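(* Let $M$ be an atomic von Neumann algebra or a compact C$^*$-algebra, and let $L$ be a locally compact Hausdorff space. Then every weak-2-local derivation on $C_0(L,M)$ is a linear derivation. In particular, for every complex Hilbert space $H$, every weak-2-local derivation on $C_0(L,B(H))$ or on $C_0(L,K(H))$ is a linear derivation.
   Context: All C$^*$-algebras are complex. $B(H)$ is the algebra of bounded linear operators on $H$ and $K(H)$ the C$^*$-algebra of compact operators on $H$. An atomic von Neumann algebra is (up to isomorphism) an $\ell_\infty$-direct sum of algebras $B(H_i)$; a compact C$^*$-algebra is (up to isomorphism) a $c_0$-direct sum of algebras $K(H_i)$, with $H_i$ complex Hilbert spaces. $C_0(L,A)$ is the C$^*$-algebra of all continuous functions $X:L\to A$ vanishing at infinity, with pointwise operations and the supremum norm. A derivation on a C$^*$-algebra $B$ is a linear map $D:B\to B$ with $D(ab)=D(a)b+aD(b)$ for all $a,b\in B$. A (not necessarily linear nor continuous) mapping $\Delta:B\to B$ is a weak-2-local derivation on $B$ if for every $x,y\in B$ and every $\phi$ in the dual space $B^*$ there is a derivation $D_{x,y,\phi}$ on $B$, depending on $x,y$ and $\phi$, such that $\phi(\Delta(x))=\phi(D_{x,y,\phi}(x))$ and $\phi(\Delta(y))=\phi(D_{x,y,\phi}(y))$. *)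

theory Defs
  imports "HOL-Analysis.Analysis" "HOL-Algebra.Module"
begin

text \<open>
  Spaces and algebras are records with explicit carriers, in the style of HOL-Algebra, so that
  families \<open>H i\<close> of Hilbert spaces and their direct sums can be formed. Some fields of the \<open>ring\<close>
  record have no meaning here (\<open>mult\<close> and \<open>one\<close> of a Hilbert space, \<open>one\<close> of a possibly
  non-unital algebra); no axiom, isomorphism, derivation or functional refers to them.
  Functions are extensional: they take the value \<^const>\<open>undefined\<close> outside their domain, so that
  equality in a function space is equality on the domain.
\<close>

definition complex_ring :: "complex ring" where
  "complex_ring = \<lparr>carrier = UNIV, mult = (*), one = 1, zero = 0, add = (+)\<rparr>"


section \<open>Complex Hilbert spaces\<close>

record 'h hilbert = "(complex, 'h) module" +
  cinner :: "'h \<Rightarrow> 'h \<Rightarrow> complex"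

definition hnorm :: "('h, 'm) hilbert_scheme \<Rightarrow> 'h \<Rightarrow> real" where
  "hnorm H x = sqrt (Re (cinner H x x))"

text \<open>
  \<^locale>\<open>Metric_space\<close> requires symmetry and non-negativity of the distance on the whole type,
  hence the value 0 off the carrier, here and for algebras below.
\<close>

definition hdist :: "('h, 'm) hilbert_scheme \<Rightarrow> 'h \<Rightarrow> 'h \<Rightarrow> real" where
  "hdist H x y = (if x \<in> carrier H \<and> y \<in> carrier H then hnorm H (x \<ominus>\<^bsub>H\<^esub> y) else 0)"

definition hilbert_topology :: "('h, 'm) hilbert_scheme \<Rightarrow> 'h topology" where
  "hilbert_topology H = Metric_space.mtopology (carrier H) (hdist H)"

locale complex_hilbert_space = Module.module complex_ring H for H (structure) +
  assumes cinner_add_left: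
      "\<lbrakk>x \<in> carrier H; y \<in> carrier H; z \<in> carrier H\<rbrakk>
        \<Longrightarrow> cinner H (x \<oplus> y) z = cinner H x z + cinner H y z"
    and cinner_smult_left:
      "\<lbrakk>x \<in> carrier H; y \<in> carrier H\<rbrakk> \<Longrightarrow> cinner H (c \<odot> x) y = c * cinner H x y"
    and cinner_commute:
      "\<lbrakk>x \<in> carrier H; y \<in> carrier H\<rbrakk> \<Longrightarrow> cinner H y x = cnj (cinner H x y)"
    and cinner_pos:
      "\<lbrakk>x \<in> carrier H; x \<noteq> \<zero>\<rbrakk> \<Longrightarrow> 0 < Re (cinner H x x)"
    and hilbert_complete: "Metric_space.mcomplete (carrier H) (hdist H)"


section \<open>C*-algebras\<close>

record 'a cstar = "(complex, 'a) module" +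
  star :: "'a \<Rightarrow> 'a"
  nrm :: "'a \<Rightarrow> real"

definition cstar_dist :: "('a, 'm) cstar_scheme \<Rightarrow> 'a \<Rightarrow> 'a \<Rightarrow> real" where
  "cstar_dist A x y = (if x \<in> carrier A \<and> y \<in> carrier A then nrm A (x \<ominus>\<^bsub>A\<^esub> y) else 0)"

definition norm_topology :: "('a, 'm) cstar_scheme \<Rightarrow> 'a topology" where
  "norm_topology A = Metric_space.mtopology (carrier A) (cstar_dist A)"

locale cstar_algebra = Module.module complex_ring A for A (structure) +
  assumes mult_closed: "\<lbrakk>x \<in> carrier A; y \<in> carrier A\<rbrakk> \<Longrightarrow> x \<otimes> y \<in> carrier A"
    and mult_assoc:
      "\<lbrakk>x \<in> carrier A; y \<in> carrier A; z \<in> carrier A\<rbrakk> \<Longrightarrow> (x \<otimes> y) \<otimes> z = x \<otimes> (y \<otimes> z)"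
    and mult_distr_left:
      "\<lbrakk>x \<in> carrier A; y \<in> carrier A; z \<in> carrier A\<rbrakk> \<Longrightarrow> (x \<oplus> y) \<otimes> z = x \<otimes> z \<oplus> y \<otimes> z"
    and mult_distr_right:
      "\<lbrakk>x \<in> carrier A; y \<in> carrier A; z \<in> carrier A\<rbrakk> \<Longrightarrow> z \<otimes> (x \<oplus> y) = z \<otimes> x \<oplus> z \<otimes> y"
    and smult_mult_left:
      "\<lbrakk>x \<in> carrier A; y \<in> carrier A\<rbrakk> \<Longrightarrow> (c \<odot> x) \<otimes> y = c \<odot> (x \<otimes> y)"
    and smult_mult_right:
      "\<lbrakk>x \<in> carrier A; y \<in> carrier A\<rbrakk> \<Longrightarrow> x \<otimes> (c \<odot> y) = c \<odot> (x \<otimes> y)"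
    and star_closed: "x \<in> carrier A \<Longrightarrow> star A x \<in> carrier A"
    and star_star: "x \<in> carrier A \<Longrightarrow> star A (star A x) = x"
    and star_add:
      "\<lbrakk>x \<in> carrier A; y \<in> carrier A\<rbrakk> \<Longrightarrow> star A (x \<oplus> y) = star A x \<oplus> star A y"
    and star_smult: "x \<in> carrier A \<Longrightarrow> star A (c \<odot> x) = cnj c \<odot> star A x"
    and star_mult:
      "\<lbrakk>x \<in> carrier A; y \<in> carrier A\<rbrakk> \<Longrightarrow> star A (x \<otimes> y) = star A y \<otimes> star A x"
    and nrm_eq_zero: "x \<in> carrier A \<Longrightarrow> nrm A x = 0 \<longleftrightarrow> x = \<zero>"
    and nrm_triangle:
      "\<lbrakk>x \<in> carrier A; y \<in> carrier A\<rbrakk> \<Longrightarrow> nrm A (x \<oplus> y) \<le> nrm A x + nrm A y"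
    and nrm_smult: "x \<in> carrier A \<Longrightarrow> nrm A (c \<odot> x) = cmod c * nrm A x"
    and nrm_mult:
      "\<lbrakk>x \<in> carrier A; y \<in> carrier A\<rbrakk> \<Longrightarrow> nrm A (x \<otimes> y) \<le> nrm A x * nrm A y"
    and cstar_identity: "x \<in> carrier A \<Longrightarrow> nrm A (star A x \<otimes> x) = (nrm A x)\<^sup>2"
    and cstar_complete: "Metric_space.mcomplete (carrier A) (cstar_dist A)"

definition star_isomorphism ::
    "('a, 'm) cstar_scheme \<Rightarrow> ('b, 'n) cstar_scheme \<Rightarrow> ('a \<Rightarrow> 'b) \<Rightarrow> bool" where
  "star_isomorphism A B f \<longleftrightarrow>
     bij_betw f (carrier A) (carrier B) \<and>
     (\<forall>x\<in>carrier A. \<forall>y\<in>carrier A. f (x \<oplus>\<^bsub>A\<^esub> y) = f x \<oplus>\<^bsub>B\<^esub> f y) \<and>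
     (\<forall>c. \<forall>x\<in>carrier A. f (c \<odot>\<^bsub>A\<^esub> x) = c \<odot>\<^bsub>B\<^esub> f x) \<and>
     (\<forall>x\<in>carrier A. \<forall>y\<in>carrier A. f (x \<otimes>\<^bsub>A\<^esub> y) = f x \<otimes>\<^bsub>B\<^esub> f y) \<and>
     (\<forall>x\<in>carrier A. f (star A x) = star B (f x))"

definition star_isomorphic :: "('a, 'm) cstar_scheme \<Rightarrow> ('b, 'n) cstar_scheme \<Rightarrow> bool" where
  "star_isomorphic A B \<longleftrightarrow> (\<exists>f. star_isomorphism A B f)"


section \<open>The algebras B(H) and K(H)\<close>

definition is_bounded_operator :: "('h, 'm) hilbert_scheme \<Rightarrow> ('h \<Rightarrow> 'h) \<Rightarrow> bool" where
  "is_bounded_operator H T \<longleftrightarrow>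
     T \<in> carrier H \<rightarrow>\<^sub>E carrier H \<and>
     (\<forall>x\<in>carrier H. \<forall>y\<in>carrier H. T (x \<oplus>\<^bsub>H\<^esub> y) = T x \<oplus>\<^bsub>H\<^esub> T y) \<and>
     (\<forall>c. \<forall>x\<in>carrier H. T (c \<odot>\<^bsub>H\<^esub> x) = c \<odot>\<^bsub>H\<^esub> T x) \<and>
     (\<exists>K. \<forall>x\<in>carrier H. hnorm H (T x) \<le> K * hnorm H x)"

definition operator_norm :: "('h, 'm) hilbert_scheme \<Rightarrow> ('h \<Rightarrow> 'h) \<Rightarrow> real" where
  "operator_norm H T = (SUP x\<in>{x \<in> carrier H. hnorm H x \<le> 1}. hnorm H (T x))"

text \<open>The adjoint exists and is unique for every bounded operator on a Hilbert space.\<close>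

definition operator_adjoint :: "('h, 'm) hilbert_scheme \<Rightarrow> ('h \<Rightarrow> 'h) \<Rightarrow> 'h \<Rightarrow> 'h" where
  "operator_adjoint H T = (THE S. is_bounded_operator H S \<and>
     (\<forall>x\<in>carrier H. \<forall>y\<in>carrier H. cinner H (T x) y = cinner H x (S y)))"

definition bounded_operators :: "('h, 'm) hilbert_scheme \<Rightarrow> ('h \<Rightarrow> 'h) cstar" where
  "bounded_operators H =
     \<lparr>carrier = {T. is_bounded_operator H T},
      mult = (\<lambda>S T. \<lambda>x\<in>carrier H. S (T x)),
      one = (\<lambda>x\<in>carrier H. x),
      zero = (\<lambda>x\<in>carrier H. \<zero>\<^bsub>H\<^esub>),
      add = (\<lambda>S T. \<lambda>x\<in>carrier H. S x \<oplus>\<^bsub>H\<^esub> T x),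
      smult = (\<lambda>c T. \<lambda>x\<in>carrier H. c \<odot>\<^bsub>H\<^esub> T x),
      star = operator_adjoint H,
      nrm = operator_norm H\<rparr>"

definition is_compact_operator :: "('h, 'm) hilbert_scheme \<Rightarrow> ('h \<Rightarrow> 'h) \<Rightarrow> bool" where
  "is_compact_operator H T \<longleftrightarrow>
     is_bounded_operator H T \<and>
     compactin (hilbert_topology H)
       (Abstract_Topology.closure_of (hilbert_topology H) (T ` {x \<in> carrier H. hnorm H x \<le> 1}))"

definition compact_operators :: "('h, 'm) hilbert_scheme \<Rightarrow> ('h \<Rightarrow> 'h) cstar" where
  "compact_operators H = (bounded_operators H) \<lparr>carrier := {T. is_compact_operator H T}\<rparr>"


section \<open>Direct sums\<close>

text \<open>
  The 0 inserted in the suprema below only matters for an empty index set or an empty space.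
\<close>

definition linf_sum :: "'i set \<Rightarrow> ('i \<Rightarrow> ('a, 'm) cstar_scheme) \<Rightarrow> ('i \<Rightarrow> 'a) cstar" where
  "linf_sum I A =
     \<lparr>carrier = {x \<in> \<Pi>\<^sub>E i\<in>I. carrier (A i). bdd_above ((\<lambda>i. nrm (A i) (x i)) ` I)},
      mult = (\<lambda>x y. \<lambda>i\<in>I. x i \<otimes>\<^bsub>A i\<^esub> y i),
      one = (\<lambda>i\<in>I. \<one>\<^bsub>A i\<^esub>),
      zero = (\<lambda>i\<in>I. \<zero>\<^bsub>A i\<^esub>),
      add = (\<lambda>x y. \<lambda>i\<in>I. x i \<oplus>\<^bsub>A i\<^esub> y i),
      smult = (\<lambda>c x. \<lambda>i\<in>I. c \<odot>\<^bsub>A i\<^esub> x i),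
      star = (\<lambda>x. \<lambda>i\<in>I. star (A i) (x i)),
      nrm = (\<lambda>x. Sup (insert 0 ((\<lambda>i. nrm (A i) (x i)) ` I)))\<rparr>"

definition c0_sum :: "'i set \<Rightarrow> ('i \<Rightarrow> ('a, 'm) cstar_scheme) \<Rightarrow> ('i \<Rightarrow> 'a) cstar" where
  "c0_sum I A = (linf_sum I A)
     \<lparr>carrier := {x \<in> \<Pi>\<^sub>E i\<in>I. carrier (A i). \<forall>\<epsilon>>0. finite {i \<in> I. \<epsilon> \<le> nrm (A i) (x i)}}\<rparr>"

definition atomic_von_neumann_algebra ::
    "'i set \<Rightarrow> ('i \<Rightarrow> 'h hilbert) \<Rightarrow> 'a cstar \<Rightarrow> bool" where
  "atomic_von_neumann_algebra I H M \<longleftrightarrow>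
     cstar_algebra M \<and> (\<forall>i\<in>I. complex_hilbert_space (H i)) \<and>
     star_isomorphic M (linf_sum I (\<lambda>i. bounded_operators (H i)))"

definition compact_cstar_algebra ::
    "'i set \<Rightarrow> ('i \<Rightarrow> 'h hilbert) \<Rightarrow> 'a cstar \<Rightarrow> bool" where
  "compact_cstar_algebra I H M \<longleftrightarrow>
     cstar_algebra M \<and> (\<forall>i\<in>I. complex_hilbert_space (H i)) \<and>
     star_isomorphic M (c0_sum I (\<lambda>i. compact_operators (H i)))"


section \<open>The algebra of continuous functions vanishing at infinity\<close>

definition C0 :: "'l topology \<Rightarrow> ('a, 'm) cstar_scheme \<Rightarrow> ('l \<Rightarrow> 'a) cstar" where
  "C0 L A =
     \<lparr>carrier = {X \<in> extensional (topspace L).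
        continuous_map L (norm_topology A) X \<and>
        (\<forall>\<epsilon>>0. \<exists>K. compactin L K \<and> (\<forall>t \<in> topspace L - K. nrm A (X t) < \<epsilon>))},
      mult = (\<lambda>X Y. \<lambda>t\<in>topspace L. X t \<otimes>\<^bsub>A\<^esub> Y t),
      one = (\<lambda>t\<in>topspace L. \<one>\<^bsub>A\<^esub>),
      zero = (\<lambda>t\<in>topspace L. \<zero>\<^bsub>A\<^esub>),
      add = (\<lambda>X Y. \<lambda>t\<in>topspace L. X t \<oplus>\<^bsub>A\<^esub> Y t),
      smult = (\<lambda>c X. \<lambda>t\<in>topspace L. c \<odot>\<^bsub>A\<^esub> X t),
      star = (\<lambda>X. \<lambda>t\<in>topspace L. star A (X t)),
      nrm = (\<lambda>X. Sup (insert 0 ((\<lambda>t. nrm A (X t)) ` topspace L)))\<rparr>"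


section \<open>Derivations and weak-2-local derivations\<close>

definition derivation :: "('b, 'm) cstar_scheme \<Rightarrow> ('b \<Rightarrow> 'b) \<Rightarrow> bool" where
  "derivation B D \<longleftrightarrow>
     D \<in> carrier B \<rightarrow> carrier B \<and>
     (\<forall>a\<in>carrier B. \<forall>b\<in>carrier B. D (a \<oplus>\<^bsub>B\<^esub> b) = D a \<oplus>\<^bsub>B\<^esub> D b) \<and>
     (\<forall>c. \<forall>a\<in>carrier B. D (c \<odot>\<^bsub>B\<^esub> a) = c \<odot>\<^bsub>B\<^esub> D a) \<and>
     (\<forall>a\<in>carrier B. \<forall>b\<in>carrier B. D (a \<otimes>\<^bsub>B\<^esub> b) = D a \<otimes>\<^bsub>B\<^esub> b \<oplus>\<^bsub>B\<^esub> a \<otimes>\<^bsub>B\<^esub> D b)"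

definition dual_space :: "('b, 'm) cstar_scheme \<Rightarrow> ('b \<Rightarrow> complex) set" where
  "dual_space B = {\<phi>.
     (\<forall>a\<in>carrier B. \<forall>b\<in>carrier B. \<phi> (a \<oplus>\<^bsub>B\<^esub> b) = \<phi> a + \<phi> b) \<and>
     (\<forall>c. \<forall>a\<in>carrier B. \<phi> (c \<odot>\<^bsub>B\<^esub> a) = c * \<phi> a) \<and>
     (\<exists>K. \<forall>a\<in>carrier B. cmod (\<phi> a) \<le> K * nrm B a)}"

definition weak_2_local_derivation :: "('b, 'm) cstar_scheme \<Rightarrow> ('b \<Rightarrow> 'b) \<Rightarrow> bool" where
  "weak_2_local_derivation B \<Delta> \<longleftrightarrow>
     \<Delta> \<in> carrier B \<rightarrow> carrier B \<and>
     (\<forall>x\<in>carrier B. \<forall>y\<in>carrier B. \<forall>\<phi>\<in>dual_space B.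
        \<exists>D. derivation B D \<and> \<phi> (\<Delta> x) = \<phi> (D x) \<and> \<phi> (\<Delta> y) = \<phi> (D y))"

end

theory Submission
  imports Defs
begin

text \<open>
  Fix a point \<open>t\<close> of \<open>L\<close> and a summand with Hilbert space \<open>H\<close>, so that every element \<open>X\<close> gives
  an operator \<open>x\<close> on \<open>H\<close>. Every derivation acts at \<open>t\<close> as a commutator \<open>[a, x]\<close> with a linear,
  possibly unbounded, \<open>a\<close>; hence the trace of \<open>c [a, c]\<close> vanishes for every \<open>c\<close> of finite rank, and
  the trace of \<open>c \<Delta>(c)\<close> vanishes for a weak-2-local derivation \<open>\<Delta>\<close>. Applied to \<open>c\<close>, \<open>x\<close> and to
  the pair with the functional of \<open>c + x\<close>, this gives
  \<open>tr (c \<Delta>(x)) = - tr (x \<Delta>(c))\<close>, whose right side is linear in \<open>x\<close>.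
  For operators \<open>c\<close>, \<open>x\<close> of rank one the same identity shows that the form \<open>tr (c \<Delta>(x))\<close> vanishes
  when \<open>c x = x c = 0\<close>, which forces \<open>\<Delta>(x) = [a, x]\<close> for one \<open>a\<close>, first for rank one and then
  for all \<open>x\<close>. Neither adjoints nor continuity of the isomorphisms are needed, because a matrix
  coefficient \<open>\<lambda>\<close> satisfies \<open>u x v = \<lambda>(x) p\<close> with \<open>u\<close>, \<open>v\<close>, \<open>p\<close> of rank one and is therefore bounded.
\<close>

section \<open>Normed complex modules\<close>

text \<open>The hypothesis gives a derivation that depends on the functional and serves two elements
  at a time. Each use of it can therefore only compare values of one functional on two elements,
  which is why the argument runs through coefficients and traces, and why an operator
  \<open>a\<close> for \<open>\<Delta>\<close> appears only at its end. For the pair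
  \<open>c\<close>, \<open>x\<close>, a common \<open>D\<close> gives \<phi>(\<Delta>(c)) +
  \<phi>(\<Delta>(x)) = \<phi>(D(c + x)), so the additivity of \<open>D\<close> stands in for the
  missing additivity of \<open>\<Delta>\<close>. A derivation of C_0(L,A) is not assumed to be
  continuous, nor to act pointwise. That the action of D(X)(t) depends on that of X(t) alone rests
  on writing a scalar function that vanishes at t as a product of two such functions. Then D is a
  commutator at t by the formula a(\<xi>) = D(E \<xi>)(t) e, where e is a unit vector and E \<xi>
  lifts the operator \<open>rank1 \<xi> e\<close>; the formula gives no bound on \<open>a\<close>.
  Traces are therefore expanded along finitely many functionals and vectors, and a general operator
  is replaced by one of finite rank before a trace is taken.\<close>

lemma complex_ring_simps [simp]:
  "carrier complex_ring = UNIV" "add complex_ring = (+)" "mult complex_ring = (*)"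
  "zero complex_ring = 0" "one complex_ring = 1"
  by (simp_all add: complex_ring_def)

locale complex_module = Module.module complex_ring V for V (structure)
begin

lemma scale_closed [simp, intro]: "x \<in> carrier V \<Longrightarrow> c \<odot> x \<in> carrier V"
  using smult_closed by simp

lemma scale_add_left: "x \<in> carrier V \<Longrightarrow> (a + b) \<odot> x = a \<odot> x \<oplus> b \<odot> x"
  using smult_l_distr by simp

lemma scale_add_right:
  "x \<in> carrier V \<Longrightarrow> y \<in> carrier V \<Longrightarrow> a \<odot> (x \<oplus> y) = a \<odot> x \<oplus> a \<odot> y"
  using smult_r_distr by simp

lemma scale_scale: "x \<in> carrier V \<Longrightarrow> a \<odot> (b \<odot> x) = (a * b) \<odot> x"
  using smult_assoc1 by simp

lemma scale_one [simp]: "x \<in> carrier V \<Longrightarrow> 1 \<odot> x = x"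
  using smult_one by simp

lemma scale_zero_left [simp]: "x \<in> carrier V \<Longrightarrow> 0 \<odot> x = \<zero>"
  using smult_l_null by simp

lemma scale_zero_right [simp]: "a \<odot> \<zero> = \<zero>"
  using smult_r_null by simp

lemma minus_eq_scale: "x \<in> carrier V \<Longrightarrow> \<ominus> x = (- 1) \<odot> x"
proof -
  assume x: "x \<in> carrier V"
  have "x \<oplus> (- 1) \<odot> x = (1 + (- 1)) \<odot> x"
    using x by (simp only: scale_add_left scale_one)
  then have "x \<oplus> (- 1) \<odot> x = \<zero>"
    using x by simp
  then show ?thesis
    using x M.minus_equality[of "(- 1) \<odot> x" x] by (simp add: M.a_comm)
qed

text \<open>Differences are unfolded into \<open>\<oplus>\<close> and multiplication by -1, so that
  the rules for additive and homogeneous maps handle them as well.\<close>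

lemma diff_eq_scale:
  "x \<in> carrier V \<Longrightarrow> y \<in> carrier V \<Longrightarrow> x \<ominus> y = x \<oplus> (- 1) \<odot> y"
  by (simp add: a_minus_def minus_eq_scale)

lemma diff_self: "x \<in> carrier V \<Longrightarrow> x \<oplus> (- 1) \<odot> x = \<zero>"
  using minus_eq_scale[of x] M.r_neg[of x] by simp

lemma eq_iff_diff_zero:
  assumes "x \<in> carrier V" "y \<in> carrier V"
  shows "x = y \<longleftrightarrow> x \<oplus> (- 1) \<odot> y = \<zero>"
proof
  assume "x \<oplus> (- 1) \<odot> y = \<zero>"
  then have "(x \<oplus> (- 1) \<odot> y) \<oplus> y = y"
    using assms by simp
  then show "x = y"
    using assms diff_self[of y] by (simp add: M.a_assoc M.a_comm[of "(- 1) \<odot> y" y])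
qed (simp add: assms diff_self)

end

text \<open>Instantiated twice: by \<open>hnorm\<close> with \<open>hdist\<close> on a Hilbert space
  and by \<open>nrm\<close> with \<open>cstar_dist\<close> on an algebra. The distance is a
  parameter because both distances are defined beforehand.\<close>

locale normed_module = complex_module V for V (structure) +
  fixes N :: "'v \<Rightarrow> real" and d :: "'v \<Rightarrow> 'v \<Rightarrow> real"
  assumes N_eq_0: "x \<in> carrier V \<Longrightarrow> N x = 0 \<longleftrightarrow> x = \<zero>"
    and N_add: "x \<in> carrier V \<Longrightarrow> y \<in> carrier V \<Longrightarrow> N (x \<oplus> y) \<le> N x + N y"
    and N_scale: "x \<in> carrier V \<Longrightarrow> N (c \<odot> x) = cmod c * N x"
    and d_def: "d x y = (if x \<in> carrier V \<and> y \<in> carrier V then N (x \<ominus> y) else 0)"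
begin

lemma N_zero [simp]: "N \<zero> = 0"
  using N_eq_0 by simp

text \<open>From 0 = N(x - x) \<le> 2 N(x).\<close>

lemma N_nonneg: "x \<in> carrier V \<Longrightarrow> 0 \<le> N x"
  using N_add[of x "(- 1) \<odot> x"] N_scale[of x "- 1"] by (simp add: diff_self)

lemma d_eq: "x \<in> carrier V \<Longrightarrow> y \<in> carrier V \<Longrightarrow> d x y = N (x \<oplus> (- 1) \<odot> y)"
  by (simp add: d_def diff_eq_scale)

lemma d_commute: "d x y = d y x"
proof (cases "x \<in> carrier V \<and> y \<in> carrier V")
  case True
  then have "(- 1) \<odot> (x \<oplus> (- 1) \<odot> y) = y \<oplus> (- 1) \<odot> x"
    by (simp add: scale_add_right scale_scale M.a_comm)
  then show ?thesis
    using True N_scale[of "x \<oplus> (- 1) \<odot> y" "- 1"] by (simp add: d_eq)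
qed (auto simp: d_def)

lemma d_triangle:
  assumes "x \<in> carrier V" "y \<in> carrier V" "z \<in> carrier V"
  shows "d x z \<le> d x y + d y z"
proof -
  have "(x \<oplus> (- 1) \<odot> y) \<oplus> (y \<oplus> (- 1) \<odot> z) = x \<oplus> (((- 1) \<odot> y \<oplus> y) \<oplus> (- 1) \<odot> z)"
    using assms by (simp add: M.a_assoc)
  also have "(- 1) \<odot> y \<oplus> y = \<zero>"
    using assms by (simp add: M.a_comm diff_self)
  finally show ?thesis
    using assms N_add[of "x \<oplus> (- 1) \<odot> y" "y \<oplus> (- 1) \<odot> z"] by (simp add: d_eq)
qed

sublocale Metric_space "carrier V" d
proof
  show "0 \<le> d x y" for x y
    by (simp add: d_def N_nonneg)
  show "d x y = d y x" for x y
    by (rule d_commute)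
  show "d x y = 0 \<longleftrightarrow> x = y" if "x \<in> carrier V" "y \<in> carrier V" for x y
    using that by (simp add: d_eq N_eq_0 eq_iff_diff_zero[symmetric])
  show "d x z \<le> d x y + d y z" if "x \<in> carrier V" "y \<in> carrier V" "z \<in> carrier V" for x y z
    using that by (rule d_triangle)
qed

lemma N_diff_le:
  assumes "x \<in> carrier V" "y \<in> carrier V"
  shows "\<bar>N x - N y\<bar> \<le> d x y"
proof -
  have "d x \<zero> = N x" "d y \<zero> = N y"
    using assms by (simp_all add: d_eq)
  then show ?thesis
    using assms d_triangle[of x y \<zero>] d_triangle[of y x \<zero>] d_commute[of x y] by simp
qed

lemma d_add_le:
  assumes "x \<in> carrier V" "y \<in> carrier V" "x' \<in> carrier V" "y' \<in> carrier V"
  shows "d (x \<oplus> y) (x' \<oplus> y') \<le> d x x' + d y y'"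
proof -
  have "(x \<oplus> y) \<oplus> (- 1) \<odot> (x' \<oplus> y') = (x \<oplus> (- 1) \<odot> x') \<oplus> (y \<oplus> (- 1) \<odot> y')"
    using assms by (simp add: scale_add_right M.a_ac)
  then show ?thesis
    using assms N_add[of "x \<oplus> (- 1) \<odot> x'" "y \<oplus> (- 1) \<odot> y'"] by (simp add: d_eq)
qed

lemma d_scale:
  assumes "x \<in> carrier V" "y \<in> carrier V"
  shows "d (c \<odot> x) (c \<odot> y) = cmod c * d x y"
proof -
  have "c \<odot> x \<oplus> (- 1) \<odot> (c \<odot> y) = c \<odot> (x \<oplus> (- 1) \<odot> y)"
    using assms by (simp add: scale_add_right scale_scale)
  then show ?thesis
    using assms by (simp add: d_eq N_scale)
qed

lemma d_scale_left:
  assumes "x \<in> carrier V"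
  shows "d (a \<odot> x) (b \<odot> x) = cmod (a - b) * N x"
proof -
  have "(a - b) \<odot> x = a \<odot> x \<oplus> (- 1) \<odot> (b \<odot> x)"
    using assms scale_add_left[of x a "- b"] by (simp add: scale_scale)
  then show ?thesis
    using assms by (simp add: d_eq flip: N_scale)
qed

end

section \<open>Complex Hilbert spaces\<close>

context complex_hilbert_space
begin

sublocale complex_module H ..

lemma cinner_add_right:
  assumes "x \<in> carrier H" "y \<in> carrier H" "z \<in> carrier H"
  shows "cinner H x (y \<oplus> z) = cinner H x y + cinner H x z"
  using assms cinner_commute[of "y \<oplus> z" x] cinner_commute[of y x] cinner_commute[of z x]
  by (simp add: cinner_add_left)

lemma cinner_scale_right:
  assumes "x \<in> carrier H" "y \<in> carrier H"
  shows "cinner H x (c \<odot> y) = cnj c * cinner H x y"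
  using assms cinner_commute[of "c \<odot> y" x] cinner_commute[of y x]
  by (simp add: cinner_smult_left)

lemma cinner_zero_left [simp]:
  assumes "x \<in> carrier H"
  shows "cinner H \<zero> x = 0"
proof -
  have "cinner H (0 \<odot> \<zero>) x = 0"
    unfolding cinner_smult_left[OF M.zero_closed assms] by simp
  then show ?thesis
    by simp
qed

lemma cinner_zero_right [simp]:
  assumes "x \<in> carrier H"
  shows "cinner H x \<zero> = 0"
  using assms cinner_commute[OF M.zero_closed assms] by simp

lemmas cinner_linear = cinner_add_left cinner_smult_left cinner_add_right cinner_scale_right

lemma cinner_self: "x \<in> carrier H \<Longrightarrow> cinner H x x = of_real ((hnorm H x)\<^sup>2)"
proof -
  assume x: "x \<in> carrier H"
  have "Im (cinner H x x) = 0"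
    using arg_cong[OF cinner_commute[OF x x], of Im] by simp
  moreover have "0 \<le> Re (cinner H x x)"
    using cinner_pos[of x] x by (cases "x = \<zero>") auto
  ultimately show ?thesis
    by (simp add: hnorm_def complex_eq_iff)
qed

lemma hnorm_zero: "hnorm H \<zero> = 0"
  by (simp add: hnorm_def)

lemma hnorm_eq_0:
  assumes "x \<in> carrier H"
  shows "hnorm H x = 0 \<longleftrightarrow> x = \<zero>"
proof
  assume "hnorm H x = 0"
  then have "Re (cinner H x x) = 0"
    by (simp add: hnorm_def)
  then show "x = \<zero>"
    using cinner_pos[OF assms] by force
qed (simp add: hnorm_zero)

lemma cinner_self_eq_0: "x \<in> carrier H \<Longrightarrow> cinner H x x = 0 \<longleftrightarrow> x = \<zero>"
  by (simp add: cinner_self hnorm_eq_0)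

lemma cinner_eqI:
  assumes "x \<in> carrier H" "y \<in> carrier H"
    and "\<And>z. z \<in> carrier H \<Longrightarrow> cinner H x z = cinner H y z"
  shows "x = y"
proof -
  have "cinner H (x \<oplus> (- 1) \<odot> y) z = 0" if "z \<in> carrier H" for z
    using that assms by (simp add: cinner_linear)
  then show ?thesis
    using assms cinner_self_eq_0[of "x \<oplus> (- 1) \<odot> y"] eq_iff_diff_zero[of x y] by simp
qed

lemma hnorm_nonneg:
  assumes "x \<in> carrier H"
  shows "0 \<le> hnorm H x"
proof (cases "x = \<zero>")
  case False
  then show ?thesis
    using cinner_pos[OF assms False] by (simp add: hnorm_def)
qed (simp add: hnorm_zero)

lemma hnorm_scale: "x \<in> carrier H \<Longrightarrow> hnorm H (c \<odot> x) = cmod c * hnorm H x"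
proof -
  assume x: "x \<in> carrier H"
  have "cinner H (c \<odot> x) (c \<odot> x) = (c * cnj c) * cinner H x x"
    using x by (simp add: cinner_linear)
  then have "complex_of_real ((hnorm H (c \<odot> x))\<^sup>2) = of_real ((cmod c * hnorm H x)\<^sup>2)"
    using x by (simp only: cinner_self scale_closed complex_norm_square[symmetric]
        of_real_mult[symmetric] power_mult_distrib)
  then have "(hnorm H (c \<odot> x))\<^sup>2 = (cmod c * hnorm H x)\<^sup>2"
    using of_real_eq_iff by blast
  then show ?thesis
    using x by (simp add: hnorm_nonneg power2_eq_iff_nonneg)
qed

lemma Cauchy_Schwarz:
  assumes x: "x \<in> carrier H" and y: "y \<in> carrier H"
  shows "cmod (cinner H x y) \<le> hnorm H x * hnorm H y"
proof (cases "y = \<zero>")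
  case True
  then show ?thesis using x hnorm_eq_0[of y] y by simp
next
  case False
  define n where "n = (hnorm H y)\<^sup>2"
  define b where "b = cinner H x y"
  have n: "0 < n"
    using False hnorm_eq_0[OF y] by (simp add: n_def)
  have yx: "cinner H y x = cnj b"
    using cinner_commute[OF x y] by (simp add: b_def)
  \<comment> \<open>The component of \<open>x\<close> orthogonal to \<open>y\<close>, multiplied by
    \<open>n\<close> to avoid a division; its squared norm is \<open>n\<close> times the gap in the
    squared inequality.\<close>
  define z where "z = complex_of_real n \<odot> x \<oplus> (- b) \<odot> y"
  have z: "z \<in> carrier H"
    using x y by (simp add: z_def)
  have "cinner H z z = of_real n * (of_real n * cinner H x x - b * cnj b)"
    using x y by (simp add: z_def cinner_linear yx b_def[symmetric] cinner_self[OF y]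
        n_def algebra_simps)
  then have "complex_of_real ((hnorm H z)\<^sup>2) = of_real (n * (n * (hnorm H x)\<^sup>2 - (cmod b)\<^sup>2))"
    using x z by (simp only: cinner_self complex_norm_square[symmetric] of_real_mult of_real_diff)
  then have "(hnorm H z)\<^sup>2 = n * (n * (hnorm H x)\<^sup>2 - (cmod b)\<^sup>2)"
    using of_real_eq_iff by blast
  then have "0 \<le> n * (n * (hnorm H x)\<^sup>2 - (cmod b)\<^sup>2)"
    by (metis zero_le_power2)
  then have "(cmod b)\<^sup>2 \<le> (hnorm H x * hnorm H y)\<^sup>2"
    using n by (simp add: zero_le_mult_iff n_def power_mult_distrib mult.commute)
  then have "cmod b \<le> hnorm H x * hnorm H y"
    by (rule power2_le_imp_le) (simp add: hnorm_nonneg x y)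
  then show ?thesis
    by (simp add: b_def)
qed

lemma hnorm_triangle:
  assumes x: "x \<in> carrier H" and y: "y \<in> carrier H"
  shows "hnorm H (x \<oplus> y) \<le> hnorm H x + hnorm H y"
proof -
  have yx: "cinner H y x = cnj (cinner H x y)"
    using cinner_commute[OF x y] .
  have "cinner H (x \<oplus> y) (x \<oplus> y) = cinner H x x + cinner H y y + (cinner H x y + cnj (cinner H x y))"
    using x y by (simp add: cinner_linear yx)
  then have "complex_of_real ((hnorm H (x \<oplus> y))\<^sup>2)
      = of_real ((hnorm H x)\<^sup>2 + (hnorm H y)\<^sup>2 + 2 * Re (cinner H x y))"
    using x y by (simp only: cinner_self M.a_closed complex_add_cnj of_real_add)
  then have "(hnorm H (x \<oplus> y))\<^sup>2 = (hnorm H x)\<^sup>2 + (hnorm H y)\<^sup>2 + 2 * Re (cinner H x y)"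
    using of_real_eq_iff by blast
  also have "\<dots> \<le> (hnorm H x + hnorm H y)\<^sup>2"
    using Cauchy_Schwarz[OF x y] complex_Re_le_cmod[of "cinner H x y"]
    by (simp add: power2_eq_square algebra_simps)
  finally show ?thesis
    by (rule power2_le_imp_le) (simp add: hnorm_nonneg x y)
qed

sublocale normed_module H "hnorm H" "hdist H"
  by unfold_locales (simp_all add: hnorm_eq_0 hnorm_triangle hnorm_scale hdist_def)

text \<open>The alternative \<open>x = \<zero>\<close> stands apart because the space may be
  trivial. In the other one the rule also supplies the auxiliary unit vector \<open>e\<close> of
  later proofs.\<close>

lemma unit_multiple:
  assumes "x \<in> carrier H"
  obtains c u where "u \<in> carrier H" "hnorm H u = 1" "x = c \<odot> u" | "x = \<zero>"
proof (cases "x = \<zero>")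
  case False
  then have n: "hnorm H x \<noteq> 0"
    using assms hnorm_eq_0[OF assms] by simp
  show ?thesis
  proof (rule that(1))
    show "(1 / complex_of_real (hnorm H x)) \<odot> x \<in> carrier H"
      using assms by simp
    show "hnorm H ((1 / complex_of_real (hnorm H x)) \<odot> x) = 1"
      using assms n hnorm_nonneg[OF assms] by (simp add: hnorm_scale norm_divide)
    show "x = complex_of_real (hnorm H x) \<odot> ((1 / complex_of_real (hnorm H x)) \<odot> x)"
      using assms n by (simp add: scale_scale)
  qed
qed

text \<open>For fixed \<open>z\<close> the functional \<open>B _ z\<close> vanishes on the
  orthogonal complement of \<open>z\<close>, hence is a multiple of the inner product with
  \<open>z\<close>; likewise in the second argument at \<open>e\<close>. Comparing both at the pair
  \<open>e\<close>, \<open>z\<close> shows that the factor does not depend on \<open>z\<close>, as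
  long as \<open>z\<close> is not orthogonal to \<open>e\<close>.\<close>

lemma sesquilinear_eq_cinner:
  assumes add_left: "\<And>x y z. x \<in> carrier H \<Longrightarrow> y \<in> carrier H \<Longrightarrow> z \<in> carrier H \<Longrightarrow>
      B (x \<oplus> y) z = B x z + B y z"
    and scale_left: "\<And>c x z. x \<in> carrier H \<Longrightarrow> z \<in> carrier H \<Longrightarrow> B (c \<odot> x) z = c * B x z"
    and add_right: "\<And>x y z. x \<in> carrier H \<Longrightarrow> y \<in> carrier H \<Longrightarrow> z \<in> carrier H \<Longrightarrow>
      B x (y \<oplus> z) = B x y + B x z"
    and scale_right: "\<And>c x z. x \<in> carrier H \<Longrightarrow> z \<in> carrier H \<Longrightarrow> B x (c \<odot> z) = cnj c * B x z"
    and orth: "\<And>x z. x \<in> carrier H \<Longrightarrow> z \<in> carrier H \<Longrightarrow> cinner H x z = 0 \<Longrightarrow> B x z = 0"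
    and e: "e \<in> carrier H" "hnorm H e = 1"
    and x: "x \<in> carrier H" and z: "z \<in> carrier H"
  shows "B x z = cinner H x z * B e e"
proof -
  have ee: "cinner H e e = 1"
    using e by (simp add: cinner_self)
  have left: "B x z * cinner H z z = cinner H x z * B z z"
    if "x \<in> carrier H" "z \<in> carrier H" for x z
  proof -
    have "B (cinner H z z \<odot> x \<oplus> (- cinner H x z) \<odot> z) z = 0"
      using that by (intro orth) (auto simp: cinner_linear)
    then show ?thesis
      using that by (simp add: add_left scale_left mult.commute)
  qed
  have right: "B e z = cinner H e z * B e e" if "z \<in> carrier H" for z
  proof -
    have "B e (z \<oplus> (- cinner H z e) \<odot> e) = 0"
      using that e cinner_commute[of z e] by (intro orth) (auto simp: cinner_linear ee)
    then show ?thesis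
      using that e cinner_commute[of z e] by (simp add: add_right scale_right)
  qed
  have main: "B x z = cinner H x z * B e e"
    if "x \<in> carrier H" "z \<in> carrier H" "cinner H e z \<noteq> 0" for x z
  proof -
    have "z \<noteq> \<zero>"
      using that e by auto
    then have zz: "cinner H z z \<noteq> 0"
      using that cinner_self_eq_0 by blast
    have "B z z = cinner H z z * B e e"
      using left[of e z] right[of z] that e by (simp add: mult.commute)
    then have "B x z * cinner H z z = (cinner H x z * B e e) * cinner H z z"
      using left[of x z] that by (simp only: mult_ac)
    then show ?thesis
      using zz mult_right_cancel by blast
  qed
  show ?thesis
  proof (cases "cinner H e z = 0")
    case True
    \<comment> \<open>Neither \<open>z \<oplus> e\<close> nor \<open>e\<close> is orthogonal to
      \<open>e\<close>, and \<open>B x z\<close> is the difference of the two values.\<close>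
    have "B x (z \<oplus> e) = cinner H x (z \<oplus> e) * B e e"
      by (rule main) (simp_all add: x z e True cinner_linear ee)
    moreover have "B x e = cinner H x e * B e e"
      by (rule main) (simp_all add: x e ee)
    ultimately have "B x z + cinner H x e * B e e
        = (cinner H x z + cinner H x e) * B e e"
      using x z e by (simp add: add_right cinner_add_right)
    then show ?thesis
      by (simp add: distrib_right)
  next
    case False
    then show ?thesis
      by (rule main[OF x z])
  qed
qed

end

section \<open>Functions vanishing at infinity\<close>

text \<open>Stated for real functions, so that it applies to the norm of an algebra-valued function
  and to the modulus of a scalar function alike.\<close>

definition vanishes :: "'l topology \<Rightarrow> ('l \<Rightarrow> real) \<Rightarrow> bool" where
  "vanishes L f \<longleftrightarrow> (\<forall>\<epsilon>>0. \<exists>K. compactin L K \<and> (\<forall>t \<in> topspace L - K. f t < \<epsilon>))"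

lemma vanishes_mono:
  assumes "vanishes L f" "\<And>t. t \<in> topspace L \<Longrightarrow> g t \<le> f t"
  shows "vanishes L g"
  unfolding vanishes_def
proof (intro allI impI)
  fix \<epsilon> :: real assume "0 < \<epsilon>"
  then obtain K where "compactin L K" "\<forall>t\<in>topspace L - K. f t < \<epsilon>"
    using assms(1) unfolding vanishes_def by blast
  then show "\<exists>K. compactin L K \<and> (\<forall>t \<in> topspace L - K. g t < \<epsilon>)"
    using assms(2) by (intro exI[of _ K]) (auto intro: le_less_trans)
qed

lemma vanishes_add:
  assumes "vanishes L f" "vanishes L g"
  shows "vanishes L (\<lambda>t. f t + g t)"
  unfolding vanishes_def
proof (intro allI impI)
  fix \<epsilon> :: real assume "0 < \<epsilon>"
  then have e: "0 < \<epsilon> / 2" by simp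
  obtain K where K: "compactin L K" "\<forall>t\<in>topspace L - K. f t < \<epsilon> / 2"
    using assms(1) e unfolding vanishes_def by blast
  obtain K' where K': "compactin L K'" "\<forall>t\<in>topspace L - K'. g t < \<epsilon> / 2"
    using assms(2) e unfolding vanishes_def by blast
  show "\<exists>K. compactin L K \<and> (\<forall>t \<in> topspace L - K. f t + g t < \<epsilon>)"
  proof (intro exI[of _ "K \<union> K'"] conjI ballI)
    show "compactin L (K \<union> K')"
      using K K' compactin_Un by blast
    show "f t + g t < \<epsilon>" if "t \<in> topspace L - (K \<union> K')" for t
    proof -
      have "f t < \<epsilon> / 2" "g t < \<epsilon> / 2"
        using that K(2) K'(2) by auto
      then show ?thesis by simp
    qed
  qed
qed

lemma vanishes_scale:
  assumes "vanishes L f" "0 \<le> c"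
  shows "vanishes L (\<lambda>t. c * f t)"
  unfolding vanishes_def
proof (intro allI impI)
  fix \<epsilon> :: real assume "0 < \<epsilon>"
  \<comment> \<open>\<open>c + 1\<close> instead of \<open>c\<close>, since \<open>c\<close> may be
    0.\<close>
  then have e: "0 < \<epsilon> / (c + 1)" using assms(2) by simp
  obtain K where K: "compactin L K" "\<forall>t\<in>topspace L - K. f t < \<epsilon> / (c + 1)"
    using assms(1) e unfolding vanishes_def by blast
  show "\<exists>K. compactin L K \<and> (\<forall>t \<in> topspace L - K. c * f t < \<epsilon>)"
  proof (intro exI[of _ K] conjI ballI K(1))
    fix t assume "t \<in> topspace L - K"
    then have "f t < \<epsilon> / (c + 1)"
      using K(2) by blast
    then have "c * f t \<le> c * (\<epsilon> / (c + 1))"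
      by (intro mult_left_mono assms(2)) simp
    also have "\<dots> < \<epsilon>"
      using assms(2) \<open>0 < \<epsilon>\<close> by (simp add: field_simps)
    finally show "c * f t < \<epsilon>" .
  qed
qed

lemma vanishes_sqrt:
  assumes "vanishes L f"
  shows "vanishes L (\<lambda>t. sqrt (f t))"
  unfolding vanishes_def
proof (intro allI impI)
  fix \<epsilon> :: real assume e: "0 < \<epsilon>"
  then obtain K where K: "compactin L K" "\<forall>t\<in>topspace L - K. f t < \<epsilon>\<^sup>2"
    using assms unfolding vanishes_def by (meson zero_less_power)
  show "\<exists>K. compactin L K \<and> (\<forall>t \<in> topspace L - K. sqrt (f t) < \<epsilon>)"
  proof (intro exI[of _ K] conjI ballI K(1))
    fix t assume "t \<in> topspace L - K"
    then have "f t < \<epsilon>\<^sup>2"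
      using K(2) by blast
    then have "sqrt (f t) < sqrt (\<epsilon>\<^sup>2)"
      by (rule real_sqrt_less_mono)
    then show "sqrt (f t) < \<epsilon>"
      using e by simp
  qed
qed

definition scalar_C0 :: "'l topology \<Rightarrow> ('l \<Rightarrow> complex) \<Rightarrow> bool" where
  "scalar_C0 L k \<longleftrightarrow> continuous_map L euclidean k \<and> vanishes L (\<lambda>t. cmod (k t))"

text \<open>Continuity as a limit along \<open>atin L t\<close> opens the limit rules for real and
  complex functions to an abstract topology \<open>L\<close>.\<close>

lemma tendsto_atin: "continuous_map L euclidean k \<Longrightarrow> t \<in> topspace L \<Longrightarrow> (k \<longlongrightarrow> k t) (atin L t)"
  using limitin_continuous_map[of L euclidean k t "k t"] by simp

lemma continuous_map_euclideanI:
  "(\<And>t. t \<in> topspace L \<Longrightarrow> (k \<longlongrightarrow> k t) (atin L t)) \<Longrightarrow> continuous_map L euclidean k"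
  by (simp add: continuous_map_atin)

text \<open>Local compactness puts an open \<open>U\<close> around \<open>t\<close> inside a compact
  \<open>K\<close>. Locally compact Hausdorff spaces are completely regular, so some function is 0
  at \<open>t\<close> and 1 off \<open>U\<close>; subtracted from 1, it vanishes off
  \<open>K\<close>.\<close>

lemma bump_function:
  assumes "locally_compact_space L" "Hausdorff_space L" "t \<in> topspace L"
  obtains h where "scalar_C0 L h" "h t = 1" "\<And>s. cmod (h s) \<le> 1"
proof -
  obtain U K where UK: "openin L U" "compactin L K" "t \<in> U" "U \<subseteq> K"
    using assms(1,3) unfolding locally_compact_space_def by blast
  have "completely_regular_space L"
    using assms(1,2) locally_compact_regular_imp_completely_regular_space by blast
  moreover have "closedin L (topspace L - U)" "t \<in> topspace L - (topspace L - U)"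
    using UK assms(3) by auto
  ultimately obtain f :: "'a \<Rightarrow> real" where f: "continuous_map L (top_of_set {0..1}) f"
      "f t = 0" "f ` (topspace L - U) \<subseteq> {1}"
    unfolding completely_regular_space_def by (metis (no_types, lifting))
  \<comment> \<open>The truncation gives \<open>cmod (h s) \<le> 1\<close> also outside
    \<open>topspace L\<close>, where nothing is known of \<open>f\<close>.\<close>
  define h where "h s = complex_of_real (1 - max 0 (min 1 (f s)))" for s
  show thesis
  proof (rule that)
    have f': "(f \<longlongrightarrow> f t) (atin L t)" if "t \<in> topspace L" for t
      using f(1) that by (intro tendsto_atin) (auto simp: continuous_map_in_subtopology)
    have "continuous_map L euclidean h"
      unfolding h_def by (intro continuous_map_euclideanI tendsto_intros f')
    moreover have "vanishes L (\<lambda>s. cmod (h s))"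
      unfolding vanishes_def
    proof (intro allI impI exI[of _ K] conjI ballI UK)
      fix \<epsilon> :: real and s assume "0 < \<epsilon>" "s \<in> topspace L - K"
      then have "f s = 1"
        using UK f(3) by blast
      then show "cmod (h s) < \<epsilon>"
        using \<open>0 < \<epsilon>\<close> by (simp add: h_def)
    qed
    ultimately show "scalar_C0 L h"
      by (simp add: scalar_C0_def)
    show "h t = 1"
      by (simp add: h_def f)
    show "cmod (h s) \<le> 1" for s
      unfolding h_def norm_of_real by (auto simp: max_def min_def)
  qed
qed

lemma scalar_C0_mult:
  assumes "scalar_C0 L h" "scalar_C0 L k" "\<And>s. cmod (h s) \<le> 1"
  shows "scalar_C0 L (\<lambda>s. h s * k s)"
  unfolding scalar_C0_def
proof (intro conjI continuous_map_euclideanI tendsto_mult)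
  show "(h \<longlongrightarrow> h t) (atin L t)" "(k \<longlongrightarrow> k t) (atin L t)" if "t \<in> topspace L" for t
    using that assms by (auto intro: tendsto_atin simp: scalar_C0_def)
  show "vanishes L (\<lambda>t. cmod (h t * k t))"
  proof (rule vanishes_mono)
    show "vanishes L (\<lambda>t. cmod (k t))"
      using assms by (simp add: scalar_C0_def)
    show "cmod (h t * k t) \<le> cmod (k t)" for t
      using mult_right_mono[OF assms(3)[of t], of "cmod (k t)"] by (simp add: norm_mult)
  qed
qed

text \<open>The factors are sqrt|k| and k / sqrt|k|. Both have modulus sqrt|k|, which gives the
  decay at infinity and the continuity of the quotient at the zeros of \<open>k\<close>.\<close>

lemma scalar_C0_factor:
  assumes "scalar_C0 L k" "k t = 0"
  obtains k1 k2 where "scalar_C0 L k1" "scalar_C0 L k2" "k1 t = 0" "k2 t = 0"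
    "k = (\<lambda>s. k1 s * k2 s)"
proof -
  define k1 where "k1 s = complex_of_real (sqrt (cmod (k s)))" for s
  \<comment> \<open>At a zero of \<open>k\<close> the quotient by 0 is 0, the value that continuity
    demands.\<close>
  define k2 where "k2 s = k s / k1 s" for s
  have prod: "k1 s * k2 s = k s" for s
    by (simp add: k2_def k1_def)
  have norm1: "cmod (k1 s) = sqrt (cmod (k s))" for s
    by (simp add: k1_def)
  have norm2: "cmod (k2 s) = sqrt (cmod (k s))" for s
    by (simp add: k2_def norm_divide norm1 real_div_sqrt)
  have kt: "(k \<longlongrightarrow> k s) (atin L s)" if "s \<in> topspace L" for s
    using that assms(1) by (simp add: scalar_C0_def tendsto_atin)
  have van: "vanishes L (\<lambda>s. sqrt (cmod (k s)))"
    using assms(1) by (simp add: scalar_C0_def vanishes_sqrt)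
  have k1t: "(k1 \<longlongrightarrow> k1 s) (atin L s)" if "s \<in> topspace L" for s
    unfolding k1_def by (intro tendsto_intros kt that)
  have k2t: "(k2 \<longlongrightarrow> k2 s) (atin L s)" if "s \<in> topspace L" for s
  proof (cases "k s = 0")
    case True
    have "((\<lambda>s. sqrt (cmod (k s))) \<longlongrightarrow> sqrt (cmod (k s))) (atin L s)"
      by (intro tendsto_intros kt that)
    then have "((\<lambda>s. cmod (k2 s)) \<longlongrightarrow> 0) (atin L s)"
      by (simp add: norm2 True)
    then have "(k2 \<longlongrightarrow> 0) (atin L s)"
      by (rule tendsto_norm_zero_cancel)
    moreover have "k2 s = 0"
      by (simp add: k2_def True)
    ultimately show ?thesis
      by simp
  next
    case False
    then have "k1 s \<noteq> 0"
      by (simp add: k1_def)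
    then show ?thesis
      unfolding k2_def by (intro tendsto_divide kt k1t that)
  qed
  show thesis
  proof (rule that)
    show "scalar_C0 L k1" "scalar_C0 L k2"
      using van k1t k2t by (auto simp: scalar_C0_def norm1 norm2 intro: continuous_map_euclideanI)
    show "k1 t = 0" "k2 t = 0"
      by (simp_all add: k1_def k2_def assms(2))
    show "k = (\<lambda>s. k1 s * k2 s)"
      by (simp add: prod)
  qed
qed

section \<open>Normed algebras and the algebra of continuous functions\<close>

text \<open>The common ground of an abstract C*-algebra \<open>M\<close>, which satisfies these laws
  by its axioms, and of B(H) and K(H), for which they follow from estimates of the operator
  norm.\<close>

locale normed_algebra = complex_module A for A :: "('a, 'm) cstar_scheme" (structure) +
  assumes mult_closed [simp, intro]: "x \<in> carrier A \<Longrightarrow> y \<in> carrier A \<Longrightarrow> x \<otimes> y \<in> carrier A"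
    and mult_assoc:
      "\<lbrakk>x \<in> carrier A; y \<in> carrier A; z \<in> carrier A\<rbrakk> \<Longrightarrow> (x \<otimes> y) \<otimes> z = x \<otimes> (y \<otimes> z)"
    and mult_distr_left:
      "\<lbrakk>x \<in> carrier A; y \<in> carrier A; z \<in> carrier A\<rbrakk> \<Longrightarrow> (x \<oplus> y) \<otimes> z = x \<otimes> z \<oplus> y \<otimes> z"
    and mult_distr_right:
      "\<lbrakk>x \<in> carrier A; y \<in> carrier A; z \<in> carrier A\<rbrakk> \<Longrightarrow> z \<otimes> (x \<oplus> y) = z \<otimes> x \<oplus> z \<otimes> y"
    and smult_mult_left:
      "\<lbrakk>x \<in> carrier A; y \<in> carrier A\<rbrakk> \<Longrightarrow> (c \<odot> x) \<otimes> y = c \<odot> (x \<otimes> y)"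
    and smult_mult_right:
      "\<lbrakk>x \<in> carrier A; y \<in> carrier A\<rbrakk> \<Longrightarrow> x \<otimes> (c \<odot> y) = c \<odot> (x \<otimes> y)"
    and nrm_eq_zero: "x \<in> carrier A \<Longrightarrow> nrm A x = 0 \<longleftrightarrow> x = \<zero>"
    and nrm_triangle:
      "\<lbrakk>x \<in> carrier A; y \<in> carrier A\<rbrakk> \<Longrightarrow> nrm A (x \<oplus> y) \<le> nrm A x + nrm A y"
    and nrm_smult: "x \<in> carrier A \<Longrightarrow> nrm A (c \<odot> x) = cmod c * nrm A x"
    and nrm_mult:
      "\<lbrakk>x \<in> carrier A; y \<in> carrier A\<rbrakk> \<Longrightarrow> nrm A (x \<otimes> y) \<le> nrm A x * nrm A y"
begin

sublocale normed_module A "nrm A" "cstar_dist A"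
  by unfold_locales (simp_all add: nrm_eq_zero nrm_triangle nrm_smult cstar_dist_def)

text \<open>The condition of \<open>dual_space\<close> with a nonnegative constant, so that it can
  be multiplied with other bounds.\<close>

definition bounded_functional :: "('a \<Rightarrow> complex) \<Rightarrow> bool" where
  "bounded_functional \<psi> \<longleftrightarrow>
     (\<forall>a\<in>carrier A. \<forall>b\<in>carrier A. \<psi> (a \<oplus> b) = \<psi> a + \<psi> b) \<and>
     (\<forall>c. \<forall>a\<in>carrier A. \<psi> (c \<odot> a) = c * \<psi> a) \<and>
     (\<exists>K\<ge>0. \<forall>a\<in>carrier A. cmod (\<psi> a) \<le> K * nrm A a)"

lemma bounded_functionalD:
  assumes "bounded_functional \<psi>"
  shows "\<And>a b. a \<in> carrier A \<Longrightarrow> b \<in> carrier A \<Longrightarrow> \<psi> (a \<oplus> b) = \<psi> a + \<psi> b"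
    "\<And>c a. a \<in> carrier A \<Longrightarrow> \<psi> (c \<odot> a) = c * \<psi> a"
  using assms by (auto simp: bounded_functional_def)

lemma bounded_functional_add:
  assumes "bounded_functional \<psi>" "bounded_functional \<rho>"
  shows "bounded_functional (\<lambda>m. \<psi> m + \<rho> m)"
proof -
  obtain K K' where K: "0 \<le> K" "\<And>a. a\<in>carrier A \<Longrightarrow> cmod (\<psi> a) \<le> K * nrm A a"
      "0 \<le> K'" "\<And>a. a\<in>carrier A \<Longrightarrow> cmod (\<rho> a) \<le> K' * nrm A a"
    using assms unfolding bounded_functional_def by blast
  have "cmod (\<psi> a + \<rho> a) \<le> (K + K') * nrm A a" if "a \<in> carrier A" for a
    using K(2)[OF that] K(4)[OF that] norm_triangle_ineq[of "\<psi> a" "\<rho> a"]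
    unfolding distrib_right by linarith
  then show ?thesis
    using bounded_functionalD[OF assms(1)] bounded_functionalD[OF assms(2)] K(1,3)
    unfolding bounded_functional_def
    by (intro conjI exI[of _ "K + K'"]) (simp_all add: distrib_left)
qed

lemma bounded_functional_scale:
  assumes "bounded_functional \<psi>"
  shows "bounded_functional (\<lambda>m. c * \<psi> m)"
proof -
  obtain K where K: "0 \<le> K" "\<And>a. a\<in>carrier A \<Longrightarrow> cmod (\<psi> a) \<le> K * nrm A a"
    using assms unfolding bounded_functional_def by blast
  have "cmod (c * \<psi> a) \<le> (cmod c * K) * nrm A a" if "a \<in> carrier A" for a
    using mult_left_mono[OF K(2)[OF that], of "cmod c"] by (simp add: norm_mult mult.assoc)
  then show ?thesis
    using bounded_functionalD[OF assms] K(1) unfolding bounded_functional_def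
    by (intro conjI exI[of _ "cmod c * K"]) (simp_all add: distrib_left)
qed

lemma bounded_functional_mult_left:
  assumes "bounded_functional \<psi>" "x \<in> carrier A"
  shows "bounded_functional (\<lambda>m. \<psi> (x \<otimes> m))"
proof -
  obtain K where K: "0 \<le> K" "\<And>a. a\<in>carrier A \<Longrightarrow> cmod (\<psi> a) \<le> K * nrm A a"
    using assms(1) unfolding bounded_functional_def by blast
  have "cmod (\<psi> (x \<otimes> a)) \<le> (K * nrm A x) * nrm A a" if "a \<in> carrier A" for a
    using K(2)[of "x \<otimes> a"] mult_left_mono[OF nrm_mult[OF assms(2) that] K(1)] that assms(2)
    by (simp add: mult.assoc)
  then show ?thesis
    using bounded_functionalD[OF assms(1)] K(1) assms(2) N_nonneg unfolding bounded_functional_def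
    by (intro conjI exI[of _ "K * nrm A x"]) (simp_all add: mult_distr_right smult_mult_right)
qed

section \<open>Continuity in norm and the closure properties of C_0(L,A)\<close>

lemma continuous_mapD:
  assumes "continuous_map L (norm_topology A) X" "t \<in> topspace L"
  shows "((\<lambda>s. cstar_dist A (X s) (X t)) \<longlongrightarrow> 0) (atin L t)"
proof -
  have "limitin mtopology X (X t) (atin L t)"
    using assms by (simp add: norm_topology_def limitin_continuous_map)
  then show ?thesis
    unfolding limitin_metric tendsto_iff
    by (auto simp: dist_real_def elim!: eventually_mono)
qed

text \<open>The comparison function \<open>g t\<close> moves continuity proofs for algebra-valued
  functions into limit rules for real functions.\<close>

lemma continuous_mapI:
  assumes X: "\<And>s. s \<in> topspace L \<Longrightarrow> X s \<in> carrier A"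
    and lim: "\<And>t. t \<in> topspace L \<Longrightarrow> (g t \<longlongrightarrow> 0) (atin L t)"
    and le: "\<And>s t. s \<in> topspace L \<Longrightarrow> t \<in> topspace L \<Longrightarrow> cstar_dist A (X s) (X t) \<le> g t s"
  shows "continuous_map L (norm_topology A) X"
  unfolding norm_topology_def continuous_map_atin limitin_metric
proof (intro ballI conjI allI impI)
  fix t assume t: "t \<in> topspace L"
  then show "X t \<in> carrier A"
    by (rule X)
  fix \<epsilon> :: real assume "0 < \<epsilon>"
  then have "\<forall>\<^sub>F s in atin L t. g t s < \<epsilon>"
    using order_tendstoD(2)[OF lim[OF t]] by blast
  moreover have "\<forall>\<^sub>F s in atin L t. s \<in> topspace L"
    by (auto simp: eventually_atin)
  ultimately show "\<forall>\<^sub>F s in atin L t. X s \<in> carrier A \<and> cstar_dist A (X s) (X t) < \<epsilon>"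
  proof eventually_elim
    case (elim s)
    then show ?case
      using X le[OF elim(2) t] by auto
  qed
qed

lemma C0_simps:
  "X \<oplus>\<^bsub>C0 L A\<^esub> Y = (\<lambda>t\<in>topspace L. X t \<oplus> Y t)"
  "X \<otimes>\<^bsub>C0 L A\<^esub> Y = (\<lambda>t\<in>topspace L. X t \<otimes> Y t)"
  "c \<odot>\<^bsub>C0 L A\<^esub> X = (\<lambda>t\<in>topspace L. c \<odot> X t)"
  by (simp_all add: C0_def)

lemma C0_iff:
  "X \<in> carrier (C0 L A) \<longleftrightarrow> X \<in> extensional (topspace L) \<and>
     continuous_map L (norm_topology A) X \<and> vanishes L (\<lambda>t. nrm A (X t))"
  by (simp add: C0_def vanishes_def)

lemma C0_closed: "X \<in> carrier (C0 L A) \<Longrightarrow> t \<in> topspace L \<Longrightarrow> X t \<in> carrier A"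
  unfolding C0_iff norm_topology_def by (metis continuous_map_image_subset_topspace
      image_subset_iff topspace_mtopology)

lemma C0_I:
  assumes X: "\<And>s. s \<in> topspace L \<Longrightarrow> X s \<in> carrier A"
    and lim: "\<And>t. t \<in> topspace L \<Longrightarrow> (g t \<longlongrightarrow> 0) (atin L t)"
    and le: "\<And>s t. s \<in> topspace L \<Longrightarrow> t \<in> topspace L \<Longrightarrow> cstar_dist A (X s) (X t) \<le> g t s"
    and v: "vanishes L f" and vle: "\<And>s. s \<in> topspace L \<Longrightarrow> nrm A (X s) \<le> f s"
  shows "(\<lambda>s\<in>topspace L. X s) \<in> carrier (C0 L A)"
  unfolding C0_iff
proof (intro conjI restrict_extensional)
  show "continuous_map L (norm_topology A) (\<lambda>s\<in>topspace L. X s)"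
    using X le by (intro continuous_mapI[OF _ lim]) simp_all
  show "vanishes L (\<lambda>t. nrm A ((\<lambda>s\<in>topspace L. X s) t))"
    using vle by (intro vanishes_mono[OF v]) simp
qed

lemma C0_add_closed:
  assumes X: "X \<in> carrier (C0 L A)" and Y: "Y \<in> carrier (C0 L A)"
  shows "X \<oplus>\<^bsub>C0 L A\<^esub> Y \<in> carrier (C0 L A)"
  unfolding C0_simps
proof (rule C0_I)
  show "((\<lambda>s. cstar_dist A (X s) (X t) + cstar_dist A (Y s) (Y t)) \<longlongrightarrow> 0) (atin L t)"
    if "t \<in> topspace L" for t
    using X Y that by (intro tendsto_add_zero continuous_mapD) (auto simp: C0_iff)
  show "vanishes L (\<lambda>t. nrm A (X t) + nrm A (Y t))"
    using X Y by (intro vanishes_add) (auto simp: C0_iff)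
qed (simp_all add: C0_closed[OF X] C0_closed[OF Y] d_add_le nrm_triangle)

lemma C0_scale_closed:
  assumes X: "X \<in> carrier (C0 L A)"
  shows "c \<odot>\<^bsub>C0 L A\<^esub> X \<in> carrier (C0 L A)"
  unfolding C0_simps
proof (rule C0_I)
  show "((\<lambda>s. cmod c * cstar_dist A (X s) (X t)) \<longlongrightarrow> 0) (atin L t)"
    if "t \<in> topspace L" for t
    using X that by (intro tendsto_mult_right_zero continuous_mapD) (auto simp: C0_iff)
  show "vanishes L (\<lambda>t. cmod c * nrm A (X t))"
    using X by (intro vanishes_scale) (auto simp: C0_iff)
qed (simp_all add: C0_closed[OF X] d_scale nrm_smult)

text \<open>Outside a compact set the norm is below 1, and the image of that set is compact, hence
  contained in a ball.\<close>

lemma C0_bounded: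
  assumes X: "X \<in> carrier (C0 L A)"
  obtains B where "0 \<le> B" "\<And>t. t \<in> topspace L \<Longrightarrow> nrm A (X t) \<le> B"
proof -
  obtain K where K: "compactin L K" "\<forall>t\<in>topspace L - K. nrm A (X t) < 1"
    using X zero_less_one unfolding C0_iff vanishes_def by blast
  have KL: "K \<subseteq> topspace L"
    using K(1) compactin_subset_topspace by blast
  have "compactin mtopology (X ` K)"
    using X K(1) image_compactin unfolding C0_iff norm_topology_def by blast
  then have "mbounded (X ` K)"
    by (rule compactin_imp_mbounded)
  then obtain x B where x: "X ` K \<subseteq> mcball x B"
    unfolding mbounded_def by blast
  show thesis
  \<comment> \<open>The maximum with 1 covers the points outside \<open>K\<close> and keeps the
    bound nonnegative when \<open>K\<close> is empty and nothing is known of \<open>x\<close> and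
    \<open>B\<close>.\<close>
  proof (rule that[of "max 1 (nrm A x + B)"])
    fix t assume t: "t \<in> topspace L"
    show "nrm A (X t) \<le> max 1 (nrm A x + B)"
    proof (cases "t \<in> K")
      case True
      then have "x \<in> carrier A" "X t \<in> carrier A" "cstar_dist A x (X t) \<le> B"
        using x by auto
      then show ?thesis
        using N_diff_le[of x "X t"] by simp
    next
      case False
      then have "nrm A (X t) < 1"
        using K(2) t by blast
      then show ?thesis
        by simp
    qed
  qed simp
qed

text \<open>Through the intermediate point \<open>x \<otimes> y'\<close>. In the continuity of a
  product, \<open>x\<close> is the value at the moving point, bounded by \<open>C0_bounded\<close>,
  and \<open>y'\<close> the value at the fixed point.\<close>

lemma d_mult_le:
  assumes "x \<in> carrier A" "y \<in> carrier A" "x' \<in> carrier A" "y' \<in> carrier A"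
  shows "cstar_dist A (x \<otimes> y) (x' \<otimes> y')
    \<le> nrm A x * cstar_dist A y y' + cstar_dist A x x' * nrm A y'"
proof -
  have "cstar_dist A (x \<otimes> y) (x \<otimes> y') \<le> nrm A x * cstar_dist A y y'"
  proof -
    have "x \<otimes> y \<oplus> (- 1) \<odot> (x \<otimes> y') = x \<otimes> (y \<oplus> (- 1) \<odot> y')"
      using assms by (simp add: mult_distr_right smult_mult_right)
    then show ?thesis
      using assms nrm_mult[of x "y \<oplus> (- 1) \<odot> y'"] by (simp add: d_eq)
  qed
  moreover have "cstar_dist A (x \<otimes> y') (x' \<otimes> y') \<le> cstar_dist A x x' * nrm A y'"
  proof -
    have "x \<otimes> y' \<oplus> (- 1) \<odot> (x' \<otimes> y') = (x \<oplus> (- 1) \<odot> x') \<otimes> y'"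
      using assms by (simp add: mult_distr_left smult_mult_left)
    then show ?thesis
      using assms nrm_mult[of "x \<oplus> (- 1) \<odot> x'" y'] by (simp add: d_eq)
  qed
  ultimately show ?thesis
    using assms d_triangle[of "x \<otimes> y" "x \<otimes> y'" "x' \<otimes> y'"] by simp
qed

lemma C0_mult_closed:
  assumes X: "X \<in> carrier (C0 L A)" and Y: "Y \<in> carrier (C0 L A)"
  shows "X \<otimes>\<^bsub>C0 L A\<^esub> Y \<in> carrier (C0 L A)"
proof -
  obtain B where B: "0 \<le> B" "\<And>t. t \<in> topspace L \<Longrightarrow> nrm A (X t) \<le> B"
    using C0_bounded[OF X] by blast
  show ?thesis
    unfolding C0_simps
  proof (rule C0_I)
    show "((\<lambda>s. B * cstar_dist A (Y s) (Y t) + cstar_dist A (X s) (X t) * nrm A (Y t)) \<longlongrightarrow> 0)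
        (atin L t)" if "t \<in> topspace L" for t
      using X Y that
      by (intro tendsto_add_zero tendsto_mult_right_zero tendsto_mult_left_zero continuous_mapD)
        (auto simp: C0_iff)
    show "vanishes L (\<lambda>t. B * nrm A (Y t))"
      using Y B(1) by (intro vanishes_scale) (auto simp: C0_iff)
    show "nrm A (X s \<otimes> Y s) \<le> B * nrm A (Y s)" if s: "s \<in> topspace L" for s
      using nrm_mult[OF C0_closed[OF X s] C0_closed[OF Y s]]
        mult_right_mono[OF B(2)[OF s] N_nonneg[OF C0_closed[OF Y s]]] by linarith
    show "cstar_dist A (X s \<otimes> Y s) (X t \<otimes> Y t)
        \<le> B * cstar_dist A (Y s) (Y t) + cstar_dist A (X s) (X t) * nrm A (Y t)"
      if s: "s \<in> topspace L" and t: "t \<in> topspace L" for s t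
      using d_mult_le[OF C0_closed[OF X s] C0_closed[OF Y s] C0_closed[OF X t] C0_closed[OF Y t]]
        mult_right_mono[OF B(2)[OF s] nonneg[of "Y s" "Y t"]] by linarith
  qed (simp add: C0_closed[OF X] C0_closed[OF Y])
qed

text \<open>The elementary tensor of \<open>k\<close> and \<open>m\<close>. With a function that is
  1 at \<open>t\<close> it lifts \<open>m\<close> to a function with value \<open>m\<close> at
  \<open>t\<close>.\<close>

definition elem :: "'l topology \<Rightarrow> ('l \<Rightarrow> complex) \<Rightarrow> 'a \<Rightarrow> 'l \<Rightarrow> 'a" where
  "elem L k m = (\<lambda>s\<in>topspace L. k s \<odot> m)"

lemma elem_closed:
  assumes k: "scalar_C0 L k" and m: "m \<in> carrier A"
  shows "elem L k m \<in> carrier (C0 L A)"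
  unfolding elem_def
proof (rule C0_I)
  show "((\<lambda>s. cmod (k s - k t) * nrm A m) \<longlongrightarrow> 0) (atin L t)" if t: "t \<in> topspace L" for t
  proof -
    have "(k \<longlongrightarrow> k t) (atin L t)"
      using k t by (simp add: scalar_C0_def tendsto_atin)
    then have "((\<lambda>s. cmod (k s - k t)) \<longlongrightarrow> 0) (atin L t)"
      using LIM_zero tendsto_norm_zero by blast
    then show ?thesis
      by (rule tendsto_mult_left_zero)
  qed
  show "vanishes L (\<lambda>t. nrm A m * cmod (k t))"
    using k N_nonneg[OF m] by (intro vanishes_scale) (auto simp: scalar_C0_def)
qed (simp_all add: m d_scale_left nrm_smult mult.commute)

text \<open>Hence the weak-2-local property can be applied at a single point.
  \<open>C0_bounded\<close> enters because the norm is a \<open>Sup\<close>, which dominates its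
  members only for sets bounded above.\<close>

lemma eval_in_dual_space:
  assumes \<psi>: "bounded_functional \<psi>" and t: "t \<in> topspace L"
  shows "(\<lambda>X. \<psi> (X t)) \<in> dual_space (C0 L A)"
  unfolding dual_space_def
proof (intro CollectI conjI ballI allI)
  show "\<psi> ((X \<oplus>\<^bsub>C0 L A\<^esub> Y) t) = \<psi> (X t) + \<psi> (Y t)"
    if "X \<in> carrier (C0 L A)" "Y \<in> carrier (C0 L A)" for X Y
    using t that bounded_functionalD(1)[OF \<psi>] by (simp add: C0_simps C0_closed)
  show "\<psi> ((c \<odot>\<^bsub>C0 L A\<^esub> X) t) = c * \<psi> (X t)" if "X \<in> carrier (C0 L A)" for c X
    using t that bounded_functionalD(2)[OF \<psi>] by (simp add: C0_simps C0_closed)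
  obtain K where K: "0 \<le> K" "\<And>a. a\<in>carrier A \<Longrightarrow> cmod (\<psi> a) \<le> K * nrm A a"
    using \<psi> unfolding bounded_functional_def by blast
  show "\<exists>K. \<forall>X\<in>carrier (C0 L A). cmod (\<psi> (X t)) \<le> K * nrm (C0 L A) X"
  proof (intro exI[of _ K] ballI)
    fix X assume X: "X \<in> carrier (C0 L A)"
    obtain B where "0 \<le> B" "\<And>t. t \<in> topspace L \<Longrightarrow> nrm A (X t) \<le> B"
      using C0_bounded[OF X] by blast
    then have "bdd_above (insert 0 ((\<lambda>t. nrm A (X t)) ` topspace L))"
      by (intro bdd_aboveI[of _ B]) auto
    then have "nrm A (X t) \<le> nrm (C0 L A) X"
      using t by (auto simp: C0_def intro!: cSup_upper)
    then show "cmod (\<psi> (X t)) \<le> K * nrm (C0 L A) X"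
      using K(2)[OF C0_closed[OF X t]] mult_left_mono[OF _ K(1)] order_trans by blast
  qed
qed

text \<open>Turns a matrix coefficient of an element of \<open>C0 L A\<close> into a scalar
  function, to which \<open>scalar_C0_factor\<close> applies.\<close>

lemma scalar_C0_functional:
  assumes \<psi>: "bounded_functional \<psi>" and X: "X \<in> carrier (C0 L A)"
  shows "scalar_C0 L (\<lambda>s. \<psi> (X s))"
proof -
  obtain K where K: "0 \<le> K" "\<And>a. a\<in>carrier A \<Longrightarrow> cmod (\<psi> a) \<le> K * nrm A a"
    using \<psi> unfolding bounded_functional_def by blast
  have diff: "cmod (\<psi> (X s) - \<psi> (X t)) \<le> K * cstar_dist A (X s) (X t)"
    if s: "s \<in> topspace L" and t: "t \<in> topspace L" for s t
  proof -
    note Xs = C0_closed[OF X s] C0_closed[OF X t]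
    have "\<psi> (X s) - \<psi> (X t) = \<psi> (X s \<oplus> (- 1) \<odot> X t)"
      using Xs by (simp add: bounded_functionalD[OF \<psi>])
    then show ?thesis
      using Xs K(2)[of "X s \<oplus> (- 1) \<odot> X t"] by (simp add: d_eq)
  qed
  have "((\<lambda>s. \<psi> (X s)) \<longlongrightarrow> \<psi> (X t)) (atin L t)" if t: "t \<in> topspace L" for t
  proof -
    have lim: "((\<lambda>s. K * cstar_dist A (X s) (X t)) \<longlongrightarrow> 0) (atin L t)"
      using X t by (intro tendsto_mult_right_zero continuous_mapD) (auto simp: C0_iff)
    have "((\<lambda>s. \<psi> (X s) - \<psi> (X t)) \<longlongrightarrow> 0) (atin L t)"
    proof (rule Lim_null_comparison[OF _ lim])
      have "\<forall>\<^sub>F s in atin L t. s \<in> topspace L"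
        by (auto simp: eventually_atin)
      then show "\<forall>\<^sub>F s in atin L t. cmod (\<psi> (X s) - \<psi> (X t)) \<le> K * cstar_dist A (X s) (X t)"
        by eventually_elim (rule diff[OF _ t])
    qed
    then show ?thesis
      by (rule LIM_zero_cancel)
  qed
  moreover have "vanishes L (\<lambda>s. cmod (\<psi> (X s)))"
  proof (rule vanishes_mono)
    show "vanishes L (\<lambda>s. K * nrm A (X s))"
      using X K(1) by (intro vanishes_scale) (auto simp: C0_iff)
  qed (simp add: K(2) C0_closed[OF X])
  ultimately show ?thesis
    by (auto simp: scalar_C0_def intro: continuous_map_euclideanI)
qed

end

section \<open>Representations with matrix coefficients\<close>

text \<open>Models one summand of the algebra. The representation need not be faithful, so
  \<open>rank1_sandwich\<close> is demanded in \<open>A\<close> itself and does not follow from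
  \<open>act_rank1\<close>. It expresses that a rank one element lives in this summand only.\<close>

locale coefficient_representation =
  normed_algebra A + H: complex_hilbert_space H
  for A :: "('a, 'm) cstar_scheme" (structure) and H :: "('h, 'k) hilbert_scheme" +
  fixes act :: "'a \<Rightarrow> 'h \<Rightarrow> 'h" and rank1 :: "'h \<Rightarrow> 'h \<Rightarrow> 'a"
  assumes act_closed [simp, intro]:
      "\<lbrakk>m \<in> carrier A; \<xi> \<in> carrier H\<rbrakk> \<Longrightarrow> act m \<xi> \<in> carrier H"
    and act_add_vec: "\<lbrakk>m \<in> carrier A; \<xi> \<in> carrier H; \<zeta> \<in> carrier H\<rbrakk> \<Longrightarrow>
      act m (\<xi> \<oplus>\<^bsub>H\<^esub> \<zeta>) = act m \<xi> \<oplus>\<^bsub>H\<^esub> act m \<zeta>"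
    and act_scale_vec: "\<lbrakk>m \<in> carrier A; \<xi> \<in> carrier H\<rbrakk> \<Longrightarrow> act m (c \<odot>\<^bsub>H\<^esub> \<xi>) = c \<odot>\<^bsub>H\<^esub> act m \<xi>"
    and act_add: "\<lbrakk>m \<in> carrier A; n \<in> carrier A; \<xi> \<in> carrier H\<rbrakk> \<Longrightarrow>
      act (m \<oplus> n) \<xi> = act m \<xi> \<oplus>\<^bsub>H\<^esub> act n \<xi>"
    and act_scale: "\<lbrakk>m \<in> carrier A; \<xi> \<in> carrier H\<rbrakk> \<Longrightarrow> act (c \<odot> m) \<xi> = c \<odot>\<^bsub>H\<^esub> act m \<xi>"
    and act_mult: "\<lbrakk>m \<in> carrier A; n \<in> carrier A; \<xi> \<in> carrier H\<rbrakk> \<Longrightarrow>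
      act (m \<otimes> n) \<xi> = act m (act n \<xi>)"
    and rank1_closed [simp, intro]:
      "\<lbrakk>\<xi> \<in> carrier H; \<eta> \<in> carrier H\<rbrakk> \<Longrightarrow> rank1 \<xi> \<eta> \<in> carrier A"
    and act_rank1: "\<lbrakk>\<xi> \<in> carrier H; \<eta> \<in> carrier H; \<zeta> \<in> carrier H\<rbrakk> \<Longrightarrow>
      act (rank1 \<xi> \<eta>) \<zeta> = cinner H \<zeta> \<eta> \<odot>\<^bsub>H\<^esub> \<xi>"
    and rank1_sandwich:
      "\<lbrakk>m \<in> carrier A; \<xi> \<in> carrier H; \<eta> \<in> carrier H; \<xi>' \<in> carrier H; \<eta>' \<in> carrier H\<rbrakk> \<Longrightarrow>
        (rank1 \<xi> \<eta> \<otimes> m) \<otimes> rank1 \<xi>' \<eta>' = cinner H (act m \<xi>') \<eta> \<odot> rank1 \<xi> \<eta>'"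
begin

abbreviation coef :: "'a \<Rightarrow> 'h \<Rightarrow> 'h \<Rightarrow> complex" where
  "coef m \<xi> \<eta> \<equiv> cinner H (act m \<xi>) \<eta>"

lemmas act_simps = act_add_vec act_scale_vec act_add act_scale act_mult act_rank1

lemma act_zero [simp]: "m \<in> carrier A \<Longrightarrow> act m \<zero>\<^bsub>H\<^esub> = \<zero>\<^bsub>H\<^esub>"
  using act_scale_vec[of m "\<zero>\<^bsub>H\<^esub>" 0] by simp

lemma zero_act [simp]: "\<xi> \<in> carrier H \<Longrightarrow> act \<zero> \<xi> = \<zero>\<^bsub>H\<^esub>"
  using act_scale[of \<zero> \<xi> 0] by simp

lemma coef_bounded:
  assumes "\<xi> \<in> carrier H" "\<eta> \<in> carrier H"
  shows "bounded_functional (\<lambda>m. coef m \<xi> \<eta>)"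
proof -
  have "cmod (coef m \<xi> \<eta>) \<le> nrm A (rank1 \<xi> \<eta>) * nrm A m" if m: "m \<in> carrier A" for m
  proof (cases "\<xi> = \<zero>\<^bsub>H\<^esub>")
    case True
    then show ?thesis
      using assms m N_nonneg by simp
  next
    case False
    define p where "p = rank1 \<xi> \<xi>"
    have p: "p \<in> carrier A"
      using assms by (simp add: p_def)
    \<comment> \<open>That \<open>p\<close> is nonzero is read off from its action; its norm is not
      computed, since it cancels below.\<close>
    have "coef p \<xi> \<xi> \<noteq> 0"
      using assms False by (simp add: p_def act_rank1 H.cinner_linear H.cinner_self_eq_0)
    then have "p \<noteq> \<zero>"
      using assms by auto
    then have pos: "0 < nrm A p"
      using nrm_eq_zero[OF p] N_nonneg[OF p] by simp
    have "cmod (coef m \<xi> \<eta>) * nrm A p = nrm A ((rank1 \<xi> \<eta> \<otimes> m) \<otimes> p)"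
      using assms m by (simp add: p_def rank1_sandwich nrm_smult)
    also have "\<dots> \<le> nrm A (rank1 \<xi> \<eta> \<otimes> m) * nrm A p"
      using assms m p by (intro nrm_mult) auto
    also have "\<dots> \<le> (nrm A (rank1 \<xi> \<eta>) * nrm A m) * nrm A p"
      using assms m pos by (intro mult_right_mono nrm_mult) auto
    finally show ?thesis
      using pos by simp
  qed
  then show ?thesis
    unfolding bounded_functional_def using assms N_nonneg
    by (intro conjI exI[of _ "nrm A (rank1 \<xi> \<eta>)"]) (simp_all add: act_simps H.cinner_linear)
qed

text \<open>Reduces an equality of actions to unit vectors, for which the formula for
  \<open>\<Delta>\<close> below is stated.\<close>

lemma act_eqI:
  assumes m: "m \<in> carrier A" and n: "n \<in> carrier A"
    and eq: "\<And>\<xi> \<eta>. \<lbrakk>\<xi> \<in> carrier H; \<eta> \<in> carrier H; hnorm H \<xi> = 1; hnorm H \<eta> = 1\<rbrakk> \<Longrightarrow>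
      coef m \<xi> \<eta> = coef n \<xi> \<eta>"
    and \<xi>: "\<xi> \<in> carrier H"
  shows "act m \<xi> = act n \<xi>"
proof (rule H.cinner_eqI)
  fix \<eta> assume \<eta>: "\<eta> \<in> carrier H"
  show "coef m \<xi> \<eta> = coef n \<xi> \<eta>"
  proof (rule H.unit_multiple[OF \<xi>])
    fix c u assume u: "u \<in> carrier H" "hnorm H u = 1" "\<xi> = c \<odot>\<^bsub>H\<^esub> u"
    show ?thesis
    proof (rule H.unit_multiple[OF \<eta>])
      fix c' u' assume u': "u' \<in> carrier H" "hnorm H u' = 1" "\<eta> = c' \<odot>\<^bsub>H\<^esub> u'"
      show ?thesis
        using m n u u' eq[of u u'] by (simp add: act_simps H.cinner_linear)
    qed (use m n \<xi> in simp)
  qed (use m n \<eta> in simp)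
qed (use m n \<xi> in auto)

end

text \<open>\<open>h\<close> is the function of \<open>bump_function\<close>; it stands in for the
  constant 1, which vanishes at infinity only if \<open>L\<close> is compact.\<close>

locale pointed_representation = coefficient_representation A H act rank1
  for A :: "('a, 'm) cstar_scheme" (structure) and H :: "('h, 'k) hilbert_scheme"
    and act :: "'a \<Rightarrow> 'h \<Rightarrow> 'h" and rank1 :: "'h \<Rightarrow> 'h \<Rightarrow> 'a" +
  fixes L :: "'l topology" and t :: 'l and h :: "'l \<Rightarrow> complex"
  assumes t: "t \<in> topspace L" and h: "scalar_C0 L h" and h_t [simp]: "h t = 1"
    and h_le: "\<And>s. cmod (h s) \<le> 1"
begin

abbreviation B :: "('l \<Rightarrow> 'a) cstar" where "B \<equiv> C0 L A"

lemma at_closed [simp, intro]: "X \<in> carrier B \<Longrightarrow> X t \<in> carrier A"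
  by (rule C0_closed[OF _ t])

lemma at_simps:
  "(X \<oplus>\<^bsub>B\<^esub> Y) t = X t \<oplus> Y t" "(X \<otimes>\<^bsub>B\<^esub> Y) t = X t \<otimes> Y t" "(c \<odot>\<^bsub>B\<^esub> X) t = c \<odot> X t"
  "elem L k m t = k t \<odot> m"
  using t by (simp_all add: C0_simps elem_def)

lemmas B_closed = C0_add_closed C0_mult_closed C0_scale_closed elem_closed[OF h]

section \<open>Derivations of C_0(L,A) at the point \<open>t\<close>\<close>

lemma derivationD:
  assumes "derivation B D"
  shows "\<And>X. X \<in> carrier B \<Longrightarrow> D X \<in> carrier B"
    "\<And>X Y. X \<in> carrier B \<Longrightarrow> Y \<in> carrier B \<Longrightarrow> D (X \<oplus>\<^bsub>B\<^esub> Y) t = D X t \<oplus> D Y t"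
    "\<And>X Y. X \<in> carrier B \<Longrightarrow> Y \<in> carrier B \<Longrightarrow>
      D (X \<otimes>\<^bsub>B\<^esub> Y) t = D X t \<otimes> Y t \<oplus> X t \<otimes> D Y t"
    "\<And>X c. X \<in> carrier B \<Longrightarrow> D (c \<odot>\<^bsub>B\<^esub> X) t = c \<odot> D X t"
proof -
  note d = assms[unfolded derivation_def]
  show "D X \<in> carrier B" if "X \<in> carrier B" for X
    by (rule funcset_mem[OF d[THEN conjunct1] that])
  show "D (X \<oplus>\<^bsub>B\<^esub> Y) t = D X t \<oplus> D Y t" if "X \<in> carrier B" "Y \<in> carrier B" for X Y
    unfolding d[THEN conjunct2, THEN conjunct1, rule_format, OF that] by (rule at_simps)
  show "D (X \<otimes>\<^bsub>B\<^esub> Y) t = D X t \<otimes> Y t \<oplus> X t \<otimes> D Y t"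
    if "X \<in> carrier B" "Y \<in> carrier B" for X Y
    unfolding d[THEN conjunct2, THEN conjunct2, THEN conjunct2, rule_format, OF that]
    by (simp only: at_simps)
  show "D (c \<odot>\<^bsub>B\<^esub> X) t = c \<odot> D X t" if "X \<in> carrier B" for X c
    unfolding d[THEN conjunct2, THEN conjunct2, THEN conjunct1, rule_format, OF that]
    by (rule at_simps)
qed

text \<open>
  A compression of \<open>N\<close> by elements of rank one is a scalar function vanishing at \<open>t\<close>, and such a
  function is a product of two functions vanishing at \<open>t\<close>.
\<close>

lemma derivation_kernel:
  assumes D: "derivation B D" and N: "N \<in> carrier B"
    and N0: "\<And>\<xi>. \<xi> \<in> carrier H \<Longrightarrow> act (N t) \<xi> = \<zero>\<^bsub>H\<^esub>"
    and \<xi>: "\<xi> \<in> carrier H"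
  shows "act (D N t) \<xi> = \<zero>\<^bsub>H\<^esub>"
proof (rule H.unit_multiple[OF \<xi>])
  fix c e assume e: "e \<in> carrier H" "hnorm H e = 1"
  have ee: "cinner H e e = 1"
    using e by (simp add: H.cinner_self)
  note D' = derivationD[OF D]
  show ?thesis
  proof (rule H.cinner_eqI)
    fix \<eta> assume \<eta>: "\<eta> \<in> carrier H"
    \<comment> \<open>\<open>F\<close> and \<open>G\<close> contribute \<open>h\<close> twice to the
      compression; one factor is absorbed into \<open>k\<close>, the other into
      \<open>E\<close>.\<close>
    define k where "k s = h s * coef (N s) \<xi> \<eta>" for s
    have "scalar_C0 L k"
      unfolding k_def using coef_bounded[OF \<xi> \<eta>]
      by (intro scalar_C0_mult h h_le scalar_C0_functional[OF _ N])
    moreover have "k t = 0"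
      using N0 \<xi> \<eta> by (simp add: k_def)
    ultimately obtain k1 k2 where k: "scalar_C0 L k1" "scalar_C0 L k2" "k1 t = 0" "k2 t = 0"
      "k = (\<lambda>s. k1 s * k2 s)"
      by (rule scalar_C0_factor)
    define p where "p = rank1 e e"
    have p: "p \<in> carrier A"
      using e by (simp add: p_def)
    \<comment> \<open>The sandwich identity concerns three factors, so it yields this and not
      \<open>p \<otimes> p = p\<close>. This is why \<open>E\<close> stands between
      \<open>K1\<close> and \<open>K2\<close>.\<close>
    have ppp: "(p \<otimes> p) \<otimes> p = p"
      using e p rank1_sandwich[of p e e e e]
      by (simp add: p_def[symmetric]) (simp add: p_def act_rank1 H.cinner_linear ee)
    define F where "F = elem L h (rank1 e \<eta>)"
    define G where "G = elem L h (rank1 \<xi> e)"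
    define E where "E = elem L h p"
    define K1 where "K1 = elem L k1 p"
    define K2 where "K2 = elem L k2 p"
    have FG [simp]: "F \<in> carrier B" "G \<in> carrier B" "E \<in> carrier B" "K1 \<in> carrier B" "K2 \<in> carrier B"
      using e \<xi> \<eta> p k by (simp_all add: F_def G_def E_def K1_def K2_def elem_closed h)
    have eq: "(F \<otimes>\<^bsub>B\<^esub> N) \<otimes>\<^bsub>B\<^esub> G = (K1 \<otimes>\<^bsub>B\<^esub> E) \<otimes>\<^bsub>B\<^esub> K2"
      unfolding C0_simps
    proof (rule restrict_ext)
      fix s assume s: "s \<in> topspace L"
      have Ns: "N s \<in> carrier A"
        using C0_closed[OF N s] .
      have "((h s \<odot> rank1 e \<eta>) \<otimes> N s) \<otimes> (h s \<odot> rank1 \<xi> e)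
          = (h s * h s * coef (N s) \<xi> \<eta>) \<odot> p"
        using Ns e \<xi> \<eta> by (simp add: smult_mult_left smult_mult_right rank1_sandwich scale_scale
            p_def mult_ac)
      also have "h s * h s * coef (N s) \<xi> \<eta> = k1 s * h s * k2 s"
        using fun_cong[OF k(5), of s] by (simp add: k_def mult_ac)
      also have "\<dots> \<odot> p = ((k1 s \<odot> p) \<otimes> (h s \<odot> p)) \<otimes> (k2 s \<odot> p)"
        using p by (simp add: smult_mult_left smult_mult_right scale_scale ppp mult_ac)
      finally show "(\<lambda>s\<in>topspace L. F s \<otimes> N s) s \<otimes> G s
          = (\<lambda>s\<in>topspace L. K1 s \<otimes> E s) s \<otimes> K2 s"
        using s by (simp add: F_def G_def E_def K1_def K2_def elem_def)
    qed
    \<comment> \<open>Each term of the product rule retains \<open>K1 t\<close> or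
      \<open>K2 t\<close>, and both are zero.\<close>
    have "coef (D ((K1 \<otimes>\<^bsub>B\<^esub> E) \<otimes>\<^bsub>B\<^esub> K2) t) e e
        = coef (D (K1 \<otimes>\<^bsub>B\<^esub> E) t) (act (K2 t) e) e + coef (K1 t) (act (E t) (act (D K2 t) e)) e"
      using e by (simp add: D' at_simps B_closed act_simps H.cinner_linear)
    also have "\<dots> = 0"
      using e p by (simp add: K1_def K2_def at_simps k act_simps D'(1) B_closed FG[unfolded K1_def K2_def])
    finally have "coef (D ((F \<otimes>\<^bsub>B\<^esub> N) \<otimes>\<^bsub>B\<^esub> G) t) e e = 0"
      by (simp add: eq)
    \<comment> \<open>The outer terms contain \<open>N t\<close>, which acts as 0; the middle one is
      the coefficient of \<open>D N t\<close> in question.\<close>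
    moreover have "coef (D ((F \<otimes>\<^bsub>B\<^esub> N) \<otimes>\<^bsub>B\<^esub> G) t) e e
        = coef (D F t) (act (N t) (act (G t) e)) e + coef (F t) (act (D N t) (act (G t) e)) e
          + coef (F t) (act (N t) (act (D G t) e)) e"
      using e N by (simp add: D' at_simps B_closed act_simps H.cinner_linear)
    moreover have "act (G t) e = \<xi>"
      using e \<xi> by (simp add: G_def at_simps act_rank1 ee)
    moreover have "coef (F t) z e = cinner H z \<eta>" if "z \<in> carrier H" for z
      using e \<eta> that by (simp add: F_def at_simps act_rank1 H.cinner_linear ee)
    ultimately show "coef (D N t) \<xi> \<eta> = cinner H \<zero>\<^bsub>H\<^esub> \<eta>"
      using N0 \<xi> e \<eta> N by (simp add: D'(1))
  qed (simp_all add: D'(1) N \<xi>)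
qed (simp add: derivationD(1)[OF D N])

text \<open>Only the actions at \<open>t\<close> are compared: \<open>X\<close> and \<open>Y\<close>
  may differ at other points and in other summands.\<close>

lemma derivation_cong:
  assumes D: "derivation B D" and X: "X \<in> carrier B" and Y: "Y \<in> carrier B"
    and eq: "\<And>\<xi>. \<xi> \<in> carrier H \<Longrightarrow> act (X t) \<xi> = act (Y t) \<xi>"
    and \<xi>: "\<xi> \<in> carrier H"
  shows "act (D X t) \<xi> = act (D Y t) \<xi>"
proof -
  note D' = derivationD[OF D]
  have "act (D (X \<oplus>\<^bsub>B\<^esub> (- 1) \<odot>\<^bsub>B\<^esub> Y) t) \<xi> = \<zero>\<^bsub>H\<^esub>"
  proof (rule derivation_kernel[OF D _ _ \<xi>])
    show "act ((X \<oplus>\<^bsub>B\<^esub> (- 1) \<odot>\<^bsub>B\<^esub> Y) t) \<zeta> = \<zero>\<^bsub>H\<^esub>" if "\<zeta> \<in> carrier H" for \<zeta>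
      using X Y that by (simp add: at_simps act_simps eq H.diff_self)
  qed (simp add: X Y B_closed)
  then have "act (D X t) \<xi> \<oplus>\<^bsub>H\<^esub> (- 1) \<odot>\<^bsub>H\<^esub> act (D Y t) \<xi> = \<zero>\<^bsub>H\<^esub>"
    using X Y \<xi> by (simp add: D' B_closed act_simps)
  then show ?thesis
    using X Y \<xi> D'(1) by (subst H.eq_iff_diff_zero) auto
qed

text \<open>The relation D(X)(t) = [a, X(t)] on \<open>H\<close>, with the subtraction moved to the
  other side.\<close>

definition implements :: "('h \<Rightarrow> 'h) \<Rightarrow> (('l \<Rightarrow> 'a) \<Rightarrow> 'l \<Rightarrow> 'a) \<Rightarrow> bool" where
  "implements a D \<longleftrightarrow>
    (\<forall>\<xi>\<in>carrier H. a \<xi> \<in> carrier H) \<and>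
    (\<forall>\<xi>\<in>carrier H. \<forall>\<zeta>\<in>carrier H. a (\<xi> \<oplus>\<^bsub>H\<^esub> \<zeta>) = a \<xi> \<oplus>\<^bsub>H\<^esub> a \<zeta>) \<and>
    (\<forall>c. \<forall>\<xi>\<in>carrier H. a (c \<odot>\<^bsub>H\<^esub> \<xi>) = c \<odot>\<^bsub>H\<^esub> a \<xi>) \<and>
    (\<forall>X\<in>carrier B. \<forall>\<xi>\<in>carrier H.
      a (act (X t) \<xi>) = act (D X t) \<xi> \<oplus>\<^bsub>H\<^esub> act (X t) (a \<xi>))"

lemma implementsD:
  assumes "implements a D"
  shows "\<And>\<xi>. \<xi> \<in> carrier H \<Longrightarrow> a \<xi> \<in> carrier H"
    "\<And>\<xi> \<zeta>. \<xi> \<in> carrier H \<Longrightarrow> \<zeta> \<in> carrier H \<Longrightarrow> a (\<xi> \<oplus>\<^bsub>H\<^esub> \<zeta>) = a \<xi> \<oplus>\<^bsub>H\<^esub> a \<zeta>"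
    "\<And>c \<xi>. \<xi> \<in> carrier H \<Longrightarrow> a (c \<odot>\<^bsub>H\<^esub> \<xi>) = c \<odot>\<^bsub>H\<^esub> a \<xi>"
    "\<And>X \<xi>. X \<in> carrier B \<Longrightarrow> \<xi> \<in> carrier H \<Longrightarrow>
      a (act (X t) \<xi>) = act (D X t) \<xi> \<oplus>\<^bsub>H\<^esub> act (X t) (a \<xi>)"
proof -
  note a = assms[unfolded implements_def]
  show "\<And>\<xi>. \<xi> \<in> carrier H \<Longrightarrow> a \<xi> \<in> carrier H"
    by (rule a[THEN conjunct1, rule_format])
  show "\<And>\<xi> \<zeta>. \<xi> \<in> carrier H \<Longrightarrow> \<zeta> \<in> carrier H \<Longrightarrow> a (\<xi> \<oplus>\<^bsub>H\<^esub> \<zeta>) = a \<xi> \<oplus>\<^bsub>H\<^esub> a \<zeta>"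
    by (rule a[THEN conjunct2, THEN conjunct1, rule_format])
  show "\<And>c \<xi>. \<xi> \<in> carrier H \<Longrightarrow> a (c \<odot>\<^bsub>H\<^esub> \<xi>) = c \<odot>\<^bsub>H\<^esub> a \<xi>"
    by (rule a[THEN conjunct2, THEN conjunct2, THEN conjunct1, rule_format])
  show "\<And>X \<xi>. X \<in> carrier B \<Longrightarrow> \<xi> \<in> carrier H \<Longrightarrow>
      a (act (X t) \<xi>) = act (D X t) \<xi> \<oplus>\<^bsub>H\<^esub> act (X t) (a \<xi>)"
    by (rule a[THEN conjunct2, THEN conjunct2, THEN conjunct2, rule_format])
qed

lemma derivation_inner:
  assumes D: "derivation B D" and e: "e \<in> carrier H" "hnorm H e = 1"
  shows "\<exists>a. implements a D"
proof -
  have ee: "cinner H e e = 1"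
    using e by (simp add: H.cinner_self)
  note D' = derivationD[OF D]
  define E where "E \<xi> = elem L h (rank1 \<xi> e)" for \<xi>
  define a where "a \<xi> = act (D (E \<xi>) t) e" for \<xi>
  have E [simp]: "E \<xi> \<in> carrier B" if "\<xi> \<in> carrier H" for \<xi>
    using e that by (simp add: E_def B_closed)
  have actE: "act (E \<xi> t) \<zeta> = cinner H \<zeta> e \<odot>\<^bsub>H\<^esub> \<xi>" if "\<xi> \<in> carrier H" "\<zeta> \<in> carrier H" for \<xi> \<zeta>
    using e that by (simp add: E_def at_simps act_simps)
  show ?thesis
    unfolding implements_def
  proof (intro exI[of _ a] conjI ballI allI)
    show a: "a \<xi> \<in> carrier H" if "\<xi> \<in> carrier H" for \<xi>
      using that e D'(1) by (simp add: a_def)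
    show "a (\<xi> \<oplus>\<^bsub>H\<^esub> \<zeta>) = a \<xi> \<oplus>\<^bsub>H\<^esub> a \<zeta>" if "\<xi> \<in> carrier H" "\<zeta> \<in> carrier H" for \<xi> \<zeta>
    proof -
      have "act (D (E (\<xi> \<oplus>\<^bsub>H\<^esub> \<zeta>)) t) e = act (D (E \<xi> \<oplus>\<^bsub>B\<^esub> E \<zeta>) t) e"
        using that by (intro derivation_cong[OF D])
          (simp_all add: B_closed at_simps act_add actE H.scale_add_right e)
      then show ?thesis
        using that e by (simp add: a_def D' act_simps)
    qed
    show "a (c \<odot>\<^bsub>H\<^esub> \<xi>) = c \<odot>\<^bsub>H\<^esub> a \<xi>" if "\<xi> \<in> carrier H" for c \<xi>
    proof -
      have "act (D (E (c \<odot>\<^bsub>H\<^esub> \<xi>)) t) e = act (D (c \<odot>\<^bsub>B\<^esub> E \<xi>) t) e"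
        using that by (intro derivation_cong[OF D])
          (simp_all add: B_closed at_simps act_scale actE H.scale_scale e mult.commute)
      then show ?thesis
        using that e by (simp add: a_def D' act_simps)
    qed
    show "a (act (X t) \<xi>) = act (D X t) \<xi> \<oplus>\<^bsub>H\<^esub> act (X t) (a \<xi>)"
      if "X \<in> carrier B" "\<xi> \<in> carrier H" for X \<xi>
    proof -
      have "act (D (E (act (X t) \<xi>)) t) e = act (D (X \<otimes>\<^bsub>B\<^esub> E \<xi>) t) e"
        using that by (intro derivation_cong[OF D])
          (simp_all add: B_closed at_simps act_mult actE act_scale_vec e)
      then show ?thesis
        using that e by (simp add: a_def D' act_add act_mult actE ee)
    qed
  qed
qed

text \<open>\<langle>D(X)\<xi>, \<eta>\<rangle> = \<langle>a X \<xi>, \<eta>\<rangle> - \<langle>X a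
  \<xi>, \<eta>\<rangle> sees X(t) only through its value at \<xi> and through the functional
  \<langle>X _, \<eta>\<rangle>.\<close>

lemma derivation_coef_cong:
  assumes D: "derivation B D" and X: "X \<in> carrier B" and Y: "Y \<in> carrier B"
    and \<xi>: "\<xi> \<in> carrier H" "hnorm H \<xi> = 1" and \<eta>: "\<eta> \<in> carrier H"
    and eq1: "act (X t) \<xi> = act (Y t) \<xi>"
    and eq2: "\<And>\<zeta>. \<zeta> \<in> carrier H \<Longrightarrow> coef (X t) \<zeta> \<eta> = coef (Y t) \<zeta> \<eta>"
  shows "coef (D X t) \<xi> \<eta> = coef (D Y t) \<xi> \<eta>"
proof -
  obtain a where "implements a D"
    by (rule exE[OF derivation_inner[OF D \<xi>]])
  note a = implementsD[OF this]
  have "coef (D X t) \<xi> \<eta> + coef (X t) (a \<xi>) \<eta> = coef (D Y t) \<xi> \<eta> + coef (Y t) (a \<xi>) \<eta>"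
    using a(4)[OF X \<xi>(1)] a(4)[rule_format, OF Y \<xi>(1)] eq1 X Y \<xi> \<eta> a(1) derivationD(1)[OF D]
    by (simp flip: H.cinner_add_left)
  then show ?thesis
    using eq2 a(1) \<xi> by simp
qed

definition linear_functional :: "('h \<Rightarrow> complex) \<Rightarrow> bool" where
  "linear_functional f \<longleftrightarrow>
     (\<forall>x\<in>carrier H. \<forall>y\<in>carrier H. f (x \<oplus>\<^bsub>H\<^esub> y) = f x + f y) \<and>
     (\<forall>c. \<forall>x\<in>carrier H. f (c \<odot>\<^bsub>H\<^esub> x) = c * f x)"

text \<open>
  The trace of \<open>x [a, x] = [x a, x]\<close> vanishes for an operator \<open>x\<close> of finite rank; the sum in the
  conclusion is this trace, so that \<open>a\<close> may be unbounded.
\<close>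

lemma derivation_trace:
  assumes D: "derivation B D" and e: "e \<in> carrier H" "hnorm H e = 1" and X: "X \<in> carrier B"
    and f: "linear_functional f1" "linear_functional f2" "linear_functional f3"
    and v: "v1 \<in> carrier H" "v2 \<in> carrier H" "v3 \<in> carrier H"
    and act: "\<And>\<zeta>. \<zeta> \<in> carrier H \<Longrightarrow> act (X t) \<zeta> =
      f1 \<zeta> \<odot>\<^bsub>H\<^esub> v1 \<oplus>\<^bsub>H\<^esub> f2 \<zeta> \<odot>\<^bsub>H\<^esub> v2 \<oplus>\<^bsub>H\<^esub> f3 \<zeta> \<odot>\<^bsub>H\<^esub> v3"
  shows "f1 (act (D X t) v1) + f2 (act (D X t) v2) + f3 (act (D X t) v3) = 0"
proof -
  obtain a where "implements a D"
    by (rule exE[OF derivation_inner[OF D e]])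
  note a = implementsD[OF this]
  have lin: "f (x \<oplus>\<^bsub>H\<^esub> y) = f x + f y" "f (c \<odot>\<^bsub>H\<^esub> x) = c * f x"
    if "linear_functional f" "x \<in> carrier H" "y \<in> carrier H" for f x y c
    using that by (auto simp: linear_functional_def)
  have DX: "D X t \<in> carrier A"
    using derivationD(1)[OF D X] by simp
  \<comment> \<open>Both products in \<open>a X - X a\<close> are expanded along the given
    presentation. Summed over the three pairs of a functional and a vector, the two double sums
    differ by an exchange of indices and cancel.\<close>
  have eq: "f (act (D X t) v) = f1 v * f (a v1) + f2 v * f (a v2) + f3 v * f (a v3)
      - (f1 (a v) * f v1 + f2 (a v) * f v2 + f3 (a v) * f v3)"
    if f: "linear_functional f" and v': "v \<in> carrier H" for f v
  proof -
    have "f (act (D X t) v) + f (act (X t) (a v)) = f (a (act (X t) v))"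
      using f v' X DX a(1) a(4)[OF X v'] by (simp add: lin)
    moreover have "f (act (X t) (a v)) = f1 (a v) * f v1 + f2 (a v) * f v2 + f3 (a v) * f v3"
      using f v' v a(1) by (simp add: act lin)
    moreover have "f (a (act (X t) v)) = f1 v * f (a v1) + f2 v * f (a v2) + f3 v * f (a v3)"
      using f v' v a(1) by (simp add: act a(2,3) lin)
    ultimately show ?thesis
      by (simp add: algebra_simps)
  qed
  show ?thesis
    unfolding eq[OF f(1) v(1)] eq[OF f(2) v(2)] eq[OF f(3) v(3)] by (simp add: mult.commute)
qed

end

section \<open>Weak-2-local derivations at a point\<close>

locale pointed_weak_2_local = pointed_representation A H act rank1 L t h
  for A :: "('a, 'm) cstar_scheme" (structure) and H :: "('h, 'k) hilbert_scheme"
    and act :: "'a \<Rightarrow> 'h \<Rightarrow> 'h" and rank1 :: "'h \<Rightarrow> 'h \<Rightarrow> 'a"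
    and L :: "'l topology" and t :: 'l and h :: "'l \<Rightarrow> complex" +
  fixes \<Delta> :: "('l \<Rightarrow> 'a) \<Rightarrow> 'l \<Rightarrow> 'a"
  assumes weak: "weak_2_local_derivation B \<Delta>"
begin

lemma \<Delta>_closed: "X \<in> carrier B \<Longrightarrow> \<Delta> X \<in> carrier B"
  using weak unfolding weak_2_local_derivation_def by (auto dest: funcset_mem)

lemma \<Delta>_at [simp]: "X \<in> carrier B \<Longrightarrow> \<Delta> X t \<in> carrier A"
  by (rule at_closed[OF \<Delta>_closed])

lemma weakD:
  assumes "bounded_functional \<psi>" "X \<in> carrier B" "Y \<in> carrier B"
  obtains D where "derivation B D" "\<psi> (\<Delta> X t) = \<psi> (D X t)" "\<psi> (\<Delta> Y t) = \<psi> (D Y t)"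
proof -
  have "(\<lambda>X. \<psi> (X t)) \<in> dual_space B"
    using assms(1) t by (rule eval_in_dual_space)
  from weak[unfolded weak_2_local_derivation_def, THEN conjunct2, rule_format, OF assms(2,3) this]
  show thesis
    by (elim exE conjE) (rule that)
qed

text \<open>A single functional, the coefficient at \<open>\<xi>\<close> and \<open>\<eta>\<close>,
  is used for both elements, so one derivation serves both.\<close>

lemma \<Delta>_coef_cong:
  assumes "X \<in> carrier B" "Y \<in> carrier B"
    and "\<xi> \<in> carrier H" "hnorm H \<xi> = 1" "\<eta> \<in> carrier H"
    and "act (X t) \<xi> = act (Y t) \<xi>"
    and "\<And>\<zeta>. \<zeta> \<in> carrier H \<Longrightarrow> coef (X t) \<zeta> \<eta> = coef (Y t) \<zeta> \<eta>"
  shows "coef (\<Delta> X t) \<xi> \<eta> = coef (\<Delta> Y t) \<xi> \<eta>"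
  using weakD[OF coef_bounded[OF assms(3,5)] assms(1,2)] derivation_coef_cong[OF _ assms]
  by metis

text \<open>\<open>\<psi>\<close> is m \<mapsto> tr(X(t) m). Three summands, padded by zero
  functionals, cover an operator of rank one, one of rank two and their sum.\<close>

lemma \<Delta>_trace:
  assumes e: "e \<in> carrier H" "hnorm H e = 1" and X: "X \<in> carrier B"
    and f: "linear_functional f1" "linear_functional f2" "linear_functional f3"
    and v: "v1 \<in> carrier H" "v2 \<in> carrier H" "v3 \<in> carrier H"
    and act: "\<And>\<zeta>. \<zeta> \<in> carrier H \<Longrightarrow> act (X t) \<zeta> =
      f1 \<zeta> \<odot>\<^bsub>H\<^esub> v1 \<oplus>\<^bsub>H\<^esub> f2 \<zeta> \<odot>\<^bsub>H\<^esub> v2 \<oplus>\<^bsub>H\<^esub> f3 \<zeta> \<odot>\<^bsub>H\<^esub> v3"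
    and \<psi>: "bounded_functional \<psi>"
      "\<And>m. m \<in> carrier A \<Longrightarrow> \<psi> m = f1 (act m v1) + f2 (act m v2) + f3 (act m v3)"
  shows "\<psi> (\<Delta> X t) = 0"
proof (rule weakD[OF \<psi>(1) X X])
  fix D assume D: "derivation B D" "\<psi> (\<Delta> X t) = \<psi> (D X t)"
  then show ?thesis
    using derivation_trace[OF D(1) e X f v act] \<psi>(2) derivationD(1)[OF D(1) X] by simp
qed

lemma \<Delta>_trace_pair:
  assumes e: "e \<in> carrier H" "hnorm H e = 1" and X: "X \<in> carrier B" and Y: "Y \<in> carrier B"
    and f: "linear_functional f1" "linear_functional f2" "linear_functional f3"
    and v: "v1 \<in> carrier H" "v2 \<in> carrier H" "v3 \<in> carrier H"
    and act: "\<And>\<zeta>. \<zeta> \<in> carrier H \<Longrightarrow> act (X t) \<zeta> \<oplus>\<^bsub>H\<^esub> act (Y t) \<zeta> =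
      f1 \<zeta> \<odot>\<^bsub>H\<^esub> v1 \<oplus>\<^bsub>H\<^esub> f2 \<zeta> \<odot>\<^bsub>H\<^esub> v2 \<oplus>\<^bsub>H\<^esub> f3 \<zeta> \<odot>\<^bsub>H\<^esub> v3"
    and \<psi>: "bounded_functional \<psi>"
      "\<And>m. m \<in> carrier A \<Longrightarrow> \<psi> m = f1 (act m v1) + f2 (act m v2) + f3 (act m v3)"
  shows "\<psi> (\<Delta> X t) + \<psi> (\<Delta> Y t) = 0"
proof (rule weakD[OF \<psi>(1) X Y])
  fix D assume D: "derivation B D" "\<psi> (\<Delta> X t) = \<psi> (D X t)" "\<psi> (\<Delta> Y t) = \<psi> (D Y t)"
  have "\<psi> (D (X \<oplus>\<^bsub>B\<^esub> Y) t) = 0"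
    using derivation_trace[OF D(1) e C0_add_closed[OF X Y] f v] \<psi>(2)[of "D (X \<oplus>\<^bsub>B\<^esub> Y) t"]
      derivationD(1)[OF D(1) C0_add_closed[OF X Y]] X Y
    by (simp add: at_simps act_add act)
  then show ?thesis
    using X Y D bounded_functionalD(1)[OF \<psi>(1)] by (simp add: derivationD[OF D(1)])
qed

text \<open>
  For unit vectors \<open>\<xi>\<close> and \<open>\<eta>\<close> with rank one projections \<open>P\<close> and \<open>Q\<close>, the operator
  \<open>x' = x P + Q x - Q x P\<close> has finite rank and agrees with \<open>x\<close> on \<open>\<xi>\<close> and against \<open>\<eta>\<close>, so \<open>x\<close> may
  be replaced by \<open>x'\<close> on the left. For operators \<open>c\<close>, \<open>x'\<close> of finite rank, the traces of
  \<open>c \<Delta>(c)\<close>, \<open>x' \<Delta>(x')\<close> and \<open>(c + x') (\<Delta>(c) + \<Delta>(x'))\<close> vanish, whence the trace of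
  \<open>c \<Delta>(x')\<close> is minus that of \<open>x' \<Delta>(c)\<close>; the latter is linear in \<open>x\<close>.
\<close>

lemma \<Delta>_antisymmetry:
  assumes X: "X \<in> carrier B"
    and \<xi>: "\<xi> \<in> carrier H" "hnorm H \<xi> = 1" and \<eta>: "\<eta> \<in> carrier H" "hnorm H \<eta> = 1"
    and Y_def: "Y = \<Delta> (elem L h (rank1 \<xi> \<eta>)) t"
  shows "coef (\<Delta> X t) \<xi> \<eta> = - (coef Y (act (X t) \<xi>) \<xi> + coef (X t) (act Y \<eta>) \<eta>
      - coef Y \<eta> \<xi> * coef (X t) \<xi> \<eta>)"
proof -
  have \<xi>\<xi>: "cinner H \<xi> \<xi> = 1" and \<eta>\<eta>: "cinner H \<eta> \<eta> = 1"
    using \<xi> \<eta> by (simp_all add: H.cinner_self)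
  define x where "x = X t"
  have x: "x \<in> carrier A"
    using X by (simp add: x_def)
  define P where "P = rank1 \<xi> \<xi>"
  define Q where "Q = rank1 \<eta> \<eta>"
  have PQ: "P \<in> carrier A" "Q \<in> carrier A"
    using \<xi> \<eta> by (simp_all add: P_def Q_def)
  define x' where "x' = x \<otimes> P \<oplus> (Q \<otimes> x \<oplus> (- 1) \<odot> ((Q \<otimes> x) \<otimes> P))"
  have x': "x' \<in> carrier A"
    using x PQ by (simp add: x'_def)
  define X' where "X' = elem L h x'"
  define C where "C = elem L h (rank1 \<xi> \<eta>)"
  have X': "X' \<in> carrier B" and C: "C \<in> carrier B"
    using x' \<xi> \<eta> by (simp_all add: X'_def C_def B_closed)
  \<comment> \<open>This is (1 - Q) x \<xi>: the terms of \<open>x'\<close> that end in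
    \<open>P\<close> are collected, which leaves a presentation of \<open>x'\<close> with two
    summands.\<close>
  define v2 where "v2 = act x \<xi> \<oplus>\<^bsub>H\<^esub> (- coef x \<xi> \<eta>) \<odot>\<^bsub>H\<^esub> \<eta>"
  have v2: "v2 \<in> carrier H"
    using x \<xi> \<eta> by (simp add: v2_def)
  let ?f1 = "\<lambda>z. cinner H z \<eta>" and ?f2 = "\<lambda>z. cinner H z \<xi>" and ?f3 = "\<lambda>z. coef x z \<eta>"
  have f: "linear_functional ?f1" "linear_functional ?f2" "linear_functional ?f3"
    "linear_functional (\<lambda>z. 0)"
    using x \<xi> \<eta> by (simp_all add: linear_functional_def H.cinner_linear act_simps)
  have actC: "act (C t) \<zeta> = ?f1 \<zeta> \<odot>\<^bsub>H\<^esub> \<xi>" if "\<zeta> \<in> carrier H" for \<zeta>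
    using that \<xi> \<eta> by (simp add: C_def at_simps act_simps)
  have actX': "act (X' t) \<zeta> = ?f2 \<zeta> \<odot>\<^bsub>H\<^esub> v2 \<oplus>\<^bsub>H\<^esub> ?f3 \<zeta> \<odot>\<^bsub>H\<^esub> \<eta>"
    if \<zeta>: "\<zeta> \<in> carrier H" for \<zeta>
  proof (rule H.cinner_eqI)
    fix w assume "w \<in> carrier H"
    then show "coef (X' t) \<zeta> w = cinner H (?f2 \<zeta> \<odot>\<^bsub>H\<^esub> v2 \<oplus>\<^bsub>H\<^esub> ?f3 \<zeta> \<odot>\<^bsub>H\<^esub> \<eta>) w"
      using \<zeta> x x' \<xi> \<eta> PQ
      by (simp add: X'_def at_simps x'_def act_simps P_def Q_def v2_def H.cinner_linear algebra_simps)
  qed (use X' x \<xi> \<eta> v2 \<zeta> in auto)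
  \<comment> \<open>The functional m \<mapsto> tr(x' m), expanded into coefficients so that the
    closure lemmas for bounded functionals apply.\<close>
  define \<psi> where "\<psi> m = coef m (act x \<xi>) \<xi> + coef (x \<otimes> m) \<eta> \<eta> + (- coef x \<xi> \<eta>) * coef m \<eta> \<xi>" for m
  have b1: "bounded_functional (\<lambda>m. coef m \<xi> \<eta>)"
    using \<xi> \<eta> by (simp add: coef_bounded)
  have b\<psi>: "bounded_functional \<psi>"
    unfolding \<psi>_def using x \<xi> \<eta>
    by (intro bounded_functional_add bounded_functional_scale bounded_functional_mult_left[OF _ x]
        coef_bounded) auto
  have \<psi>: "\<psi> m = ?f2 (act m v2) + ?f3 (act m \<eta>)" if "m \<in> carrier A" for m
    using that x \<xi> \<eta> by (simp add: \<psi>_def v2_def act_simps H.cinner_linear algebra_simps)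
  have "coef (\<Delta> X t) \<xi> \<eta> = coef (\<Delta> X' t) \<xi> \<eta>"
  proof (rule \<Delta>_coef_cong[OF X X' \<xi> \<eta>(1)])
    show "act (X t) \<xi> = act (X' t) \<xi>"
    proof (rule H.cinner_eqI)
      fix w assume "w \<in> carrier H"
      then show "coef (X t) \<xi> w = coef (X' t) \<xi> w"
        using x \<xi> \<eta> v2
        by (simp add: actX' x_def[symmetric] \<xi>\<xi> H.cinner_linear) (simp add: v2_def H.cinner_linear)
    qed (use X X' \<xi> in auto)
    show "coef (X t) \<zeta> \<eta> = coef (X' t) \<zeta> \<eta>" if "\<zeta> \<in> carrier H" for \<zeta>
      using that x \<xi> \<eta> v2
      by (simp add: actX' x_def[symmetric] H.cinner_linear \<eta>\<eta>) (simp add: v2_def H.cinner_linear \<eta>\<eta>)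
  qed
  \<comment> \<open>\<open>coef m \<xi> \<eta>\<close> is tr(c m) for
    \<open>c = rank1 \<xi> \<eta>\<close>. With the next two facts, only tr(c \<Delta>(x')) and
    tr(x' \<Delta>(c)) survive in the sum.\<close>
  moreover have "coef (\<Delta> C t) \<xi> \<eta> = 0"
    by (rule \<Delta>_trace[OF \<xi> C f(1) f(4) f(4) \<xi>(1) \<xi>(1) \<xi>(1) _ b1]) (simp_all add: actC \<xi> \<eta>)
  moreover have "\<psi> (\<Delta> X' t) = 0"
    by (rule \<Delta>_trace[OF \<xi> X' f(4) f(2) f(3) \<xi>(1) v2 \<eta>(1) _ b\<psi>]) (simp_all add: actX' \<psi> \<xi> \<eta> v2 x)
  moreover have "(coef (\<Delta> C t) \<xi> \<eta> + \<psi> (\<Delta> C t)) + (coef (\<Delta> X' t) \<xi> \<eta> + \<psi> (\<Delta> X' t)) = 0"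
    by (rule \<Delta>_trace_pair[OF \<xi> C X' f(1) f(2) f(3) \<xi>(1) v2 \<eta>(1) _ bounded_functional_add[OF b1 b\<psi>]])
      (simp_all add: actX' actC \<psi> \<xi> \<eta> v2 x H.M.a_assoc)
  ultimately have "coef (\<Delta> X t) \<xi> \<eta> = - \<psi> (\<Delta> C t)"
    by (simp add: eq_neg_iff_add_eq_0 add.commute)
  moreover have "\<psi> (\<Delta> C t) = coef Y (act (X t) \<xi>) \<xi> + coef (X t) (act Y \<eta>) \<eta>
      - coef Y \<eta> \<xi> * coef (X t) \<xi> \<eta>"
    using x \<eta> C by (simp add: \<psi>_def Y_def C_def[symmetric] act_mult x_def[symmetric] mult.commute)
  ultimately show ?thesis
    by simp
qed

text \<open>For fixed \<open>\<xi>\<close> and \<open>\<eta>\<close> the right side of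
  \<open>\<Delta>_antisymmetry\<close> is additive in the action of \<open>X t\<close>. The element
  \<open>Z\<close> has to act as a sum only at \<open>t\<close>; this admits \<open>rank1\<close>,
  whose dependence on its vectors is known through its action.\<close>

lemma \<Delta>_add_at:
  assumes X: "X \<in> carrier B" and Y: "Y \<in> carrier B" and Z: "Z \<in> carrier B"
    and eq: "\<And>\<zeta>. \<zeta> \<in> carrier H \<Longrightarrow> act (Z t) \<zeta> = act (X t) \<zeta> \<oplus>\<^bsub>H\<^esub> act (Y t) \<zeta>"
    and \<xi>: "\<xi> \<in> carrier H"
  shows "act (\<Delta> Z t) \<xi> = act (\<Delta> X t) \<xi> \<oplus>\<^bsub>H\<^esub> act (\<Delta> Y t) \<xi>"
proof -
  have "act (\<Delta> Z t) \<xi> = act (\<Delta> X t \<oplus> \<Delta> Y t) \<xi>"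
  proof (rule act_eqI)
    fix \<xi> \<eta> assume u: "\<xi> \<in> carrier H" "\<eta> \<in> carrier H" "hnorm H \<xi> = 1" "hnorm H \<eta> = 1"
    define W where "W = \<Delta> (elem L h (rank1 \<xi> \<eta>)) t"
    have W: "W \<in> carrier A"
      using u by (simp add: W_def B_closed)
    note F = \<Delta>_antisymmetry[OF _ u(1,3) u(2,4) W_def]
    have "coef (\<Delta> X t \<oplus> \<Delta> Y t) \<xi> \<eta> = coef (\<Delta> X t) \<xi> \<eta> + coef (\<Delta> Y t) \<xi> \<eta>"
      using X Y u by (simp add: act_add H.cinner_add_left)
    then show "coef (\<Delta> Z t) \<xi> \<eta> = coef (\<Delta> X t \<oplus> \<Delta> Y t) \<xi> \<eta>"
      unfolding F[OF X] F[OF Y] F[OF Z] using X Y Z u W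
      by (simp add: eq act_add_vec H.cinner_add_left algebra_simps)
  qed (simp_all add: X Y Z \<xi>)
  then show ?thesis
    using X Y \<xi> by (simp add: act_add)
qed

lemma \<Delta>_scale_at:
  assumes X: "X \<in> carrier B" and Z: "Z \<in> carrier B"
    and eq: "\<And>\<zeta>. \<zeta> \<in> carrier H \<Longrightarrow> act (Z t) \<zeta> = c \<odot>\<^bsub>H\<^esub> act (X t) \<zeta>"
    and \<xi>: "\<xi> \<in> carrier H"
  shows "act (\<Delta> Z t) \<xi> = c \<odot>\<^bsub>H\<^esub> act (\<Delta> X t) \<xi>"
proof -
  have "act (\<Delta> Z t) \<xi> = act (c \<odot> \<Delta> X t) \<xi>"
  proof (rule act_eqI)
    fix \<xi> \<eta> assume u: "\<xi> \<in> carrier H" "\<eta> \<in> carrier H" "hnorm H \<xi> = 1" "hnorm H \<eta> = 1"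
    define W where "W = \<Delta> (elem L h (rank1 \<xi> \<eta>)) t"
    have W: "W \<in> carrier A"
      using u by (simp add: W_def B_closed)
    note F = \<Delta>_antisymmetry[OF _ u(1,3) u(2,4) W_def]
    have "coef (c \<odot> \<Delta> X t) \<xi> \<eta> = c * coef (\<Delta> X t) \<xi> \<eta>"
      using X u by (simp add: act_scale H.cinner_smult_left)
    then show "coef (\<Delta> Z t) \<xi> \<eta> = coef (c \<odot> \<Delta> X t) \<xi> \<eta>"
      unfolding F[OF X] F[OF Z] using X Z u W
      by (simp add: eq act_scale_vec H.cinner_smult_left algebra_simps)
  qed (simp_all add: X Z \<xi>)
  then show ?thesis
    using X \<xi> by (simp add: act_scale)
qed

section \<open>The form tr(c \<Delta>(x)) on operators of rank one\<close>

definition \<delta> :: "'a \<Rightarrow> 'a" where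
  "\<delta> m = \<Delta> (elem L h m) t"

lemma \<delta>_closed [simp]: "m \<in> carrier A \<Longrightarrow> \<delta> m \<in> carrier A"
  by (simp add: \<delta>_def B_closed)

lemma \<delta>_add:
  assumes "m \<in> carrier A" "n \<in> carrier A" "k \<in> carrier A"
    and "\<And>\<zeta>. \<zeta> \<in> carrier H \<Longrightarrow> act k \<zeta> = act m \<zeta> \<oplus>\<^bsub>H\<^esub> act n \<zeta>" and "\<xi> \<in> carrier H"
  shows "act (\<delta> k) \<xi> = act (\<delta> m) \<xi> \<oplus>\<^bsub>H\<^esub> act (\<delta> n) \<xi>"
  unfolding \<delta>_def using assms by (intro \<Delta>_add_at) (simp_all add: B_closed at_simps)

lemma \<delta>_scale:
  assumes "m \<in> carrier A" "k \<in> carrier A"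
    and "\<And>\<zeta>. \<zeta> \<in> carrier H \<Longrightarrow> act k \<zeta> = c \<odot>\<^bsub>H\<^esub> act m \<zeta>" and "\<xi> \<in> carrier H"
  shows "act (\<delta> k) \<xi> = c \<odot>\<^bsub>H\<^esub> act (\<delta> m) \<xi>"
  unfolding \<delta>_def using assms by (intro \<Delta>_scale_at) (simp_all add: B_closed at_simps)

lemma \<delta>_antisymmetry:
  assumes m: "m \<in> carrier A"
    and \<xi>: "\<xi> \<in> carrier H" "hnorm H \<xi> = 1" and \<eta>: "\<eta> \<in> carrier H" "hnorm H \<eta> = 1"
  shows "coef (\<delta> m) \<xi> \<eta> = - (coef (\<delta> (rank1 \<xi> \<eta>)) (act m \<xi>) \<xi> + coef m (act (\<delta> (rank1 \<xi> \<eta>)) \<eta>) \<eta>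
      - coef (\<delta> (rank1 \<xi> \<eta>)) \<eta> \<xi> * coef m \<xi> \<eta>)"
  using \<Delta>_antisymmetry[OF elem_closed[OF h m] \<xi> \<eta> refl] m by (simp add: \<delta>_def at_simps)

text \<open>The number tr(c \<Delta>(x)) for \<open>c = rank1 \<xi> \<eta>\<close> and
  \<open>x = rank1 \<zeta> \<theta>\<close>. It is linear in the first and third argument and
  conjugate-linear in the second and fourth.\<close>

definition S :: "'h \<Rightarrow> 'h \<Rightarrow> 'h \<Rightarrow> 'h \<Rightarrow> complex" where
  "S \<xi> \<eta> \<zeta> \<theta> = coef (\<delta> (rank1 \<zeta> \<theta>)) \<xi> \<eta>"

context
  fixes \<xi> \<eta> \<zeta> \<theta> x assumes vec: "\<xi> \<in> carrier H" "\<eta> \<in> carrier H" "\<zeta> \<in> carrier H" "\<theta> \<in> carrier H" "x \<in> carrier H"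
begin

lemma S_linear:
  "S (\<xi> \<oplus>\<^bsub>H\<^esub> x) \<eta> \<zeta> \<theta> = S \<xi> \<eta> \<zeta> \<theta> + S x \<eta> \<zeta> \<theta>" "S (c \<odot>\<^bsub>H\<^esub> \<xi>) \<eta> \<zeta> \<theta> = c * S \<xi> \<eta> \<zeta> \<theta>"
  "S \<xi> (\<eta> \<oplus>\<^bsub>H\<^esub> x) \<zeta> \<theta> = S \<xi> \<eta> \<zeta> \<theta> + S \<xi> x \<zeta> \<theta>" "S \<xi> (c \<odot>\<^bsub>H\<^esub> \<eta>) \<zeta> \<theta> = cnj c * S \<xi> \<eta> \<zeta> \<theta>"
  using vec by (simp_all add: S_def act_simps H.cinner_linear)

lemma S_linear':
  "S \<xi> \<eta> (\<zeta> \<oplus>\<^bsub>H\<^esub> x) \<theta> = S \<xi> \<eta> \<zeta> \<theta> + S \<xi> \<eta> x \<theta>" "S \<xi> \<eta> (c \<odot>\<^bsub>H\<^esub> \<zeta>) \<theta> = c * S \<xi> \<eta> \<zeta> \<theta>"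
  "S \<xi> \<eta> \<zeta> (\<theta> \<oplus>\<^bsub>H\<^esub> x) = S \<xi> \<eta> \<zeta> \<theta> + S \<xi> \<eta> \<zeta> x" "S \<xi> \<eta> \<zeta> (c \<odot>\<^bsub>H\<^esub> \<theta>) = cnj c * S \<xi> \<eta> \<zeta> \<theta>"
proof -
  have "act (\<delta> (rank1 (\<zeta> \<oplus>\<^bsub>H\<^esub> x) \<theta>)) \<xi> = act (\<delta> (rank1 \<zeta> \<theta>)) \<xi> \<oplus>\<^bsub>H\<^esub> act (\<delta> (rank1 x \<theta>)) \<xi>"
    using vec by (intro \<delta>_add) (simp_all add: act_rank1 H.scale_add_right)
  then show "S \<xi> \<eta> (\<zeta> \<oplus>\<^bsub>H\<^esub> x) \<theta> = S \<xi> \<eta> \<zeta> \<theta> + S \<xi> \<eta> x \<theta>"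
    using vec by (simp add: S_def H.cinner_linear)
  have "act (\<delta> (rank1 (c \<odot>\<^bsub>H\<^esub> \<zeta>) \<theta>)) \<xi> = c \<odot>\<^bsub>H\<^esub> act (\<delta> (rank1 \<zeta> \<theta>)) \<xi>"
    using vec by (intro \<delta>_scale) (simp_all add: act_rank1 H.scale_scale mult.commute)
  then show "S \<xi> \<eta> (c \<odot>\<^bsub>H\<^esub> \<zeta>) \<theta> = c * S \<xi> \<eta> \<zeta> \<theta>"
    using vec by (simp add: S_def H.cinner_linear)
  have "act (\<delta> (rank1 \<zeta> (\<theta> \<oplus>\<^bsub>H\<^esub> x))) \<xi> = act (\<delta> (rank1 \<zeta> \<theta>)) \<xi> \<oplus>\<^bsub>H\<^esub> act (\<delta> (rank1 \<zeta> x)) \<xi>"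
    using vec by (intro \<delta>_add) (simp_all add: act_rank1 H.cinner_linear H.scale_add_left)
  then show "S \<xi> \<eta> \<zeta> (\<theta> \<oplus>\<^bsub>H\<^esub> x) = S \<xi> \<eta> \<zeta> \<theta> + S \<xi> \<eta> \<zeta> x"
    using vec by (simp add: S_def H.cinner_linear)
  have "act (\<delta> (rank1 \<zeta> (c \<odot>\<^bsub>H\<^esub> \<theta>))) \<xi> = cnj c \<odot>\<^bsub>H\<^esub> act (\<delta> (rank1 \<zeta> \<theta>)) \<xi>"
    using vec by (intro \<delta>_scale) (simp_all add: act_rank1 H.cinner_linear H.scale_scale)
  then show "S \<xi> \<eta> \<zeta> (c \<odot>\<^bsub>H\<^esub> \<theta>) = cnj c * S \<xi> \<eta> \<zeta> \<theta>"
    using vec by (simp add: S_def H.cinner_linear)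
qed

end

lemma S_zero:
  assumes "\<xi> \<in> carrier H" "\<eta> \<in> carrier H" "\<zeta> \<in> carrier H" "\<theta> \<in> carrier H"
  shows "S \<zero>\<^bsub>H\<^esub> \<eta> \<zeta> \<theta> = 0" "S \<xi> \<zero>\<^bsub>H\<^esub> \<zeta> \<theta> = 0" "S \<xi> \<eta> \<zeta> \<zero>\<^bsub>H\<^esub> = 0"
  using assms S_linear(2,4)[of "\<zero>\<^bsub>H\<^esub>" "\<zero>\<^bsub>H\<^esub>" "\<zero>\<^bsub>H\<^esub>" "\<zero>\<^bsub>H\<^esub>" "\<zero>\<^bsub>H\<^esub>" 0]
    S_linear'(4)[of \<xi> \<eta> \<zeta> "\<zero>\<^bsub>H\<^esub>" "\<zero>\<^bsub>H\<^esub>" 0]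
  by (simp_all add: S_def)

text \<open>The two conditions give c x = 0 and x c = 0. On the right of
  \<open>\<delta>_antisymmetry\<close> every term contains x \<xi> or a coefficient of x against
  \<eta>, and both vanish.\<close>

lemma S_orthogonal:
  assumes v: "\<xi> \<in> carrier H" "\<eta> \<in> carrier H" "\<zeta> \<in> carrier H" "\<theta> \<in> carrier H"
    and orth: "cinner H \<zeta> \<eta> = 0" "cinner H \<xi> \<theta> = 0"
  shows "S \<xi> \<eta> \<zeta> \<theta> = 0"
proof (rule H.unit_multiple[OF v(1)])
  fix c u assume u: "u \<in> carrier H" "hnorm H u = 1" "\<xi> = c \<odot>\<^bsub>H\<^esub> u"
  show ?thesis
  proof (rule H.unit_multiple[OF v(2)])
    fix c' u' assume u': "u' \<in> carrier H" "hnorm H u' = 1" "\<eta> = c' \<odot>\<^bsub>H\<^esub> u'"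
    show ?thesis
    proof (cases "c = 0 \<or> c' = 0")
      case True
      then show ?thesis
        using u u' v S_zero[OF v] by auto
    next
      case False
      then have "cinner H \<zeta> u' = 0" "cinner H u \<theta> = 0"
        using orth u u' v by (simp_all add: H.cinner_linear)
      then have "S u u' \<zeta> \<theta> = 0"
        unfolding S_def using u u' v
        by (subst \<delta>_antisymmetry) (simp_all add: act_rank1 H.cinner_linear)
      then show ?thesis
        using u u' v by (simp add: S_linear)
    qed
  qed (use S_zero[OF v] in simp)
qed (use S_zero[OF v] in simp)

text \<open>For \<open>m = rank1 \<xi> e\<close> the second and the third term of
  \<open>\<delta>_antisymmetry\<close> cancel.\<close>

lemma S_antisymmetric:
  assumes e: "e \<in> carrier H" "hnorm H e = 1" and \<xi>: "\<xi> \<in> carrier H" and \<theta>: "\<theta> \<in> carrier H"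
  shows "S e \<theta> \<xi> e = - S \<xi> e e \<theta>"
proof (rule H.unit_multiple[OF \<theta>])
  fix c u assume u: "u \<in> carrier H" "hnorm H u = 1" "\<theta> = c \<odot>\<^bsub>H\<^esub> u"
  have ee: "cinner H e e = 1"
    using e by (simp add: H.cinner_self)
  have "S e u \<xi> e = - S \<xi> e e u"
    unfolding S_def using \<delta>_antisymmetry[of "rank1 \<xi> e" e u] e u \<xi>
    by (simp add: act_rank1 H.cinner_linear ee)
  then show ?thesis
    using u e \<xi> by (simp add: S_linear S_linear')
next
  assume "\<theta> = \<zero>\<^bsub>H\<^esub>"
  then show ?thesis
    using S_zero[OF \<xi> e(1) e(1) \<theta>] S_zero[OF e(1) \<theta> \<xi> e(1)] by simp
qed

text \<open>With \<langle>a(\<zeta>), \<eta>\<rangle> = \<open>S e \<eta> \<zeta> e\<close> the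
  right side is the coefficient of the commutator of \<open>a\<close> with
  \<open>rank1 \<zeta> \<theta>\<close>. \<open>sesquilinear_eq_cinner\<close> is applied twice: for
  orthogonal \<open>\<zeta>\<close>, \<open>\<eta>\<close> as a form in \<open>\<xi>\<close>,
  \<open>\<theta>\<close>; then to the remaining difference, which vanishes for orthogonal
  \<open>\<zeta>\<close>, \<open>\<eta>\<close>, as a form in these.\<close>

lemma S_formula:
  assumes e: "e \<in> carrier H" "hnorm H e = 1"
    and v: "\<xi> \<in> carrier H" "\<eta> \<in> carrier H" "\<zeta> \<in> carrier H" "\<theta> \<in> carrier H"
  shows "S \<xi> \<eta> \<zeta> \<theta> = cinner H \<xi> \<theta> * S e \<eta> \<zeta> e - cinner H \<zeta> \<eta> * S e \<theta> \<xi> e"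
proof -
  have ortho: "S \<xi> \<eta> \<zeta> \<theta> = cinner H \<xi> \<theta> * S e \<eta> \<zeta> e"
    if "\<zeta> \<in> carrier H" "\<eta> \<in> carrier H" "cinner H \<zeta> \<eta> = 0" for \<zeta> \<eta>
    using that v e
    by (intro H.sesquilinear_eq_cinner[of "\<lambda>\<xi> \<theta>. S \<xi> \<eta> \<zeta> \<theta>"]) (simp_all add: S_linear S_linear' S_orthogonal)
  have "S e e e e = 0"
    using S_antisymmetric[OF e e(1) e(1)] by simp
  moreover have "S \<xi> \<eta> \<zeta> \<theta> - cinner H \<xi> \<theta> * S e \<eta> \<zeta> e
      = cinner H \<zeta> \<eta> * (S \<xi> e e \<theta> - cinner H \<xi> \<theta> * S e e e e)"
    using v e by (intro H.sesquilinear_eq_cinner[of "\<lambda>\<zeta> \<eta>. S \<xi> \<eta> \<zeta> \<theta> - cinner H \<xi> \<theta> * S e \<eta> \<zeta> e"])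
      (simp_all add: S_linear S_linear' ortho algebra_simps)
  ultimately show ?thesis
    using S_antisymmetric[OF e v(1) v(4)] by (simp add: algebra_simps)
qed

text \<open>\<open>S_formula\<close> determines \<open>\<delta> (rank1 \<xi> \<eta>)\<close>
  completely; inserted into \<open>\<Delta>_antisymmetry\<close> it determines every coefficient of
  \<open>\<Delta> X t\<close>, for \<open>X t\<close> of any rank.\<close>

lemma \<Delta>_inner:
  assumes e: "e \<in> carrier H" "hnorm H e = 1" and X: "X \<in> carrier B"
    and a_def: "\<And>\<zeta>. a \<zeta> = act (\<delta> (rank1 \<zeta> e)) e"
    and \<xi>: "\<xi> \<in> carrier H"
  shows "act (\<Delta> X t) \<xi> = a (act (X t) \<xi>) \<oplus>\<^bsub>H\<^esub> (- 1) \<odot>\<^bsub>H\<^esub> act (X t) (a \<xi>)"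
proof -
  have a: "a \<zeta> \<in> carrier H" if "\<zeta> \<in> carrier H" for \<zeta>
    using that e by (simp add: a_def)
  have a_scale: "a (c \<odot>\<^bsub>H\<^esub> \<zeta>) = c \<odot>\<^bsub>H\<^esub> a \<zeta>" if "\<zeta> \<in> carrier H" for c \<zeta>
    unfolding a_def using that e
    by (intro \<delta>_scale) (simp_all add: act_rank1 H.scale_scale mult.commute)
  have Sa: "S e \<eta> \<zeta> e = cinner H (a \<zeta>) \<eta>" for \<eta> \<zeta>
    by (simp add: S_def a_def)
  have unit: "coef (\<Delta> X t) \<xi> \<eta> = cinner H (a (act (X t) \<xi>)) \<eta> - coef (X t) (a \<xi>) \<eta>"
    if \<xi>: "\<xi> \<in> carrier H" "hnorm H \<xi> = 1" and \<eta>: "\<eta> \<in> carrier H" "hnorm H \<eta> = 1" for \<xi> \<eta>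
  proof -
    define Y where "Y = \<delta> (rank1 \<xi> \<eta>)"
    have Yc: "Y \<in> carrier A"
      using \<xi> \<eta> by (simp add: Y_def)
    have Y: "coef Y z w = cinner H z \<eta> * cinner H (a \<xi>) w - cinner H \<xi> w * cinner H (a z) \<eta>"
      if "z \<in> carrier H" "w \<in> carrier H" for z w
      using S_formula[OF e that \<xi>(1) \<eta>(1)] by (simp add: Sa) (simp add: S_def Y_def)
    have \<xi>\<xi>: "cinner H \<xi> \<xi> = 1" and \<eta>\<eta>: "cinner H \<eta> \<eta> = 1"
      using \<xi> \<eta> by (simp_all add: H.cinner_self)
    have Y\<eta>: "act Y \<eta> = a \<xi> \<oplus>\<^bsub>H\<^esub> (- cinner H (a \<eta>) \<eta>) \<odot>\<^bsub>H\<^esub> \<xi>"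
      using \<xi> \<eta> a Yc by (intro H.cinner_eqI) (simp_all add: Y \<eta>\<eta> H.cinner_linear)
    have "coef (\<Delta> X t) \<xi> \<eta> = - (coef Y (act (X t) \<xi>) \<xi> + coef (X t) (act Y \<eta>) \<eta>
        - coef Y \<eta> \<xi> * coef (X t) \<xi> \<eta>)"
      using X \<xi> \<eta> by (intro \<Delta>_antisymmetry) (simp_all add: Y_def \<delta>_def)
    \<comment> \<open>The contributions of \<langle>a(\<xi>), \<xi>\<rangle> and \<langle>a(\<eta>),
      \<eta>\<rangle>, each multiplied by \<langle>X(t)\<xi>, \<eta>\<rangle>, cancel.\<close>
    then show ?thesis
      using X \<xi> \<eta> a Yc by (simp add: Y\<eta> Y \<xi>\<xi> \<eta>\<eta> act_simps H.cinner_linear algebra_simps)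
  qed
  show ?thesis
  proof (rule H.cinner_eqI)
    fix \<eta> assume \<eta>: "\<eta> \<in> carrier H"
    have "coef (\<Delta> X t) \<xi> \<eta> = cinner H (a (act (X t) \<xi>)) \<eta> - coef (X t) (a \<xi>) \<eta>"
    proof (rule H.unit_multiple[OF \<xi>])
      fix c u assume u: "u \<in> carrier H" "hnorm H u = 1" "\<xi> = c \<odot>\<^bsub>H\<^esub> u"
      show ?thesis
      proof (rule H.unit_multiple[OF \<eta>])
        fix c' u' assume u': "u' \<in> carrier H" "hnorm H u' = 1" "\<eta> = c' \<odot>\<^bsub>H\<^esub> u'"
        show ?thesis
          using u u' X a
          by (simp add: a_scale act_simps H.cinner_linear unit[OF u(1,2) u'(1,2)]
              right_diff_distrib)
      next
        assume "\<eta> = \<zero>\<^bsub>H\<^esub>"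
        then show ?thesis
          using X \<xi> a by simp
      qed
    next
      assume "\<xi> = \<zero>\<^bsub>H\<^esub>"
      moreover have "a \<zero>\<^bsub>H\<^esub> = \<zero>\<^bsub>H\<^esub>"
        using a_scale[of "\<zero>\<^bsub>H\<^esub>" 0] a by simp
      ultimately show ?thesis
        using X \<eta> by simp
    qed
    then show "coef (\<Delta> X t) \<xi> \<eta>
        = cinner H (a (act (X t) \<xi>) \<oplus>\<^bsub>H\<^esub> (- 1) \<odot>\<^bsub>H\<^esub> act (X t) (a \<xi>)) \<eta>"
      using X \<xi> \<eta> a by (simp add: H.cinner_linear)
  qed (use X \<xi> a in auto)
qed

text \<open>A commutator satisfies the product rule. A nonzero \<open>\<xi>\<close> provides the
  unit vector on which \<open>a\<close> is built.\<close>

lemma \<Delta>_mult_at: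
  assumes X: "X \<in> carrier B" and Y: "Y \<in> carrier B" and \<xi>: "\<xi> \<in> carrier H"
  shows "act (\<Delta> (X \<otimes>\<^bsub>B\<^esub> Y) t) \<xi> = act (\<Delta> X t \<otimes> Y t \<oplus> X t \<otimes> \<Delta> Y t) \<xi>"
proof (rule H.unit_multiple[OF \<xi>])
  fix c e assume e: "e \<in> carrier H" "hnorm H e = 1"
  define a where "a \<zeta> = act (\<delta> (rank1 \<zeta> e)) e" for \<zeta>
  have a: "a \<zeta> \<in> carrier H" if "\<zeta> \<in> carrier H" for \<zeta>
    using that e by (simp add: a_def)
  note \<Delta> = \<Delta>_inner[OF e _ a_def]
  show ?thesis
  proof (rule H.cinner_eqI)
    fix \<eta> assume \<eta>: "\<eta> \<in> carrier H"
    show "coef (\<Delta> (X \<otimes>\<^bsub>B\<^esub> Y) t) \<xi> \<eta> = coef (\<Delta> X t \<otimes> Y t \<oplus> X t \<otimes> \<Delta> Y t) \<xi> \<eta>"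
      using X Y \<xi> \<eta> a
      by (simp add: \<Delta> B_closed act_add act_mult at_simps act_add_vec act_scale_vec H.cinner_linear)
  qed (use X Y \<xi> in \<open>auto simp: B_closed\<close>)
qed (use X Y in \<open>simp add: B_closed\<close>)

end

section \<open>From points to functions\<close>

context normed_algebra
begin

text \<open>Each law is an equality of functions, so it is tested at one point and in one
  representation at a time, with \<open>h\<close> and \<open>a\<close> chosen anew for each of them;
  \<open>sep\<close> turns equal actions into equality in \<open>A\<close>.\<close>

theorem weak_2_local_derivation_imp_derivation:
  assumes L: "locally_compact_space L" "Hausdorff_space L"
    and rep: "\<And>i. i \<in> I \<Longrightarrow> coefficient_representation A (H i) (act i) (rank1 i)"
    and sep: "\<And>m n. \<lbrakk>m \<in> carrier A; n \<in> carrier A;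
        \<And>i \<xi>. \<lbrakk>i \<in> I; \<xi> \<in> carrier (H i)\<rbrakk> \<Longrightarrow> act i m \<xi> = act i n \<xi>\<rbrakk> \<Longrightarrow> m = n"
    and weak: "weak_2_local_derivation (C0 L A) \<Delta>"
  shows "derivation (C0 L A) \<Delta>"
proof -
  let ?B = "C0 L A"
  have \<Delta>: "\<Delta> X \<in> carrier ?B" if "X \<in> carrier ?B" for X
    using weak that unfolding weak_2_local_derivation_def by (auto dest: funcset_mem)
  have point: "\<exists>h. pointed_weak_2_local A (H i) (act i) (rank1 i) L t h \<Delta>"
    if i: "i \<in> I" and t: "t \<in> topspace L" for i t
  proof -
    obtain h where h: "scalar_C0 L h" "h t = 1" "\<And>s. cmod (h s) \<le> 1"
      using L t by (rule bump_function) (rule that)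
    show ?thesis
      by (intro exI[of _ h] pointed_weak_2_local.intro pointed_representation.intro rep[OF i]
          pointed_representation_axioms.intro pointed_weak_2_local_axioms.intro t h weak)
  qed
  have eqI: "X = Y" if X: "X \<in> carrier ?B" and Y: "Y \<in> carrier ?B"
    and eq: "\<And>t i \<xi>. \<lbrakk>t \<in> topspace L; i \<in> I; \<xi> \<in> carrier (H i)\<rbrakk> \<Longrightarrow> act i (X t) \<xi> = act i (Y t) \<xi>"
    for X Y
  proof (rule extensionalityI)
    show "X \<in> extensional (topspace L)" "Y \<in> extensional (topspace L)"
      using X Y by (simp_all add: C0_iff)
    show "X t = Y t" if t: "t \<in> topspace L" for t
      using C0_closed[OF X t] C0_closed[OF Y t] eq[OF t] by (rule sep)
  qed
  show ?thesis
    unfolding derivation_def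
  proof (intro conjI ballI allI)
    show "\<Delta> \<in> carrier ?B \<rightarrow> carrier ?B"
      using \<Delta> by (rule funcsetI)
    fix X c assume X: "X \<in> carrier ?B"
    show "\<Delta> (c \<odot>\<^bsub>?B\<^esub> X) = c \<odot>\<^bsub>?B\<^esub> \<Delta> X"
    proof (rule eqI)
      fix t i \<xi> assume t: "t \<in> topspace L" and i: "i \<in> I" and \<xi>: "\<xi> \<in> carrier (H i)"
      obtain h where "pointed_weak_2_local A (H i) (act i) (rank1 i) L t h \<Delta>"
        using point[OF i t] by (rule exE)
      then interpret pointed_weak_2_local A "H i" "act i" "rank1 i" L t h \<Delta> .
      have "act i (\<Delta> (c \<odot>\<^bsub>?B\<^esub> X) t) \<xi> = c \<odot>\<^bsub>H i\<^esub> act i (\<Delta> X t) \<xi>"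
        by (rule \<Delta>_scale_at[OF X C0_scale_closed[OF X] _ \<xi>]) (simp add: at_simps act_scale X)
      then show "act i (\<Delta> (c \<odot>\<^bsub>?B\<^esub> X) t) \<xi> = act i ((c \<odot>\<^bsub>?B\<^esub> \<Delta> X) t) \<xi>"
        using X \<xi> by (simp add: at_simps act_scale)
    qed (simp_all add: \<Delta> X C0_scale_closed)
    fix Y assume Y: "Y \<in> carrier ?B"
    show "\<Delta> (X \<oplus>\<^bsub>?B\<^esub> Y) = \<Delta> X \<oplus>\<^bsub>?B\<^esub> \<Delta> Y"
    proof (rule eqI)
      fix t i \<xi> assume t: "t \<in> topspace L" and i: "i \<in> I" and \<xi>: "\<xi> \<in> carrier (H i)"
      obtain h where "pointed_weak_2_local A (H i) (act i) (rank1 i) L t h \<Delta>"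
        using point[OF i t] by (rule exE)
      then interpret pointed_weak_2_local A "H i" "act i" "rank1 i" L t h \<Delta> .
      have "act i (\<Delta> (X \<oplus>\<^bsub>?B\<^esub> Y) t) \<xi> = act i (\<Delta> X t) \<xi> \<oplus>\<^bsub>H i\<^esub> act i (\<Delta> Y t) \<xi>"
        by (rule \<Delta>_add_at[OF X Y C0_add_closed[OF X Y] _ \<xi>]) (simp add: at_simps act_add X Y)
      then show "act i (\<Delta> (X \<oplus>\<^bsub>?B\<^esub> Y) t) \<xi> = act i ((\<Delta> X \<oplus>\<^bsub>?B\<^esub> \<Delta> Y) t) \<xi>"
        using X Y \<xi> by (simp add: at_simps act_add)
    qed (simp_all add: \<Delta> X Y C0_add_closed)
    show "\<Delta> (X \<otimes>\<^bsub>?B\<^esub> Y) = \<Delta> X \<otimes>\<^bsub>?B\<^esub> Y \<oplus>\<^bsub>?B\<^esub> X \<otimes>\<^bsub>?B\<^esub> \<Delta> Y"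
    proof (rule eqI)
      fix t i \<xi> assume t: "t \<in> topspace L" and i: "i \<in> I" and \<xi>: "\<xi> \<in> carrier (H i)"
      obtain h where "pointed_weak_2_local A (H i) (act i) (rank1 i) L t h \<Delta>"
        using point[OF i t] by (rule exE)
      then interpret pointed_weak_2_local A "H i" "act i" "rank1 i" L t h \<Delta> .
      show "act i (\<Delta> (X \<otimes>\<^bsub>?B\<^esub> Y) t) \<xi>
          = act i ((\<Delta> X \<otimes>\<^bsub>?B\<^esub> Y \<oplus>\<^bsub>?B\<^esub> X \<otimes>\<^bsub>?B\<^esub> \<Delta> Y) t) \<xi>"
        using \<Delta>_mult_at[OF X Y \<xi>] by (simp add: at_simps)
    qed (simp_all add: \<Delta> X Y C0_add_closed C0_mult_closed)
  qed
qed

end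

lemma cstar_algebra_imp_normed_algebra:
  assumes "cstar_algebra A"
  shows "normed_algebra A"
proof -
  interpret cstar_algebra A by fact
  interpret complex_module A ..
  show ?thesis
    by unfold_locales
      (simp_all add: mult_closed mult_assoc mult_distr_left mult_distr_right smult_mult_left
        smult_mult_right nrm_eq_zero nrm_triangle nrm_smult nrm_mult)
qed

section \<open>Bounded operators\<close>

lemma bounded_operators_simps [simp]:
  "carrier (bounded_operators H) = {T. is_bounded_operator H T}"
  "S \<oplus>\<^bsub>bounded_operators H\<^esub> T = (\<lambda>x\<in>carrier H. S x \<oplus>\<^bsub>H\<^esub> T x)"
  "S \<otimes>\<^bsub>bounded_operators H\<^esub> T = (\<lambda>x\<in>carrier H. S (T x))"
  "c \<odot>\<^bsub>bounded_operators H\<^esub> T = (\<lambda>x\<in>carrier H. c \<odot>\<^bsub>H\<^esub> T x)"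
  "\<zero>\<^bsub>bounded_operators H\<^esub> = (\<lambda>x\<in>carrier H. \<zero>\<^bsub>H\<^esub>)"
  "nrm (bounded_operators H) = operator_norm H"
  by (simp_all add: bounded_operators_def)

definition op_rank1 :: "('h, 'm) hilbert_scheme \<Rightarrow> 'h \<Rightarrow> 'h \<Rightarrow> 'h \<Rightarrow> 'h" where
  "op_rank1 H \<xi> \<eta> = (\<lambda>z\<in>carrier H. cinner H z \<eta> \<odot>\<^bsub>H\<^esub> \<xi>)"

context complex_hilbert_space
begin

lemma bounded_operatorD:
  assumes "is_bounded_operator H T"
  shows "T \<in> extensional (carrier H)"
    "\<And>x. x \<in> carrier H \<Longrightarrow> T x \<in> carrier H"
    "\<And>x y. x \<in> carrier H \<Longrightarrow> y \<in> carrier H \<Longrightarrow> T (x \<oplus> y) = T x \<oplus> T y"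
    "\<And>c x. x \<in> carrier H \<Longrightarrow> T (c \<odot> x) = c \<odot> T x"
  using assms unfolding is_bounded_operator_def PiE_iff by (simp_all add: Ball_def)

lemma bounded_operator_bound:
  assumes "is_bounded_operator H T"
  obtains K where "0 \<le> K" "\<And>x. x \<in> carrier H \<Longrightarrow> hnorm H (T x) \<le> K * hnorm H x"
proof -
  obtain K where K: "\<forall>x\<in>carrier H. hnorm H (T x) \<le> K * hnorm H x"
    using assms unfolding is_bounded_operator_def by (elim conjE exE)
  show thesis
  proof (rule that[of "max 0 K"])
    fix x assume x: "x \<in> carrier H"
    have "K * hnorm H x \<le> max 0 K * hnorm H x"
      by (rule mult_right_mono) (simp_all add: hnorm_nonneg x)
    then show "hnorm H (T x) \<le> max 0 K * hnorm H x"
      using K x by (meson order_trans)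
  qed simp
qed

lemma bounded_operatorI:
  assumes "\<And>x. x \<in> carrier H \<Longrightarrow> T x \<in> carrier H"
    "\<And>x y. x \<in> carrier H \<Longrightarrow> y \<in> carrier H \<Longrightarrow> T (x \<oplus> y) = T x \<oplus> T y"
    "\<And>c x. x \<in> carrier H \<Longrightarrow> T (c \<odot> x) = c \<odot> T x"
    "\<And>x. x \<in> carrier H \<Longrightarrow> hnorm H (T x) \<le> K * hnorm H x"
  shows "is_bounded_operator H (\<lambda>x\<in>carrier H. T x)"
  unfolding is_bounded_operator_def
  by (intro conjI ballI allI exI[of _ K]) (simp_all add: assms)

lemma op_rank1_bounded:
  assumes "\<xi> \<in> carrier H" "\<eta> \<in> carrier H"
  shows "is_bounded_operator H (op_rank1 H \<xi> \<eta>)"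
  unfolding op_rank1_def
proof (rule bounded_operatorI)
  fix x assume x: "x \<in> carrier H"
  have "hnorm H (cinner H x \<eta> \<odot> \<xi>) = cmod (cinner H x \<eta>) * hnorm H \<xi>"
    using assms by (simp add: hnorm_scale)
  also have "\<dots> \<le> (hnorm H x * hnorm H \<eta>) * hnorm H \<xi>"
    using x assms by (intro mult_right_mono Cauchy_Schwarz hnorm_nonneg)
  finally show "hnorm H (cinner H x \<eta> \<odot> \<xi>) \<le> (hnorm H \<eta> * hnorm H \<xi>) * hnorm H x"
    by (simp add: mult_ac)
qed (use assms in \<open>simp_all add: cinner_linear scale_add_left scale_scale\<close>)

lemma op_rank1_zero: "\<eta> \<in> carrier H \<Longrightarrow> op_rank1 H \<zero> \<eta> = (\<lambda>x\<in>carrier H. \<zero>)"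
  by (simp add: op_rank1_def)

lemma bounded_operator_zero: "is_bounded_operator H (\<lambda>x\<in>carrier H. \<zero>)"
  using op_rank1_bounded[of \<zero> \<zero>] by (simp add: op_rank1_zero)

lemma bounded_operator_comp:
  assumes S: "is_bounded_operator H S" and T: "is_bounded_operator H T"
  shows "is_bounded_operator H (\<lambda>x\<in>carrier H. S (T x))"
proof -
  obtain K K' where K: "0 \<le> K" "\<And>x. x \<in> carrier H \<Longrightarrow> hnorm H (S x) \<le> K * hnorm H x"
    and K': "0 \<le> K'" "\<And>x. x \<in> carrier H \<Longrightarrow> hnorm H (T x) \<le> K' * hnorm H x"
    using bounded_operator_bound[OF S] bounded_operator_bound[OF T] by metis
  show ?thesis
  proof (rule bounded_operatorI)
    fix x assume x: "x \<in> carrier H"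
    show "hnorm H (S (T x)) \<le> (K * K') * hnorm H x"
      using K(2)[OF bounded_operatorD(2)[OF T x]] mult_left_mono[OF K'(2)[OF x] K(1)]
      by (simp add: mult.assoc)
  qed (simp_all add: bounded_operatorD[OF S] bounded_operatorD[OF T])
qed

lemma bounded_operator_add:
  assumes S: "is_bounded_operator H S" and T: "is_bounded_operator H T"
  shows "is_bounded_operator H (\<lambda>x\<in>carrier H. S x \<oplus> T x)"
proof -
  obtain K K' where K: "0 \<le> K" "\<And>x. x \<in> carrier H \<Longrightarrow> hnorm H (S x) \<le> K * hnorm H x"
    and K': "0 \<le> K'" "\<And>x. x \<in> carrier H \<Longrightarrow> hnorm H (T x) \<le> K' * hnorm H x"
    using bounded_operator_bound[OF S] bounded_operator_bound[OF T] by metis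
  show ?thesis
  proof (rule bounded_operatorI)
    fix x assume x: "x \<in> carrier H"
    have "hnorm H (S x \<oplus> T x) \<le> hnorm H (S x) + hnorm H (T x)"
      using x by (intro hnorm_triangle bounded_operatorD[OF S] bounded_operatorD[OF T])
    then show "hnorm H (S x \<oplus> T x) \<le> (K + K') * hnorm H x"
      using K(2)[OF x] K'(2)[OF x] by (simp add: distrib_right)
  qed (simp_all add: bounded_operatorD[OF S] bounded_operatorD[OF T] scale_add_right M.a_ac)
qed

lemma bounded_operator_scale_id: "is_bounded_operator H (\<lambda>x\<in>carrier H. c \<odot> x)"
  by (rule bounded_operatorI[where K = "cmod c"])
    (simp_all add: scale_add_right scale_scale mult.commute hnorm_scale)

text \<open>With scaling as a composition, boundedness and compactness of multiples follow from the
  results on compositions.\<close>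

lemma scale_eq_comp:
  assumes "is_bounded_operator H T"
  shows "(\<lambda>x\<in>carrier H. c \<odot> T x) = (\<lambda>x\<in>carrier H. (\<lambda>x\<in>carrier H. c \<odot> x) (T x))"
  by (rule restrict_ext) (simp add: bounded_operatorD[OF assms])

lemma bounded_operator_scale:
  assumes "is_bounded_operator H T"
  shows "is_bounded_operator H (\<lambda>x\<in>carrier H. c \<odot> T x)"
  unfolding scale_eq_comp[OF assms] using bounded_operator_scale_id assms
  by (rule bounded_operator_comp)

section \<open>The operator norm\<close>

lemma unit_ball_nonempty: "\<zero> \<in> {x \<in> carrier H. hnorm H x \<le> 1}"
  by (simp add: hnorm_zero)

lemma operator_norm_le:
  assumes T: "is_bounded_operator H T" and K: "0 \<le> K"
    and le: "\<And>x. x \<in> carrier H \<Longrightarrow> hnorm H (T x) \<le> K * hnorm H x"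
  shows "operator_norm H T \<le> K"
  unfolding operator_norm_def
proof (rule cSUP_least)
  show "{x \<in> carrier H. hnorm H x \<le> 1} \<noteq> {}"
    using unit_ball_nonempty by (metis empty_iff)
  fix x assume x: "x \<in> {x \<in> carrier H. hnorm H x \<le> 1}"
  then have "K * hnorm H x \<le> K * 1"
    using K by (intro mult_left_mono) auto
  then show "hnorm H (T x) \<le> K"
    using le[of x] x by simp
qed

lemma operator_norm_upper:
  assumes T: "is_bounded_operator H T" and x: "x \<in> carrier H" "hnorm H x \<le> 1"
  shows "hnorm H (T x) \<le> operator_norm H T"
  unfolding operator_norm_def
proof (rule cSUP_upper)
  show "x \<in> {x \<in> carrier H. hnorm H x \<le> 1}"
    using x by simp
  obtain K where K: "0 \<le> K" "\<And>x. x \<in> carrier H \<Longrightarrow> hnorm H (T x) \<le> K * hnorm H x"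
    using bounded_operator_bound[OF T] by metis
  show "bdd_above ((\<lambda>x. hnorm H (T x)) ` {x \<in> carrier H. hnorm H x \<le> 1})"
  proof (rule bdd_aboveI2)
    fix x assume x: "x \<in> {x \<in> carrier H. hnorm H x \<le> 1}"
    then have "K * hnorm H x \<le> K * 1"
      using K by (intro mult_left_mono) auto
    then show "hnorm H (T x) \<le> K"
      using K(2)[of x] x by simp
  qed
qed

lemma operator_norm_nonneg: "is_bounded_operator H T \<Longrightarrow> 0 \<le> operator_norm H T"
  using operator_norm_upper[of T \<zero>] hnorm_nonneg[of "T \<zero>"] bounded_operatorD(2)[of T \<zero>]
  by (simp add: hnorm_zero)

lemma operator_norm_bound:
  assumes T: "is_bounded_operator H T" and x: "x \<in> carrier H"
  shows "hnorm H (T x) \<le> operator_norm H T * hnorm H x"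
proof (rule unit_multiple[OF x])
  fix c u assume u: "u \<in> carrier H" "hnorm H u = 1" "x = c \<odot> u"
  have "cmod c * hnorm H (T u) \<le> cmod c * operator_norm H T"
    using u by (intro mult_left_mono operator_norm_upper[OF T]) auto
  then show ?thesis
    using u by (simp add: bounded_operatorD[OF T] hnorm_scale mult.commute)
next
  assume "x = \<zero>"
  moreover have "T (0 \<odot> \<zero>) = 0 \<odot> T \<zero>"
    by (rule bounded_operatorD[OF T]) simp
  ultimately show ?thesis
    using bounded_operatorD(2)[OF T, of \<zero>] by (simp add: hnorm_zero)
qed

lemma operator_norm_zero: "operator_norm H (\<lambda>x\<in>carrier H. \<zero>) = 0"
proof -
  have "operator_norm H (\<lambda>x\<in>carrier H. \<zero>) \<le> 0"
    by (rule operator_norm_le[OF bounded_operator_zero]) (simp_all add: hnorm_zero)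
  then show ?thesis
    using operator_norm_nonneg[OF bounded_operator_zero] by simp
qed

lemma operator_norm_eq_0:
  assumes T: "is_bounded_operator H T"
  shows "operator_norm H T = 0 \<longleftrightarrow> T = (\<lambda>x\<in>carrier H. \<zero>)"
proof
  assume 0: "operator_norm H T = 0"
  show "T = (\<lambda>x\<in>carrier H. \<zero>)"
  proof (rule extensionalityI[OF bounded_operatorD(1)[OF T] restrict_extensional])
    fix x assume x: "x \<in> carrier H"
    have "hnorm H (T x) = 0"
      using operator_norm_bound[OF T x] 0 hnorm_nonneg[OF bounded_operatorD(2)[OF T x]] by simp
    then show "T x = (\<lambda>x\<in>carrier H. \<zero>) x"
      using x hnorm_eq_0[OF bounded_operatorD(2)[OF T x]] by simp
  qed
qed (simp add: operator_norm_zero)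

lemma operator_norm_comp:
  assumes S: "is_bounded_operator H S" and T: "is_bounded_operator H T"
  shows "operator_norm H (\<lambda>x\<in>carrier H. S (T x)) \<le> operator_norm H S * operator_norm H T"
proof (rule operator_norm_le[OF bounded_operator_comp[OF S T]])
  show "0 \<le> operator_norm H S * operator_norm H T"
    by (intro mult_nonneg_nonneg operator_norm_nonneg S T)
  fix x assume x: "x \<in> carrier H"
  have "hnorm H (S (T x)) \<le> operator_norm H S * hnorm H (T x)"
    by (rule operator_norm_bound[OF S bounded_operatorD(2)[OF T x]])
  also have "\<dots> \<le> operator_norm H S * (operator_norm H T * hnorm H x)"
    by (intro mult_left_mono operator_norm_bound[OF T x] operator_norm_nonneg[OF S])
  finally show "hnorm H ((\<lambda>x\<in>carrier H. S (T x)) x)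
      \<le> operator_norm H S * operator_norm H T * hnorm H x"
    using x by (simp add: mult.assoc)
qed

lemma operator_norm_add:
  assumes S: "is_bounded_operator H S" and T: "is_bounded_operator H T"
  shows "operator_norm H (\<lambda>x\<in>carrier H. S x \<oplus> T x) \<le> operator_norm H S + operator_norm H T"
proof (rule operator_norm_le[OF bounded_operator_add[OF S T]])
  show "0 \<le> operator_norm H S + operator_norm H T"
    by (intro add_nonneg_nonneg operator_norm_nonneg S T)
  fix x assume x: "x \<in> carrier H"
  have "hnorm H (S x \<oplus> T x) \<le> hnorm H (S x) + hnorm H (T x)"
    using x by (intro hnorm_triangle bounded_operatorD[OF S] bounded_operatorD[OF T])
  then show "hnorm H ((\<lambda>x\<in>carrier H. S x \<oplus> T x) x)
      \<le> (operator_norm H S + operator_norm H T) * hnorm H x"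
    using x operator_norm_bound[OF S x] operator_norm_bound[OF T x] by (simp add: distrib_right)
qed

lemma operator_norm_scale_le:
  assumes T: "is_bounded_operator H T"
  shows "operator_norm H (\<lambda>x\<in>carrier H. c \<odot> T x) \<le> cmod c * operator_norm H T"
proof (rule operator_norm_le[OF bounded_operator_scale[OF T]])
  show "0 \<le> cmod c * operator_norm H T"
    by (intro mult_nonneg_nonneg operator_norm_nonneg T norm_ge_zero)
  fix x assume x: "x \<in> carrier H"
  show "hnorm H ((\<lambda>x\<in>carrier H. c \<odot> T x) x) \<le> cmod c * operator_norm H T * hnorm H x"
    using x mult_left_mono[OF operator_norm_bound[OF T x], of "cmod c"]
    by (simp add: hnorm_scale bounded_operatorD[OF T] mult.assoc)
qed

text \<open>The reverse inequality is the upper estimate applied to \<open>inverse c\<close> and the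
  operator \<open>c T\<close>.\<close>

lemma operator_norm_scale:
  assumes T: "is_bounded_operator H T"
  shows "operator_norm H (\<lambda>x\<in>carrier H. c \<odot> T x) = cmod c * operator_norm H T"
proof (cases "c = 0")
  case True
  have "(\<lambda>x\<in>carrier H. 0 \<odot> T x) = (\<lambda>x\<in>carrier H. \<zero>)"
    by (rule restrict_ext) (simp add: bounded_operatorD[OF T])
  then show ?thesis
    using True by (simp add: operator_norm_zero)
next
  case False
  define S where "S = (\<lambda>x\<in>carrier H. c \<odot> T x)"
  have S: "is_bounded_operator H S"
    using bounded_operator_scale[OF T] by (simp add: S_def)
  have "(\<lambda>x\<in>carrier H. inverse c \<odot> S x) = T"
    by (rule extensionalityI[OF restrict_extensional bounded_operatorD(1)[OF T]])
      (simp add: S_def scale_scale bounded_operatorD[OF T] False)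
  then have "operator_norm H T \<le> cmod (inverse c) * operator_norm H S"
    using operator_norm_scale_le[OF S, of "inverse c"] by simp
  then have "cmod c * operator_norm H T \<le> operator_norm H S"
    using False by (simp add: norm_inverse norm_divide field_simps)
  then show ?thesis
    using operator_norm_scale_le[OF T, of c] by (simp add: S_def)
qed

end

section \<open>Compact operators\<close>

context complex_hilbert_space
begin

lemma MCauchy_bounded_operator:
  assumes T: "is_bounded_operator H T" and \<sigma>: "MCauchy \<sigma>"
  shows "MCauchy (\<lambda>n. T (\<sigma> n))"
proof -
  obtain K where K: "0 \<le> K" "\<And>x. x \<in> carrier H \<Longrightarrow> hnorm H (T x) \<le> K * hnorm H x"
    using bounded_operator_bound[OF T] by metis
  have \<sigma>H: "\<sigma> n \<in> carrier H" for n
    using \<sigma> unfolding MCauchy_def by auto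
  \<comment> \<open>\<open>K + 1\<close> makes the later quotient by it positive also when
    \<open>K = 0\<close>.\<close>
  have le: "hdist H (T (\<sigma> n)) (T (\<sigma> m)) \<le> (K + 1) * hdist H (\<sigma> n) (\<sigma> m)" for n m
  proof -
    have "T (\<sigma> n) \<oplus> (- 1) \<odot> T (\<sigma> m) = T (\<sigma> n \<oplus> (- 1) \<odot> \<sigma> m)"
      using \<sigma>H by (simp add: bounded_operatorD[OF T])
    then have "hdist H (T (\<sigma> n)) (T (\<sigma> m)) \<le> K * hdist H (\<sigma> n) (\<sigma> m)"
      using \<sigma>H K(2)[of "\<sigma> n \<oplus> (- 1) \<odot> \<sigma> m"] by (simp add: d_eq bounded_operatorD[OF T])
    then show ?thesis
      by (simp add: distrib_right add_increasing2)
  qed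
  show ?thesis
    unfolding MCauchy_def
  proof (intro conjI allI impI)
    show "range (\<lambda>n. T (\<sigma> n)) \<subseteq> carrier H"
      using \<sigma>H bounded_operatorD(2)[OF T] by auto
    fix \<epsilon> :: real assume "0 < \<epsilon>"
    then have "0 < \<epsilon> / (K + 1)"
      using K by simp
    then obtain N where N: "\<And>n n'. N \<le> n \<Longrightarrow> N \<le> n' \<Longrightarrow> hdist H (\<sigma> n) (\<sigma> n') < \<epsilon> / (K + 1)"
      using \<sigma> unfolding MCauchy_def by meson
    show "\<exists>N. \<forall>n n'. N \<le> n \<longrightarrow> N \<le> n' \<longrightarrow> hdist H (T (\<sigma> n)) (T (\<sigma> n')) < \<epsilon>"
    proof (intro exI[of _ N] allI impI)
      fix n n' assume "N \<le> n" "N \<le> n'"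
      then have "(K + 1) * hdist H (\<sigma> n) (\<sigma> n') < \<epsilon>"
        using N[of n n'] K by (simp add: pos_less_divide_eq mult.commute)
      then show "hdist H (T (\<sigma> n)) (T (\<sigma> n')) < \<epsilon>"
        using le[of n n'] by simp
    qed
  qed
qed

lemma MCauchy_add:
  assumes \<sigma>: "MCauchy \<sigma>" and \<tau>: "MCauchy \<tau>"
  shows "MCauchy (\<lambda>n. \<sigma> n \<oplus> \<tau> n)"
proof -
  have H: "\<sigma> n \<in> carrier H" "\<tau> n \<in> carrier H" for n
    using \<sigma> \<tau> unfolding MCauchy_def by auto
  show ?thesis
    unfolding MCauchy_def
  proof (intro conjI allI impI)
    show "range (\<lambda>n. \<sigma> n \<oplus> \<tau> n) \<subseteq> carrier H"
      using H by auto
    fix \<epsilon> :: real assume "0 < \<epsilon>"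
    then have e: "0 < \<epsilon> / 2" by simp
    obtain N where N: "\<And>n n'. N \<le> n \<Longrightarrow> N \<le> n' \<Longrightarrow> hdist H (\<sigma> n) (\<sigma> n') < \<epsilon> / 2"
      using \<sigma> e unfolding MCauchy_def by meson
    obtain N' where N': "\<And>n n'. N' \<le> n \<Longrightarrow> N' \<le> n' \<Longrightarrow> hdist H (\<tau> n) (\<tau> n') < \<epsilon> / 2"
      using \<tau> e unfolding MCauchy_def by meson
    show "\<exists>N. \<forall>n n'. N \<le> n \<longrightarrow> N \<le> n' \<longrightarrow> hdist H (\<sigma> n \<oplus> \<tau> n) (\<sigma> n' \<oplus> \<tau> n') < \<epsilon>"
    proof (intro exI[of _ "max N N'"] allI impI)
      fix n n' assume n: "max N N' \<le> n" "max N N' \<le> n'"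
      show "hdist H (\<sigma> n \<oplus> \<tau> n) (\<sigma> n' \<oplus> \<tau> n') < \<epsilon>"
        using N[of n n'] N'[of n n'] n d_add_le[OF H(1)[of n] H(2)[of n] H(1)[of n'] H(2)[of n']]
        by simp
    qed
  qed
qed

text \<open>In a complete space a set has compact closure iff it is totally bounded, that is, iff
  its sequences have Cauchy subsequences. In this form sums and compositions only require passing to
  subsequences.\<close>

lemma compact_operator_iff:
  "is_compact_operator H T \<longleftrightarrow> is_bounded_operator H T \<and>
    (\<forall>\<sigma>. (\<forall>n. \<sigma> n \<in> carrier H \<and> hnorm H (\<sigma> n) \<le> 1) \<longrightarrow>
      (\<exists>r :: nat \<Rightarrow> nat. strict_mono r \<and> MCauchy (\<lambda>n. T (\<sigma> (r n)))))"
  (is "_ \<longleftrightarrow> _ \<and> ?seq")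
proof (cases "is_bounded_operator H T")
  case True
  let ?U = "{x \<in> carrier H. hnorm H x \<le> 1}"
  have sub: "T ` ?U \<subseteq> carrier H"
    using bounded_operatorD(2)[OF True] by auto
  have "compactin (hilbert_topology H) (hilbert_topology H closure_of (T ` ?U))
      \<longleftrightarrow> mtotally_bounded (T ` ?U)"
    using mtotally_bounded_eq_compact_closure_of[OF hilbert_complete, of "T ` ?U"] sub
    by (simp add: hilbert_topology_def)
  also have "\<dots> \<longleftrightarrow> ?seq"
    unfolding mtotally_bounded_sequentially
  proof (intro iffI conjI sub allI impI)
    fix \<sigma> :: "nat \<Rightarrow> _"
    assume "T ` ?U \<subseteq> carrier H \<and>
      (\<forall>\<sigma>. range \<sigma> \<subseteq> T ` ?U \<longrightarrow> (\<exists>r :: nat \<Rightarrow> nat. strict_mono r \<and> MCauchy (\<sigma> \<circ> r)))"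
      and \<sigma>: "\<forall>n. \<sigma> n \<in> carrier H \<and> hnorm H (\<sigma> n) \<le> 1"
    moreover have "range (\<lambda>n. T (\<sigma> n)) \<subseteq> T ` ?U"
      using \<sigma> by auto
    ultimately have "\<exists>r :: nat \<Rightarrow> nat. strict_mono r \<and> MCauchy ((\<lambda>n. T (\<sigma> n)) \<circ> r)"
      by (elim conjE allE impE)
    then show "\<exists>r :: nat \<Rightarrow> nat. strict_mono r \<and> MCauchy (\<lambda>n. T (\<sigma> (r n)))"
      by (simp add: o_def)
  next
    fix \<tau> :: "nat \<Rightarrow> _"
    assume seq: ?seq and \<tau>: "range \<tau> \<subseteq> T ` ?U"
    have "\<exists>x. x \<in> ?U \<and> \<tau> n = T x" for n
      using \<tau> by auto
    then obtain \<sigma> where \<sigma>: "\<And>n. \<sigma> n \<in> ?U" "\<And>n. \<tau> n = T (\<sigma> n)"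
      by metis
    have "\<exists>r :: nat \<Rightarrow> nat. strict_mono r \<and> MCauchy (\<lambda>n. T (\<sigma> (r n)))"
      using \<sigma>(1) by (intro seq[rule_format]) auto
    then show "\<exists>r :: nat \<Rightarrow> nat. strict_mono r \<and> MCauchy (\<tau> \<circ> r)"
      by (simp add: o_def \<sigma>(2))
  qed
  finally show ?thesis
    using True by (simp add: is_compact_operator_def)
qed (simp add: is_compact_operator_def)

lemma compact_operatorD:
  fixes \<sigma> :: "nat \<Rightarrow> _"
  assumes "is_compact_operator H T" and "\<And>n. \<sigma> n \<in> carrier H" "\<And>n. hnorm H (\<sigma> n) \<le> 1"
  obtains r :: "nat \<Rightarrow> nat" where "strict_mono r" "MCauchy (\<lambda>n. T (\<sigma> (r n)))"
proof -
  have "\<exists>r :: nat \<Rightarrow> nat. strict_mono r \<and> MCauchy (\<lambda>n. T (\<sigma> (r n)))"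
    using assms(2,3) by (intro assms(1)[unfolded compact_operator_iff, THEN conjunct2, rule_format]) auto
  then show thesis
    by (elim exE conjE) (rule that)
qed

lemma compact_operator_bounded: "is_compact_operator H T \<Longrightarrow> is_bounded_operator H T"
  by (simp add: is_compact_operator_def)

lemma compact_operator_add:
  assumes S: "is_compact_operator H S" and T: "is_compact_operator H T"
  shows "is_compact_operator H (\<lambda>x\<in>carrier H. S x \<oplus> T x)"
  unfolding compact_operator_iff
proof (intro conjI allI impI)
  show "is_bounded_operator H (\<lambda>x\<in>carrier H. S x \<oplus> T x)"
    by (intro bounded_operator_add compact_operator_bounded S T)
  fix \<sigma> :: "nat \<Rightarrow> _" assume \<sigma>: "\<forall>n. \<sigma> n \<in> carrier H \<and> hnorm H (\<sigma> n) \<le> 1"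
  obtain r :: "nat \<Rightarrow> nat" where r: "strict_mono r" "MCauchy (\<lambda>n. S (\<sigma> (r n)))"
    by (rule compact_operatorD[OF S, of \<sigma>]) (use \<sigma> in auto)
  \<comment> \<open>A subsequence of the first one, along which the images under \<open>S\<close>
    remain Cauchy.\<close>
  obtain r' :: "nat \<Rightarrow> nat" where r': "strict_mono r'" "MCauchy (\<lambda>n. T (\<sigma> (r (r' n))))"
    by (rule compact_operatorD[OF T, of "\<lambda>n. \<sigma> (r n)"]) (use \<sigma> in auto)
  have "MCauchy (\<lambda>n. S (\<sigma> (r (r' n))))"
    using MCauchy_subsequence[OF r'(1) r(2)] by (simp add: o_def)
  then have "MCauchy (\<lambda>n. S (\<sigma> (r (r' n))) \<oplus> T (\<sigma> (r (r' n))))"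
    using r'(2) by (rule MCauchy_add)
  then show "\<exists>r :: nat \<Rightarrow> nat. strict_mono r \<and> MCauchy (\<lambda>n. (\<lambda>x\<in>carrier H. S x \<oplus> T x) (\<sigma> (r n)))"
    using strict_mono_o[OF r(1) r'(1)] \<sigma> by (intro exI[of _ "r \<circ> r'"]) simp
qed

lemma compact_operator_comp:
  assumes S: "is_bounded_operator H S" and T: "is_compact_operator H T"
  shows "is_compact_operator H (\<lambda>x\<in>carrier H. S (T x))"
  unfolding compact_operator_iff
proof (intro conjI allI impI)
  show "is_bounded_operator H (\<lambda>x\<in>carrier H. S (T x))"
    by (intro bounded_operator_comp compact_operator_bounded S T)
  fix \<sigma> :: "nat \<Rightarrow> _" assume \<sigma>: "\<forall>n. \<sigma> n \<in> carrier H \<and> hnorm H (\<sigma> n) \<le> 1"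
  obtain r :: "nat \<Rightarrow> nat" where r: "strict_mono r" "MCauchy (\<lambda>n. T (\<sigma> (r n)))"
    by (rule compact_operatorD[OF T, of \<sigma>]) (use \<sigma> in auto)
  then show "\<exists>r :: nat \<Rightarrow> nat. strict_mono r \<and> MCauchy (\<lambda>n. (\<lambda>x\<in>carrier H. S (T x)) (\<sigma> (r n)))"
    using MCauchy_bounded_operator[OF S r(2)] \<sigma> by (intro exI[of _ r]) simp
qed

lemma compact_operator_scale:
  assumes "is_compact_operator H T"
  shows "is_compact_operator H (\<lambda>x\<in>carrier H. c \<odot> T x)"
  unfolding scale_eq_comp[OF compact_operator_bounded[OF assms]]
  using bounded_operator_scale_id assms by (rule compact_operator_comp)

text \<open>The image of a sequence in the unit ball is a bounded sequence of scalars times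
  \<open>\<xi>\<close>, so Bolzano-Weierstrass in the complex plane applies.\<close>

lemma op_rank1_compact:
  assumes \<xi>: "\<xi> \<in> carrier H" and \<eta>: "\<eta> \<in> carrier H"
  shows "is_compact_operator H (op_rank1 H \<xi> \<eta>)"
  unfolding compact_operator_iff
proof (intro conjI allI impI)
  show "is_bounded_operator H (op_rank1 H \<xi> \<eta>)"
    using assms by (rule op_rank1_bounded)
  fix \<sigma> :: "nat \<Rightarrow> _" assume \<sigma>: "\<forall>n. \<sigma> n \<in> carrier H \<and> hnorm H (\<sigma> n) \<le> 1"
  define c where "c n = cinner H (\<sigma> n) \<eta>" for n
  have "cmod (c n) \<le> hnorm H \<eta>" for n
  proof -
    have "cmod (c n) \<le> hnorm H (\<sigma> n) * hnorm H \<eta>"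
      unfolding c_def using \<sigma> \<eta> by (intro Cauchy_Schwarz) auto
    also have "\<dots> \<le> 1 * hnorm H \<eta>"
      using \<sigma> hnorm_nonneg[OF \<eta>] by (intro mult_right_mono) auto
    finally show ?thesis by simp
  qed
  then have "bounded (range c)"
    by (auto intro!: boundedI)
  then obtain l and r :: "nat \<Rightarrow> nat" where r: "strict_mono r" "(c \<circ> r) \<longlonglongrightarrow> l"
    using bounded_imp_convergent_subsequence by blast
  have Cau: "Cauchy (c \<circ> r)"
    using r(2) by (rule LIMSEQ_imp_Cauchy)
  have "MCauchy (\<lambda>n. c (r n) \<odot> \<xi>)"
    unfolding MCauchy_def
  proof (intro conjI allI impI)
    show "range (\<lambda>n. c (r n) \<odot> \<xi>) \<subseteq> carrier H"
      using \<xi> by auto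
    fix \<epsilon> :: real assume "0 < \<epsilon>"
    then have "0 < \<epsilon> / (hnorm H \<xi> + 1)"
      using hnorm_nonneg[OF \<xi>] by simp
    then obtain N where N: "\<And>n n'. N \<le> n \<Longrightarrow> N \<le> n' \<Longrightarrow>
        cmod (c (r n) - c (r n')) < \<epsilon> / (hnorm H \<xi> + 1)"
      using Cau unfolding Cauchy_def dist_norm o_def by meson
    show "\<exists>N. \<forall>n n'. N \<le> n \<longrightarrow> N \<le> n' \<longrightarrow> hdist H (c (r n) \<odot> \<xi>) (c (r n') \<odot> \<xi>) < \<epsilon>"
    proof (intro exI[of _ N] allI impI)
      fix n n' assume "N \<le> n" "N \<le> n'"
      then have "cmod (c (r n) - c (r n')) * (hnorm H \<xi> + 1) < \<epsilon>"
        using N[of n n'] hnorm_nonneg[OF \<xi>] by (simp add: pos_less_divide_eq)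
      moreover have "cmod (c (r n) - c (r n')) * hnorm H \<xi>
          \<le> cmod (c (r n) - c (r n')) * (hnorm H \<xi> + 1)"
        by (intro mult_left_mono) simp_all
      ultimately show "hdist H (c (r n) \<odot> \<xi>) (c (r n') \<odot> \<xi>) < \<epsilon>"
        using \<xi> by (simp add: d_scale_left)
    qed
  qed
  then show "\<exists>r :: nat \<Rightarrow> nat. strict_mono r \<and> MCauchy (\<lambda>n. op_rank1 H \<xi> \<eta> (\<sigma> (r n)))"
    using r(1) \<sigma> by (intro exI[of _ r]) (simp add: op_rank1_def c_def)
qed

lemma compact_operator_zero: "is_compact_operator H (\<lambda>x\<in>carrier H. \<zero>)"
  using op_rank1_compact[of \<zero> \<zero>] by (simp add: op_rank1_zero)

end

section \<open>Algebras of operators\<close>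

text \<open>Treats B(H) and K(H) together, as sets of operators that share operations and norm and
  contain the operators of rank one.\<close>

locale operator_algebra = complex_hilbert_space H
  for H :: "('h, 'm) hilbert_scheme" (structure) +
  fixes \<A> :: "('h \<Rightarrow> 'h) set"
  assumes bounded: "T \<in> \<A> \<Longrightarrow> is_bounded_operator H T"
    and add_mem: "S \<in> \<A> \<Longrightarrow> T \<in> \<A> \<Longrightarrow> (\<lambda>x\<in>carrier H. S x \<oplus> T x) \<in> \<A>"
    and scale_mem: "T \<in> \<A> \<Longrightarrow> (\<lambda>x\<in>carrier H. c \<odot> T x) \<in> \<A>"
    and comp_mem: "S \<in> \<A> \<Longrightarrow> T \<in> \<A> \<Longrightarrow> (\<lambda>x\<in>carrier H. S (T x)) \<in> \<A>"
    and rank1_mem: "\<xi> \<in> carrier H \<Longrightarrow> \<eta> \<in> carrier H \<Longrightarrow> op_rank1 H \<xi> \<eta> \<in> \<A>"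
begin

abbreviation alg :: "('h \<Rightarrow> 'h) cstar" where
  "alg \<equiv> bounded_operators H \<lparr>carrier := \<A>\<rparr>"

lemma zero_mem: "(\<lambda>x\<in>carrier H. \<zero>) \<in> \<A>"
  using rank1_mem[of \<zero> \<zero>] by (simp add: op_rank1_zero)

lemmas operatorD = bounded_operatorD[OF bounded]

lemma operator_eqI:
  assumes "T \<in> \<A>" "\<And>x. x \<in> carrier H \<Longrightarrow> F x = T x"
  shows "(\<lambda>x\<in>carrier H. F x) = T"
  by (rule extensionalityI[OF restrict_extensional operatorD(1)[OF assms(1)]]) (simp add: assms(2))

lemma module_alg: "Module.module complex_ring alg"
proof (rule moduleI)
  show "cring complex_ring"
    by (rule R.is_cring)
  show "abelian_group alg"
  proof (rule abelian_groupI)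
    fix T assume T: "T \<in> carrier alg"
    show "\<exists>S\<in>carrier alg. S \<oplus>\<^bsub>alg\<^esub> T = \<zero>\<^bsub>alg\<^esub>"
    proof (rule bexI)
      show "(\<lambda>x\<in>carrier H. (- 1) \<odot> T x) \<oplus>\<^bsub>alg\<^esub> T = \<zero>\<^bsub>alg\<^esub>"
        using T by (auto intro!: restrict_ext simp: operatorD M.a_comm[of "(- 1) \<odot> _"] diff_self)
      show "(\<lambda>x\<in>carrier H. (- 1) \<odot> T x) \<in> carrier alg"
        using T by (simp add: scale_mem)
    qed
    show "\<zero>\<^bsub>alg\<^esub> \<oplus>\<^bsub>alg\<^esub> T = T"
      using T by (auto intro!: operator_eqI simp: operatorD)
  qed (auto intro!: restrict_ext add_mem zero_mem simp: operatorD M.a_ac)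
  fix a b S T assume S: "S \<in> carrier alg" and T: "T \<in> carrier alg"
  then have cl: "S x \<in> carrier H" "T x \<in> carrier H" if "x \<in> carrier H" for x
    using that operatorD(2)[of S x] operatorD(2)[of T x] by simp_all
  show "\<one>\<^bsub>complex_ring\<^esub> \<odot>\<^bsub>alg\<^esub> T = T"
    using T operator_eqI[of T "\<lambda>x. 1 \<odot> T x"] by (simp add: cl)
  show "a \<odot>\<^bsub>alg\<^esub> T \<in> carrier alg"
    using T by (simp add: scale_mem)
  show "(a \<oplus>\<^bsub>complex_ring\<^esub> b) \<odot>\<^bsub>alg\<^esub> T = a \<odot>\<^bsub>alg\<^esub> T \<oplus>\<^bsub>alg\<^esub> b \<odot>\<^bsub>alg\<^esub> T"
    by (simp, rule restrict_ext) (simp add: cl scale_add_left)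
  show "a \<odot>\<^bsub>alg\<^esub> (S \<oplus>\<^bsub>alg\<^esub> T) = a \<odot>\<^bsub>alg\<^esub> S \<oplus>\<^bsub>alg\<^esub> a \<odot>\<^bsub>alg\<^esub> T"
    by (simp, rule restrict_ext) (simp add: cl scale_add_right)
  show "(a \<otimes>\<^bsub>complex_ring\<^esub> b) \<odot>\<^bsub>alg\<^esub> T = a \<odot>\<^bsub>alg\<^esub> (b \<odot>\<^bsub>alg\<^esub> T)"
    by (simp, rule restrict_ext) (simp add: cl scale_scale)
qed

lemma normed_algebra_alg: "normed_algebra alg"
proof -
  interpret alg: complex_module alg
    by (rule complex_module.intro[OF module_alg])
  show ?thesis
  proof
    fix S T U c assume "S \<in> carrier alg" "T \<in> carrier alg"
    then have ST: "S \<in> \<A>" "T \<in> \<A>" by simp_all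
    note bd = bounded[OF ST(1)] bounded[OF ST(2)]
    note S = bounded_operatorD[OF bd(1)] and T = bounded_operatorD[OF bd(2)]
    show "S \<otimes>\<^bsub>alg\<^esub> T \<in> carrier alg"
      using ST by (simp add: comp_mem)
    show "(c \<odot>\<^bsub>alg\<^esub> S) \<otimes>\<^bsub>alg\<^esub> T = c \<odot>\<^bsub>alg\<^esub> (S \<otimes>\<^bsub>alg\<^esub> T)"
      by (simp, rule restrict_ext) (simp add: T)
    show "S \<otimes>\<^bsub>alg\<^esub> (c \<odot>\<^bsub>alg\<^esub> T) = c \<odot>\<^bsub>alg\<^esub> (S \<otimes>\<^bsub>alg\<^esub> T)"
      by (simp, rule restrict_ext) (simp add: T S)
    show "nrm alg S = 0 \<longleftrightarrow> S = \<zero>\<^bsub>alg\<^esub>"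
      by (simp add: operator_norm_eq_0[OF bd(1)])
    show "nrm alg (S \<oplus>\<^bsub>alg\<^esub> T) \<le> nrm alg S + nrm alg T"
      by (simp add: operator_norm_add[OF bd])
    show "nrm alg (c \<odot>\<^bsub>alg\<^esub> S) = cmod c * nrm alg S"
      by (simp add: operator_norm_scale[OF bd(1)])
    show "nrm alg (S \<otimes>\<^bsub>alg\<^esub> T) \<le> nrm alg S * nrm alg T"
      by (simp add: operator_norm_comp[OF bd])
    assume "U \<in> carrier alg"
    then have "U \<in> \<A>" by simp
    note U = bounded_operatorD[OF bounded[OF this]]
    show "(S \<otimes>\<^bsub>alg\<^esub> T) \<otimes>\<^bsub>alg\<^esub> U = S \<otimes>\<^bsub>alg\<^esub> (T \<otimes>\<^bsub>alg\<^esub> U)"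
      by (simp, rule restrict_ext) (simp add: U)
    show "(S \<oplus>\<^bsub>alg\<^esub> T) \<otimes>\<^bsub>alg\<^esub> U = S \<otimes>\<^bsub>alg\<^esub> U \<oplus>\<^bsub>alg\<^esub> T \<otimes>\<^bsub>alg\<^esub> U"
      by (simp, rule restrict_ext) (simp add: U)
    show "U \<otimes>\<^bsub>alg\<^esub> (S \<oplus>\<^bsub>alg\<^esub> T) = U \<otimes>\<^bsub>alg\<^esub> S \<oplus>\<^bsub>alg\<^esub> U \<otimes>\<^bsub>alg\<^esub> T"
      by (simp, rule restrict_ext) (simp add: U S T)
  qed
qed

lemma coefficient_representation_alg: "coefficient_representation alg H (\<lambda>T. T) (op_rank1 H)"
proof -
  interpret alg: normed_algebra alg
    by (rule normed_algebra_alg)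
  show ?thesis
  proof
    fix \<xi> \<eta> \<zeta> assume v: "\<xi> \<in> carrier H" "\<eta> \<in> carrier H"
    show "op_rank1 H \<xi> \<eta> \<in> carrier alg"
      using v by (simp add: rank1_mem)
    show "op_rank1 H \<xi> \<eta> \<zeta> = cinner H \<zeta> \<eta> \<odot> \<xi>" if "\<zeta> \<in> carrier H"
      using that by (simp add: op_rank1_def)
  next
    fix S T \<xi> \<zeta> c assume "T \<in> carrier alg" and \<xi>: "\<xi> \<in> carrier H"
    then have "T \<in> \<A>" by simp
    note T = bounded_operatorD[OF bounded[OF this]]
    show "T \<xi> \<in> carrier H" "T (c \<odot> \<xi>) = c \<odot> T \<xi>" "(c \<odot>\<^bsub>alg\<^esub> T) \<xi> = c \<odot> T \<xi>"
      "(S \<oplus>\<^bsub>alg\<^esub> T) \<xi> = S \<xi> \<oplus> T \<xi>" "(S \<otimes>\<^bsub>alg\<^esub> T) \<xi> = S (T \<xi>)"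
      using \<xi> by (simp_all add: T)
    show "T (\<xi> \<oplus> \<zeta>) = T \<xi> \<oplus> T \<zeta>" if "\<zeta> \<in> carrier H"
      using \<xi> that by (rule T)
  next
    fix T \<xi> \<eta> \<xi>' \<eta>' assume "T \<in> carrier alg" and v: "\<xi> \<in> carrier H" "\<eta> \<in> carrier H"
      "\<xi>' \<in> carrier H" "\<eta>' \<in> carrier H"
    then have "T \<in> \<A>" by simp
    note T = bounded_operatorD[OF bounded[OF this]]
    show "(op_rank1 H \<xi> \<eta> \<otimes>\<^bsub>alg\<^esub> T) \<otimes>\<^bsub>alg\<^esub> op_rank1 H \<xi>' \<eta>'
        = cinner H (T \<xi>') \<eta> \<odot>\<^bsub>alg\<^esub> op_rank1 H \<xi> \<eta>'"
      by (simp, rule restrict_ext)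
        (simp add: op_rank1_def v T cinner_smult_left scale_scale mult.commute)
  qed
qed

text \<open>The identity representation alone separates operators, whence the one-element index
  set.\<close>

theorem weak_2_local_derivation_alg:
  assumes "locally_compact_space L" "Hausdorff_space L"
    and "weak_2_local_derivation (C0 L alg) \<Delta>"
  shows "derivation (C0 L alg) \<Delta>"
proof (rule normed_algebra.weak_2_local_derivation_imp_derivation[OF normed_algebra_alg assms(1,2) _ _ assms(3)])
  show "coefficient_representation alg H (\<lambda>T. T) (op_rank1 H)" if "i \<in> {()}" for i
    by (rule coefficient_representation_alg)
  fix S T assume ST: "S \<in> carrier alg" "T \<in> carrier alg"
    and eq: "\<And>i \<xi>. \<lbrakk>i \<in> {()}; \<xi> \<in> carrier H\<rbrakk> \<Longrightarrow> S \<xi> = T \<xi>"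
  show "S = T"
  proof (rule extensionalityI)
    show "S \<in> extensional (carrier H)" "T \<in> extensional (carrier H)"
      using ST operatorD(1)[of S] operatorD(1)[of T] by simp_all
    show "S \<xi> = T \<xi>" if "\<xi> \<in> carrier H" for \<xi>
      by (rule eq[of "()"]) (simp_all add: that)
  qed
qed

end

context complex_hilbert_space
begin

lemma operator_algebra_bounded: "operator_algebra H {T. is_bounded_operator H T}"
  by unfold_locales
    (simp_all add: bounded_operator_add bounded_operator_scale bounded_operator_comp op_rank1_bounded)

lemma operator_algebra_compact: "operator_algebra H {T. is_compact_operator H T}"
  by unfold_locales
    (simp_all add: compact_operator_bounded compact_operator_add compact_operator_scale
      compact_operator_comp op_rank1_compact)

end

section \<open>Direct sums of algebras of operators\<close>

text \<open>The i-th coordinate of \<open>f m\<close> acts on \<open>H i\<close>; a rank one element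
  is the preimage of a family concentrated at \<open>i\<close>. The sandwich identity is transported
  by injectivity and checked in each coordinate, where both sides vanish away from
  \<open>i\<close>.\<close>

lemma direct_sum_coefficient_representation:
  fixes M :: "'a cstar" and H :: "'i \<Rightarrow> 'h hilbert"
  assumes M: "normed_algebra M" and H: "\<And>i. i \<in> I \<Longrightarrow> complex_hilbert_space (H i)"
    and bij: "bij_betw f (carrier M) S"
    and S: "S \<subseteq> (\<Pi>\<^sub>E i\<in>I. {T. is_bounded_operator (H i) T})"
    and single: "\<And>i \<xi> \<eta>. \<lbrakk>i \<in> I; \<xi> \<in> carrier (H i); \<eta> \<in> carrier (H i)\<rbrakk> \<Longrightarrow>
      (\<lambda>j\<in>I. if j = i then op_rank1 (H i) \<xi> \<eta> else (\<lambda>x\<in>carrier (H j). \<zero>\<^bsub>H j\<^esub>)) \<in> S"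
    and add: "\<And>x y. \<lbrakk>x \<in> carrier M; y \<in> carrier M\<rbrakk> \<Longrightarrow>
      f (x \<oplus>\<^bsub>M\<^esub> y) = (\<lambda>i\<in>I. \<lambda>\<xi>\<in>carrier (H i). f x i \<xi> \<oplus>\<^bsub>H i\<^esub> f y i \<xi>)"
    and scale: "\<And>c x. x \<in> carrier M \<Longrightarrow>
      f (c \<odot>\<^bsub>M\<^esub> x) = (\<lambda>i\<in>I. \<lambda>\<xi>\<in>carrier (H i). c \<odot>\<^bsub>H i\<^esub> f x i \<xi>)"
    and mult: "\<And>x y. \<lbrakk>x \<in> carrier M; y \<in> carrier M\<rbrakk> \<Longrightarrow>
      f (x \<otimes>\<^bsub>M\<^esub> y) = (\<lambda>i\<in>I. \<lambda>\<xi>\<in>carrier (H i). f x i (f y i \<xi>))"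
    and i: "i \<in> I"
  shows "coefficient_representation M (H i) (\<lambda>m. f m i)
    (\<lambda>\<xi> \<eta>. inv_into (carrier M) f
      (\<lambda>j\<in>I. if j = i then op_rank1 (H i) \<xi> \<eta> else (\<lambda>x\<in>carrier (H j). \<zero>\<^bsub>H j\<^esub>)))"
proof -
  interpret normed_algebra M by (rule M)
  interpret Hi: complex_hilbert_space "H i" by (rule H[OF i])
  let ?s = "\<lambda>\<xi> \<eta>. (\<lambda>j\<in>I. if j = i then op_rank1 (H i) \<xi> \<eta> else (\<lambda>x\<in>carrier (H j). \<zero>\<^bsub>H j\<^esub>))"
  let ?r = "\<lambda>\<xi> \<eta>. inv_into (carrier M) f (?s \<xi> \<eta>)"
  have inj: "inj_on f (carrier M)" and im: "f ` carrier M = S"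
    using bij by (auto simp: bij_betw_def)
  have fS: "f m \<in> (\<Pi>\<^sub>E i\<in>I. {T. is_bounded_operator (H i) T})" if "m \<in> carrier M" for m
    using S im that by auto
  have bounded: "is_bounded_operator (H j) (f m j)" if "m \<in> carrier M" "j \<in> I" for m j
    using fS[OF that(1)] that(2) by auto
  note bd = Hi.bounded_operatorD[OF bounded[OF _ i]]
  have r: "?r \<xi> \<eta> \<in> carrier M" "f (?r \<xi> \<eta>) = ?s \<xi> \<eta>"
    if "\<xi> \<in> carrier (H i)" "\<eta> \<in> carrier (H i)" for \<xi> \<eta>
  proof -
    have "?s \<xi> \<eta> \<in> f ` carrier M"
      using single[OF i that] im by simp
    then show "?r \<xi> \<eta> \<in> carrier M" "f (?r \<xi> \<eta>) = ?s \<xi> \<eta>"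
      by (rule inv_into_into, rule f_inv_into_f)
  qed
  have sandwich: "(?r \<xi> \<eta> \<otimes>\<^bsub>M\<^esub> m) \<otimes>\<^bsub>M\<^esub> ?r \<xi>' \<eta>' = cinner (H i) (f m i \<xi>') \<eta> \<odot>\<^bsub>M\<^esub> ?r \<xi> \<eta>'"
    if m: "m \<in> carrier M" and v: "\<xi> \<in> carrier (H i)" "\<eta> \<in> carrier (H i)"
      "\<xi>' \<in> carrier (H i)" "\<eta>' \<in> carrier (H i)" for m \<xi> \<eta> \<xi>' \<eta>'
  proof (rule inj_onD[OF inj])
    note rr = r[OF v(1,2)] r[OF v(3,4)] r[OF v(1,4)]
    show "f ((?r \<xi> \<eta> \<otimes>\<^bsub>M\<^esub> m) \<otimes>\<^bsub>M\<^esub> ?r \<xi>' \<eta>') = f (cinner (H i) (f m i \<xi>') \<eta> \<odot>\<^bsub>M\<^esub> ?r \<xi> \<eta>')"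
      unfolding mult[OF mult_closed[OF rr(1) m] rr(3)] mult[OF rr(1) m] scale[OF rr(5)]
        rr(2) rr(4) rr(6)
    proof (intro restrict_ext)
      fix j z assume j: "j \<in> I" and z: "z \<in> carrier (H j)"
      interpret Hj: complex_hilbert_space "H j" by (rule H[OF j])
      have bj: "f m j w \<in> carrier (H j)" if "w \<in> carrier (H j)" for w
        using Hj.bounded_operatorD(2)[OF bounded[OF m j] that] .
      show "(\<lambda>k\<in>I. \<lambda>w\<in>carrier (H k). ?s \<xi> \<eta> k (f m k w)) j (?s \<xi>' \<eta>' j z)
          = cinner (H i) (f m i \<xi>') \<eta> \<odot>\<^bsub>H j\<^esub> ?s \<xi> \<eta>' j z"
      proof (cases "j = i")
        case True
        then show ?thesis
          using j z v bd[OF m] by (simp add: op_rank1_def Hi.cinner_smult_left Hi.scale_scale mult.commute)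
      next
        case False
        then show ?thesis
          using j z bj by simp
      qed
    qed
  qed (use r m v in simp_all)
  show ?thesis
  proof unfold_locales
    show "f (?r \<xi> \<eta>) i \<zeta> = cinner (H i) \<zeta> \<eta> \<odot>\<^bsub>H i\<^esub> \<xi>"
      if "\<xi> \<in> carrier (H i)" "\<eta> \<in> carrier (H i)" "\<zeta> \<in> carrier (H i)" for \<xi> \<eta> \<zeta>
      using r(2)[OF that(1,2)] that(3) i by (simp add: op_rank1_def)
  qed (use sandwich r(1) i in \<open>simp_all add: bd add scale mult\<close>)
qed

text \<open>\<open>S\<close> is left open so that bounded families of bounded operators and null
  families of compact operators are covered by one argument.\<close>

theorem weak_2_local_derivation_direct_sum:
  fixes M :: "'a cstar" and H :: "'i \<Rightarrow> 'h hilbert"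
  assumes L: "locally_compact_space L" "Hausdorff_space L"
    and MH: "cstar_algebra M" "\<And>i. i \<in> I \<Longrightarrow> complex_hilbert_space (H i)"
    and iso: "star_isomorphic M ((linf_sum I (\<lambda>i. bounded_operators (H i))) \<lparr>carrier := S\<rparr>)"
    and S: "S \<subseteq> (\<Pi>\<^sub>E i\<in>I. {T. is_bounded_operator (H i) T})"
    and single: "\<And>i \<xi> \<eta>. \<lbrakk>i \<in> I; \<xi> \<in> carrier (H i); \<eta> \<in> carrier (H i)\<rbrakk> \<Longrightarrow>
      (\<lambda>j\<in>I. if j = i then op_rank1 (H i) \<xi> \<eta> else (\<lambda>x\<in>carrier (H j). \<zero>\<^bsub>H j\<^esub>)) \<in> S"
    and weak: "weak_2_local_derivation (C0 L M) \<Delta>"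
  shows "derivation (C0 L M) \<Delta>"
proof -
  obtain f where f: "star_isomorphism M ((linf_sum I (\<lambda>i. bounded_operators (H i))) \<lparr>carrier := S\<rparr>) f"
    using iso unfolding star_isomorphic_def by (rule exE)
  have bij: "bij_betw f (carrier M) S"
    and add: "\<And>x y. \<lbrakk>x \<in> carrier M; y \<in> carrier M\<rbrakk> \<Longrightarrow>
      f (x \<oplus>\<^bsub>M\<^esub> y) = (\<lambda>i\<in>I. \<lambda>\<xi>\<in>carrier (H i). f x i \<xi> \<oplus>\<^bsub>H i\<^esub> f y i \<xi>)"
    and scale: "\<And>c x. x \<in> carrier M \<Longrightarrow>
      f (c \<odot>\<^bsub>M\<^esub> x) = (\<lambda>i\<in>I. \<lambda>\<xi>\<in>carrier (H i). c \<odot>\<^bsub>H i\<^esub> f x i \<xi>)"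
    and mult: "\<And>x y. \<lbrakk>x \<in> carrier M; y \<in> carrier M\<rbrakk> \<Longrightarrow>
      f (x \<otimes>\<^bsub>M\<^esub> y) = (\<lambda>i\<in>I. \<lambda>\<xi>\<in>carrier (H i). f x i (f y i \<xi>))"
    using f unfolding star_isomorphism_def linf_sum_def by simp_all
  have M: "normed_algebra M"
    by (rule cstar_algebra_imp_normed_algebra[OF MH(1)])
  show ?thesis
  proof (rule normed_algebra.weak_2_local_derivation_imp_derivation[OF M L _ _ weak])
    show "coefficient_representation M (H i) (\<lambda>m. f m i)
      (\<lambda>\<xi> \<eta>. inv_into (carrier M) f
        (\<lambda>j\<in>I. if j = i then op_rank1 (H i) \<xi> \<eta> else (\<lambda>x\<in>carrier (H j). \<zero>\<^bsub>H j\<^esub>)))"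
      if "i \<in> I" for i
      by (rule direct_sum_coefficient_representation[OF M MH(2) bij S single add scale mult that])
    fix m n assume mn: "m \<in> carrier M" "n \<in> carrier M"
      and eq: "\<And>i \<xi>. \<lbrakk>i \<in> I; \<xi> \<in> carrier (H i)\<rbrakk> \<Longrightarrow> f m i \<xi> = f n i \<xi>"
    have PiE: "f k \<in> (\<Pi>\<^sub>E i\<in>I. {T. is_bounded_operator (H i) T})" if "k \<in> carrier M" for k
      using bij S that by (auto simp: bij_betw_def)
    have "f m = f n"
    proof (rule PiE_ext[OF PiE[OF mn(1)] PiE[OF mn(2)]])
      fix i assume i: "i \<in> I"
      interpret complex_hilbert_space "H i" by (rule MH(2)[OF i])
      have "is_bounded_operator (H i) (f m i)" "is_bounded_operator (H i) (f n i)"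
        using PiE[OF mn(1)] PiE[OF mn(2)] i by auto
      from this[THEN bounded_operatorD(1)] show "f m i = f n i"
        by (rule extensionalityI) (rule eq[OF i])
    qed
    then show "m = n"
      using bij mn by (auto simp: bij_betw_def dest: inj_onD)
  qed
qed

lemma atomic_von_neumann_algebra_derivation:
  fixes M :: "'a cstar" and H :: "'i \<Rightarrow> 'h hilbert"
  assumes L: "locally_compact_space L" "Hausdorff_space L"
    and M: "atomic_von_neumann_algebra I H M"
    and weak: "weak_2_local_derivation (C0 L M) \<Delta>"
  shows "derivation (C0 L M) \<Delta>"
proof -
  let ?A = "\<lambda>i. bounded_operators (H i)"
  let ?S = "{x \<in> \<Pi>\<^sub>E i\<in>I. carrier (?A i). bdd_above ((\<lambda>i. nrm (?A i) (x i)) ` I)}"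
  have H: "complex_hilbert_space (H i)" if "i \<in> I" for i
    using M that by (simp add: atomic_von_neumann_algebra_def)
  show ?thesis
  proof (rule weak_2_local_derivation_direct_sum[OF L _ H _ _ _ weak])
    show "cstar_algebra M"
      using M by (simp add: atomic_von_neumann_algebra_def)
    show "star_isomorphic M ((linf_sum I ?A) \<lparr>carrier := ?S\<rparr>)"
      using M by (simp add: atomic_von_neumann_algebra_def linf_sum_def)
    show "?S \<subseteq> (\<Pi>\<^sub>E i\<in>I. {T. is_bounded_operator (H i) T})"
      by auto
    fix i \<xi> \<eta> assume i: "i \<in> I" and v: "\<xi> \<in> carrier (H i)" "\<eta> \<in> carrier (H i)"
    let ?s = "\<lambda>j\<in>I. if j = i then op_rank1 (H i) \<xi> \<eta> else (\<lambda>x\<in>carrier (H j). \<zero>\<^bsub>H j\<^esub>)"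
    have "(\<lambda>j. nrm (?A j) (?s j)) ` I \<subseteq> {operator_norm (H i) (op_rank1 (H i) \<xi> \<eta>), 0}"
      using complex_hilbert_space.operator_norm_zero[OF H] by auto
    then have "bdd_above ((\<lambda>j. nrm (?A j) (?s j)) ` I)"
      by (rule bdd_above_mono[rotated]) simp
    moreover have "is_bounded_operator (H j) (?s j)" if j: "j \<in> I" for j
      using complex_hilbert_space.op_rank1_bounded[OF H[OF i] v] j
        complex_hilbert_space.bounded_operator_zero[OF H[OF j]] by simp
    ultimately show "?s \<in> ?S"
      by auto
  qed
qed

lemma compact_cstar_algebra_derivation:
  fixes M :: "'a cstar" and H :: "'i \<Rightarrow> 'h hilbert"
  assumes L: "locally_compact_space L" "Hausdorff_space L"
    and M: "compact_cstar_algebra I H M"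
    and weak: "weak_2_local_derivation (C0 L M) \<Delta>"
  shows "derivation (C0 L M) \<Delta>"
proof -
  let ?A = "\<lambda>i. compact_operators (H i)"
  let ?S = "{x \<in> \<Pi>\<^sub>E i\<in>I. carrier (?A i). \<forall>\<epsilon>>0. finite {i \<in> I. \<epsilon> \<le> nrm (?A i) (x i)}}"
  have H: "complex_hilbert_space (H i)" if "i \<in> I" for i
    using M that by (simp add: compact_cstar_algebra_def)
  show ?thesis
  proof (rule weak_2_local_derivation_direct_sum[OF L _ H _ _ _ weak])
    show "cstar_algebra M"
      using M by (simp add: compact_cstar_algebra_def)
    \<comment> \<open>The c_0-sum of the K(H_i) and the l_infinity-sum of the B(H_i) differ in their
      carriers only.\<close>
    show "star_isomorphic M ((linf_sum I (\<lambda>i. bounded_operators (H i))) \<lparr>carrier := ?S\<rparr>)"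
      using M by (simp add: compact_cstar_algebra_def c0_sum_def linf_sum_def compact_operators_def
          bounded_operators_def)
    show "?S \<subseteq> (\<Pi>\<^sub>E i\<in>I. {T. is_bounded_operator (H i) T})"
      by (auto simp: compact_operators_def is_compact_operator_def)
    fix i \<xi> \<eta> assume i: "i \<in> I" and v: "\<xi> \<in> carrier (H i)" "\<eta> \<in> carrier (H i)"
    let ?s = "\<lambda>j\<in>I. if j = i then op_rank1 (H i) \<xi> \<eta> else (\<lambda>x\<in>carrier (H j). \<zero>\<^bsub>H j\<^esub>)"
    have "finite {j \<in> I. \<epsilon> \<le> nrm (?A j) (?s j)}" if "0 < \<epsilon>" for \<epsilon>
    proof (rule finite_subset)
      show "{j \<in> I. \<epsilon> \<le> nrm (?A j) (?s j)} \<subseteq> {i}"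
        using that complex_hilbert_space.operator_norm_zero[OF H]
        by (auto simp: compact_operators_def bounded_operators_def)
    qed simp
    moreover have "is_compact_operator (H j) (?s j)" if j: "j \<in> I" for j
      using complex_hilbert_space.op_rank1_compact[OF H[OF i] v] j
        complex_hilbert_space.compact_operator_zero[OF H[OF j]] by simp
    ultimately show "?s \<in> ?S"
      by (auto simp: compact_operators_def)
  qed
qed

theorem theorem2p7:
  fixes L :: "'l topology"
  assumes "locally_compact_space L" and "Hausdorff_space L"
  shows "(\<forall>(M :: 'a cstar) (I :: 'i set) (H :: 'i \<Rightarrow> 'h hilbert).
            atomic_von_neumann_algebra I H M \<or> compact_cstar_algebra I H M \<longrightarrow>
              (\<forall>\<Delta>. weak_2_local_derivation (C0 L M) \<Delta> \<longrightarrow> derivation (C0 L M) \<Delta>)) \<and>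
         (\<forall>H :: 'k hilbert. complex_hilbert_space H \<longrightarrow>
            (\<forall>\<Delta>. weak_2_local_derivation (C0 L (bounded_operators H)) \<Delta> \<longrightarrow>
                  derivation (C0 L (bounded_operators H)) \<Delta>) \<and>
            (\<forall>\<Delta>. weak_2_local_derivation (C0 L (compact_operators H)) \<Delta> \<longrightarrow>
                  derivation (C0 L (compact_operators H)) \<Delta>))"
proof (intro conjI allI impI)
  fix M :: "'a cstar" and I :: "'i set" and H :: "'i \<Rightarrow> 'h hilbert" and \<Delta>
  assume "atomic_von_neumann_algebra I H M \<or> compact_cstar_algebra I H M"
    and weak: "weak_2_local_derivation (C0 L M) \<Delta>"
  then show "derivation (C0 L M) \<Delta>"
    using atomic_von_neumann_algebra_derivation[OF assms _ weak]
      compact_cstar_algebra_derivation[OF assms _ weak] by (elim disjE)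
next
  fix H :: "'k hilbert" and \<Delta>
  assume "complex_hilbert_space H"
  then interpret complex_hilbert_space H .
  assume weak: "weak_2_local_derivation (C0 L (bounded_operators H)) \<Delta>"
  \<comment> \<open>B(H) and K(H) are treated as operator algebras on \<open>H\<close>; as direct
    sums with one summand they would first have to be shown to satisfy
    \<open>cstar_algebra\<close>.\<close>
  have "bounded_operators H = bounded_operators H \<lparr>carrier := {T. is_bounded_operator H T}\<rparr>"
    by (simp add: bounded_operators_def)
  then show "derivation (C0 L (bounded_operators H)) \<Delta>"
    using operator_algebra.weak_2_local_derivation_alg[OF operator_algebra_bounded assms] weak
    by metis
next
  fix H :: "'k hilbert" and \<Delta>
  assume "complex_hilbert_space H"
  then interpret complex_hilbert_space H .
  assume "weak_2_local_derivation (C0 L (compact_operators H)) \<Delta>"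
  then show "derivation (C0 L (compact_operators H)) \<Delta>"
    using operator_algebra.weak_2_local_derivation_alg[OF operator_algebra_compact assms]
    unfolding compact_operators_def by metis
qed

end
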